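(* Let $n\ge1$ and let $\lambda\in\mathbb C$, $\lambda\neq0$. Then $\mathcal S(R_-^n)_\lambda$ is a representation of the group $\widehat{GL_n}(F)_0$, where an element of $\widehat{GL_n}(F)_0$ represented by $(t^l,(g,\mu))$ acts by $$\pi(t^l,(g,\mu))f(x)=\lambda^l\,\pi(g,\mu)f(x)=\lambda^l\int_{V_g}f(g^{-1}x+y)\,\mu(dy).$$ By restriction, $\mathcal S(R_-^n)_\lambda$ is a representation of $\widehat{SL_n}(F)$.
   Context: $F=\mathbb R((t))$, $R=\mathbb R[[t]]$, $R_-=\mathbb R[t^{-1}]t^{-1}$, so $F^n=R^n\oplus R_-^n$. A complex-valued function on $R_-^n=\mathbb R^n[t^{-1}]t^{-1}$ is Schwartz if its restriction to every finite-dimensional subspace is a Schwartz function; $\mathcal S(R_-^n)$ is the space of these. Functions on $R_-^n$ are identified with $R^n$-periodic functions on $F^n$ via pull-back along the projection $F^n\to R_-^n$ with kernel $R^n$. $M_n(R)'$ is the semigroup of $n\times n$ matrices over $R$ with non-zero determinant. For $g\in M_n(R)'$, $V_g=g^{-1}R^n/R^n$ (a finite-dimensional real vector space). $\widehat{M_n}(R)'$ is the semigroup of pairs $(g,\mu)$ with $g\in M_n(R)'$ and $\mu$ a Haar measure on $V_g$, with product $(g_1,\mu_1)(g_2,\mu_2)=(g_1g_2,\mu_1\ast\mu_2)$, where $$\int_{V_{g_1g_2}} f(x)\,(\mu_1\ast\mu_2)(dx)=\int_{V_{g_1}}\int_{V_{g_2}} f(g_2^{-1}y+z)\,\mu_2(dz)\,\mu_1(dy).$$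 It acts on $\mathcal S(R_-^n)$ by $\pi(g,\mu)f(x)=\int_{V_g}f(g^{-1}x+y)\,\mu(dy)$. On $V_{t^lI_n}$, $l\ge0$, $\mu_{st}$ is the Haar measure induced by the inner product for which $\{t^{-i}e_j:1\le i\le l,1\le j\le n\}$ is orthonormal (counting measure if $l=0$). Put $\pi_t=\pi(tI_n,\mu_{st})$ and $$\mathcal S(R_-^n)_\lambda=\{f\in\mathcal S(R_-^n):\pi_tf=\lambda f\}.$$ $GL_n(F)_0=\{g\in GL_n(F):\det g\text{ has leading coefficient }\pm1\}$ (leading coefficient = coefficient of the lowest power of $t$). $\widehat{M_n}(R)_0'$ is the subsemigroup of pairs $(g,\mu)\in\widehat{M_n}(R)'$ with $g\in GL_n(F)_0$. Let $\tilde G=\{t^kI_n:k\in\mathbb Z\}\times\widehat{M_n}(R)_0'$ (direct product semigroup) and let $\sim$ be the equivalence relation generated by $(t^{k+l},\alpha)\sim(t^k,(t^lI_n,\mu_{st})\alpha)$ for $k\in\mathbb Z$, $l\in\mathbb Z_{\ge0}$ (writing $t^k$ for $t^kI_n$). The quotient $\widehat{GL_n}(F)_0:=\tilde G/\!\sim$ is a group, a central extension of $GL_n(F)_0$ by $\mathbb R_{>0}$ via $(t^k,(g,\mu))\mapsto t^kg$; $\widehat{SL_n}(F)$ is the inverse image of $SL_n(F)$ in it. *)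

theory Defs
  imports
    "HOL-Analysis.Analysis"
    "HOL-Computational_Algebra.Formal_Laurent_Series"
    "HOL-Algebra.Group_Action"
begin

section \<open>The decomposition of F^n, where F = R((t))\<close>

text \<open>The field F is the type \<^typ>\<open>real fls\<close>, its variable t is \<^const>\<open>fls_X\<close>, and n is the
  cardinality of the index type.\<close>

type_synonym 'n Fvec = "(real fls, 'n) vec"
type_synonym 'n Fmat = "((real fls, 'n) vec, 'n) vec"

definition R_vecs :: "('n::finite) Fvec set" where
  "R_vecs = {x. \<forall>j. x $ j \<in> range fps_to_fls}"

definition Rminus_vecs :: "('n::finite) Fvec set" where
  "Rminus_vecs = {x. \<forall>j. \<forall>i\<ge>0. fls_nth (x $ j) i = 0}"

text \<open>The projection of F^n onto its summand \<^const>\<open>Rminus_vecs\<close>, with kernel \<^const>\<open>R_vecs\<close>.\<close>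

definition proj_minus :: "('n::finite) Fvec \<Rightarrow> 'n Fvec" where
  "proj_minus x = (\<chi> j. x $ j - fps_to_fls (fls_regpart (x $ j)))"

text \<open>The real vector space structure of F^n.\<close>

abbreviation rscale :: "real \<Rightarrow> ('n::finite) Fvec \<Rightarrow> 'n Fvec" where
  "rscale c x \<equiv> fls_const c *s x"

interpretation real_Fvec: vector_space "rscale :: real \<Rightarrow> ('n::finite) Fvec \<Rightarrow> 'n Fvec"
  by unfold_locales
     (simp_all add: vec_eq_iff algebra_simps fls_plus_const[symmetric]
        fls_const_mult_const[symmetric] del: fls_const_mult_const)

definition fin_dim_subspace :: "('n::finite) Fvec set \<Rightarrow> bool" where
  "fin_dim_subspace W \<longleftrightarrow> real_Fvec.subspace W \<and> (\<exists>B. finite B \<and> W = real_Fvec.span B)"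

text \<open>A finite-dimensional real subspace of \<^const>\<open>Rminus_vecs\<close> carries its usual topology, which is
  the initial topology for the coefficient functionals. (The t-adic topology, which is the
  topological space instance on \<^typ>\<open>real fls\<close>, plays no role here.)\<close>

definition coords :: "('n::finite) Fvec \<Rightarrow> 'n \<times> int \<Rightarrow> real" where
  "coords x = (\<lambda>(j, i). fls_nth (x $ j) i)"

definition fd_topology :: "('n::finite) Fvec set \<Rightarrow> 'n Fvec topology" where
  "fd_topology W = pullback_topology W coords euclidean"

definition fd_borel :: "('n::finite) Fvec set \<Rightarrow> 'n Fvec measure" where
  "fd_borel W = sigma W {U. openin (fd_topology W) U}"


section \<open>Schwartz functions\<close>

text \<open>The sum of the absolute values of the coefficients; it restricts to a norm on
  \<^const>\<open>Rminus_vecs\<close>, whose elements have only finitely many non-zero coefficients.\<close>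

definition coeff_norm :: "('n::finite) Fvec \<Rightarrow> real" where
  "coeff_norm x = (\<Sum>j\<in>UNIV. \<Sum>i | fls_nth (x $ j) i \<noteq> 0. \<bar>fls_nth (x $ j) i\<bar>)"

fun dir_deriv :: "('n::finite) Fvec list \<Rightarrow> ('n Fvec \<Rightarrow> complex) \<Rightarrow> 'n Fvec \<Rightarrow> complex" where
  "dir_deriv [] f = f"
| "dir_deriv (v # vs) f =
     (\<lambda>x. vector_derivative (\<lambda>s. dir_deriv vs f (x + rscale s v)) (at 0))"

text \<open>All iterated directional derivatives of the restriction of f to W exist, are continuous
  and are rapidly decreasing. Only the values of f on W enter, since W is a subspace.\<close>

definition schwartz_on :: "('n::finite) Fvec set \<Rightarrow> ('n Fvec \<Rightarrow> complex) \<Rightarrow> bool" where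
  "schwartz_on W f \<longleftrightarrow>
     (\<forall>vs. set vs \<subseteq> W \<longrightarrow>
        continuous_map (fd_topology W) euclidean (dir_deriv vs f) \<and>
        (\<forall>x\<in>W. \<forall>v\<in>W. (\<lambda>s. dir_deriv vs f (x + rscale s v)) differentiable (at 0)) \<and>
        (\<forall>k. \<exists>C. \<forall>x\<in>W. coeff_norm x ^ k * norm (dir_deriv vs f x) \<le> C))"

text \<open>Functions on \<^const>\<open>Rminus_vecs\<close> are represented by \<^const>\<open>R_vecs\<close>-periodic functions on F^n.\<close>

definition schwartz_space :: "(('n::finite) Fvec \<Rightarrow> complex) set" where
  "schwartz_space =
     {f. (\<forall>x. \<forall>r\<in>R_vecs. f (x + r) = f x) \<and>
         (\<forall>W. W \<subseteq> Rminus_vecs \<and> fin_dim_subspace W \<longrightarrow> schwartz_on W f)}"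


section \<open>The semigroup of matrices with Haar measures\<close>

definition matrices_R :: "('n::finite) Fmat set" where
  "matrices_R = {g. (\<forall>i j. g $ i $ j \<in> range fps_to_fls) \<and> det g \<noteq> 0}"

text \<open>The quotient of g^{-1} R^n by R^n, realised as the image of g^{-1} R^n under
  \<^const>\<open>proj_minus\<close>; since R^n is contained in g^{-1} R^n, a class corresponds to its unique
  representative in \<^const>\<open>Rminus_vecs\<close>.\<close>

definition V_space :: "('n::finite) Fmat \<Rightarrow> 'n Fvec set" where
  "V_space g = proj_minus ` (\<lambda>x. matrix_inv g *v x) ` R_vecs"

definition haar_measure :: "('n::finite) Fvec set \<Rightarrow> 'n Fvec measure \<Rightarrow> bool" where
  "haar_measure W \<mu> \<longleftrightarrow>
     space \<mu> = W \<and> sets \<mu> = sets (fd_borel W) \<and>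
     (\<forall>A\<in>sets \<mu>. \<forall>v\<in>W. emeasure \<mu> ((\<lambda>x. x + v) ` A) = emeasure \<mu> A) \<and>
     (\<forall>K. compactin (fd_topology W) K \<longrightarrow> emeasure \<mu> K < \<infinity>) \<and>
     emeasure \<mu> W \<noteq> 0"

text \<open>The defining integral formula of the product measure, for indicator functions of Borel
  sets. The function integrated is a function on the quotient by R^n, hence
  \<^const>\<open>proj_minus\<close>.\<close>

definition conv_measure ::
  "('n::finite) Fmat \<Rightarrow> 'n Fvec measure \<Rightarrow> 'n Fmat \<Rightarrow> 'n Fvec measure \<Rightarrow> 'n Fvec measure" where
  "conv_measure g1 \<mu>1 g2 \<mu>2 =
     measure_of (V_space (g1 ** g2)) (sets (fd_borel (V_space (g1 ** g2))))
       (\<lambda>A. \<integral>\<^sup>+y. (\<integral>\<^sup>+z. indicator A (proj_minus (matrix_inv g2 *v y + z)) \<partial>\<mu>2) \<partial>\<mu>1)"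

definition Mhat :: "(('n::finite) Fmat \<times> 'n Fvec measure) set" where
  "Mhat = {(g, \<mu>). g \<in> matrices_R \<and> haar_measure (V_space g) \<mu>}"

definition Mhat_mult ::
  "('n::finite) Fmat \<times> 'n Fvec measure \<Rightarrow> 'n Fmat \<times> 'n Fvec measure
     \<Rightarrow> 'n Fmat \<times> 'n Fvec measure" where
  "Mhat_mult = (\<lambda>(g1, \<mu>1) (g2, \<mu>2). (g1 ** g2, conv_measure g1 \<mu>1 g2 \<mu>2))"

definition pi_op ::
  "('n::finite) Fmat \<times> 'n Fvec measure \<Rightarrow> ('n Fvec \<Rightarrow> complex) \<Rightarrow> 'n Fvec \<Rightarrow> complex" where
  "pi_op = (\<lambda>(g, \<mu>) f x. \<integral>y. f (matrix_inv g *v x + y) \<partial>\<mu>)"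

abbreviation t_pow :: "int \<Rightarrow> ('n::finite) Fmat" where
  "t_pow k \<equiv> mat (fls_X_intpow k)"

text \<open>The image of Lebesgue measure under the coordinates with respect to the basis of all
  t^{-i} e_j with i between 1 and l; for l = 0 this is the unit point mass at 0.\<close>

definition mu_st :: "nat \<Rightarrow> ('n::finite) Fvec measure" where
  "mu_st l =
     distr (\<Pi>\<^sub>M p\<in>{1..l} \<times> (UNIV :: 'n set). (lborel :: real measure))
       (fd_borel (V_space (t_pow (int l))))
       (\<lambda>c. \<chi> j. \<Sum>i\<in>{1..l}. fls_const (c (i, j)) * fls_X_intpow (- int i))"

definition schwartz_eigenspace :: "complex \<Rightarrow> (('n::finite) Fvec \<Rightarrow> complex) set" where
  "schwartz_eigenspace lam =
     {f \<in> schwartz_space. pi_op (t_pow 1, mu_st 1) f = (\<lambda>x. lam * f x)}"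


section \<open>The central extensions of GL_n(F)_0 and SL_n(F)\<close>

definition GL0 :: "('n::finite) Fmat set" where
  "GL0 = {g. invertible g \<and> fls_nth (det g) (fls_subdegree (det g)) \<in> {1, -1}}"

definition Mhat0 :: "(('n::finite) Fmat \<times> 'n Fvec measure) set" where
  "Mhat0 = {(g, \<mu>) \<in> Mhat. g \<in> GL0}"

text \<open>The scalar matrix t^k is represented by its exponent k.\<close>

type_synonym 'n gtilde = "int \<times> ('n Fmat \<times> 'n Fvec measure)"

definition Gtilde :: "('n::finite) gtilde set" where
  "Gtilde = UNIV \<times> Mhat0"

definition Gtilde_mult :: "('n::finite) gtilde \<Rightarrow> 'n gtilde \<Rightarrow> 'n gtilde" where
  "Gtilde_mult = (\<lambda>(k, \<alpha>) (l, \<beta>). (k + l, Mhat_mult \<alpha> \<beta>))"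

inductive Gtilde_equiv :: "('n::finite) gtilde \<Rightarrow> 'n gtilde \<Rightarrow> bool" where
  shift: "\<alpha> \<in> Mhat0 \<Longrightarrow>
      Gtilde_equiv (k + int l, \<alpha>) (k, Mhat_mult (t_pow (int l), mu_st l) \<alpha>)"
| refl: "p \<in> Gtilde \<Longrightarrow> Gtilde_equiv p p"
| sym: "Gtilde_equiv p q \<Longrightarrow> Gtilde_equiv q p"
| trans: "Gtilde_equiv p q \<Longrightarrow> Gtilde_equiv q r \<Longrightarrow> Gtilde_equiv p r"

definition Gtilde_rel :: "(('n::finite) gtilde \<times> 'n gtilde) set" where
  "Gtilde_rel = {(p, q). Gtilde_equiv p q}"

definition Gtilde_class :: "('n::finite) gtilde \<Rightarrow> 'n gtilde set" where
  "Gtilde_class p = Gtilde_rel `` {p}"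

definition GLhat :: "('n::finite) gtilde set monoid" where
  "GLhat = \<lparr>carrier = Gtilde // Gtilde_rel,
            mult = (\<lambda>X Y. \<Union>p\<in>X. \<Union>q\<in>Y. Gtilde_class (Gtilde_mult p q)),
            one = Gtilde_class (0, (mat 1, mu_st 0))\<rparr>"

definition GLhat_proj :: "('n::finite) gtilde set \<Rightarrow> 'n Fmat" where
  "GLhat_proj X = the_elem ((\<lambda>(k, (g, \<mu>)). t_pow k ** g) ` X)"

definition SLhat :: "('n::finite) gtilde set monoid" where
  "SLhat = GLhat\<lparr>carrier := {X \<in> carrier GLhat. det (GLhat_proj X) = 1}\<rparr>"


section \<open>Representations on spaces of functions\<close>

definition complex_function_space :: "('x \<Rightarrow> complex) set \<Rightarrow> bool" where
  "complex_function_space E \<longleftrightarrow>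
     (\<lambda>_. 0) \<in> E \<and>
     (\<forall>f\<in>E. \<forall>h\<in>E. (\<lambda>x. f x + h x) \<in> E) \<and>
     (\<forall>c. \<forall>f\<in>E. (\<lambda>x. c * f x) \<in> E)"

text \<open>The locale \<^locale>\<open>group_action\<close> includes that G is a group.\<close>

definition linear_representation ::
  "('g, 'm) monoid_scheme \<Rightarrow> ('x \<Rightarrow> complex) set
     \<Rightarrow> ('g \<Rightarrow> ('x \<Rightarrow> complex) \<Rightarrow> 'x \<Rightarrow> complex) \<Rightarrow> bool" where
  "linear_representation G E \<rho> \<longleftrightarrow>
     complex_function_space E \<and> group_action G E \<rho> \<and>
     (\<forall>a\<in>carrier G.
        (\<forall>f\<in>E. \<forall>h\<in>E. \<rho> a (\<lambda>x. f x + h x) = (\<lambda>x. \<rho> a f x + \<rho> a h x)) \<and>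
        (\<forall>c. \<forall>f\<in>E. \<rho> a (\<lambda>x. c * f x) = (\<lambda>x. c * \<rho> a f x)))"

end

theory Submission
  imports Defs
begin

text \<open>Write \<^term>\<open>pi_op\<close> \<open>\<alpha>\<close> for the operator of an element \<open>\<alpha> = (g, \<mu>)\<close> of the semigroup. Two
analytic facts make these operators act on the Schwartz space. Substituting the integral that
defines the product measure and applying Fubini gives \<open>pi(\<alpha>\<beta>) = pi(\<alpha>) pi(\<beta>)\<close> (\<open>pi_op_mult\<close>). And
the operators preserve Schwartz functions (\<open>pi_op_schwartz\<close>): if x has bounded pole order and y
lies in \<open>V_g\<close>, then both x and y are bounded by a constant times the class of \<open>g\<^sup>-\<^sup>1x + y\<close>
(\<open>glue_bounded_below\<close>), so the decay of f in that single vector makes the integrand decay in x and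
y simultaneously, while a Haar measure on \<open>V_g\<close> grows only polynomially (\<open>decay_integrable\<close>). This
allows differentiation under the integral and estimates all derivatives.

Let \<open>T_l\<close> be the pair of the scalar matrix \<open>t^l\<close> and its standard measure. The relation defining the
extension identifies \<open>(t^(k+l), \<alpha>)\<close> with \<open>(t^k, T_l \<alpha>)\<close>. On the eigenspace \<open>T_l = T_1^l\<close> acts by
\<open>\<lambda>^l\<close>, so \<open>(t^k, \<alpha>) \<mapsto> \<lambda>^k pi(\<alpha>)\<close> respects the relation. That pi preserves the eigenspace, and
that multiplication descends to the quotient, both come down to one statement: \<open>T_l\<close> commutes with
every \<open>\<alpha>\<close> over \<open>GL_n(F)_0\<close> (\<open>t_lift_central\<close>).

To see this, compare \<open>T_1 \<alpha>\<close> with \<open>\<alpha> T_1\<close>. Both live over \<open>tg = gt\<close>, hence they differ by a positive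
factor, because a Haar measure on a finite-dimensional space is unique up to scaling
(\<open>haar_unique\<close>); the factor c(g) does not depend on \<open>\<mu>\<close>. Associativity makes c multiplicative, and
since c is 1 on powers of t it extends to a homomorphism from \<open>GL_n(F)\<close> to the positive reals. Such
a homomorphism factors through the determinant (\<open>multiplicative_through_det\<close>): a shear is conjugate
under a diagonal matrix to its own square, so it is mapped to 1, and Gaussian elimination leaves a
diagonal matrix. The induced character of the nonzero elements of F is trivial at t, because the n-th power of its
value there is c of the scalar matrix t; it is trivial at -1, a torsion element; and it is trivial at units
congruent to 1 modulo t, because such a matrix g has \<open>V_g = 0\<close> and acts on \<open>V_t\<close> as the identity. An
element whose leading coefficient is 1 or -1 is a product of these.

The quotient is a group because \<open>t^m g\<^sup>-\<^sup>1\<close> is integral for large m, and a Haar measure on its space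
can be normalised so that its product with \<open>(g, \<mu>)\<close> is \<open>T_m\<close> (\<open>Mhat0_inverse\<close>).\<close>

section \<open>Vectors and matrices over the Laurent series field\<close>

unbundle no fps_syntax

lemma integral_fls_iff: "(f :: real fls) \<in> range fps_to_fls \<longleftrightarrow> (\<forall>i<0. fls_nth f i = 0)"
proof
  assume "f \<in> range fps_to_fls"
  then show "\<forall>i<0. fls_nth f i = 0" by auto
next
  assume "\<forall>i<0. fls_nth f i = 0"
  then have "f = fps_to_fls (fls_regpart f)" by (intro fls_eqI) auto
  then show "f \<in> range fps_to_fls" by blast
qed

lemma Fvec_eqI: "(\<And>j i. fls_nth (x $ j) i = fls_nth (y $ j) i) \<Longrightarrow> (x :: ('n::finite) Fvec) = y"
  by (simp add: vec_eq_iff fls_eq_iff)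

lemma R_vecs_iff: "x \<in> R_vecs \<longleftrightarrow> (\<forall>j. \<forall>i<0. fls_nth (x $ j) i = 0)"
  by (simp add: R_vecs_def integral_fls_iff)

lemma proj_minus_nth: "fls_nth (proj_minus x $ j) i = (if i < 0 then fls_nth (x $ j) i else 0)"
  by (simp add: proj_minus_def)

lemma R_vecs_closed:
  "0 \<in> R_vecs" "x \<in> R_vecs \<Longrightarrow> y \<in> R_vecs \<Longrightarrow> x + y \<in> R_vecs"
  "x \<in> R_vecs \<Longrightarrow> y \<in> R_vecs \<Longrightarrow> x - y \<in> R_vecs" "x \<in> R_vecs \<Longrightarrow> rscale c x \<in> R_vecs"
  by (auto simp: R_vecs_iff)

lemma Rminus_vecs_closed:
  "0 \<in> Rminus_vecs" "x \<in> Rminus_vecs \<Longrightarrow> y \<in> Rminus_vecs \<Longrightarrow> x + y \<in> Rminus_vecs"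
  "x \<in> Rminus_vecs \<Longrightarrow> y \<in> Rminus_vecs \<Longrightarrow> x - y \<in> Rminus_vecs"
  "x \<in> Rminus_vecs \<Longrightarrow> rscale c x \<in> Rminus_vecs"
  by (auto simp: Rminus_vecs_def)

lemma proj_minus_add: "proj_minus (x + y) = proj_minus x + proj_minus y"
  and proj_minus_diff: "proj_minus (x - y) = proj_minus x - proj_minus y"
  and proj_minus_rscale: "proj_minus (rscale c x) = rscale c (proj_minus x)"
  by (rule Fvec_eqI; simp add: proj_minus_nth)+

lemma proj_minus_in_Rminus [simp]: "proj_minus x \<in> Rminus_vecs"
  by (simp add: Rminus_vecs_def proj_minus_nth)

lemma proj_minus_id: "x \<in> Rminus_vecs \<Longrightarrow> proj_minus x = x"
  by (rule Fvec_eqI) (auto simp: Rminus_vecs_def proj_minus_nth)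

lemma proj_minus_eq_0_iff: "proj_minus x = 0 \<longleftrightarrow> x \<in> R_vecs"
  by (auto simp: vec_eq_iff fls_eq_iff proj_minus_nth R_vecs_iff)

lemma diff_proj_minus_in_R [simp]: "x - proj_minus x \<in> R_vecs"
  by (simp add: R_vecs_iff proj_minus_nth)

lemma proj_minus_cong: "x - y \<in> R_vecs \<Longrightarrow> proj_minus x = proj_minus y"
  using proj_minus_eq_0_iff[of "x - y"] by (simp add: proj_minus_diff)

definition integral_matrix :: "('n::finite) Fmat \<Rightarrow> bool" where
  "integral_matrix g \<longleftrightarrow> (\<forall>i j. g $ i $ j \<in> range fps_to_fls)"

lemma matrices_R_iff: "g \<in> matrices_R \<longleftrightarrow> integral_matrix g \<and> det g \<noteq> 0"
  by (simp add: matrices_R_def integral_matrix_def)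

lemma integral_fls_closed:
  assumes "f \<in> range fps_to_fls" "h \<in> range fps_to_fls"
  shows "f * h \<in> range (fps_to_fls :: real fps \<Rightarrow> _)" "f + h \<in> range (fps_to_fls :: real fps \<Rightarrow> _)"
  using assms by (auto simp flip: fls_times_fps_to_fls fps_to_fls_plus)

lemma integral_fls_sum:
  "(\<And>k. k \<in> S \<Longrightarrow> f k \<in> range fps_to_fls) \<Longrightarrow> sum f S \<in> range (fps_to_fls :: real fps \<Rightarrow> _)"
  by (induction S rule: infinite_finite_induct)
     (auto simp: integral_fls_closed intro: range_eqI[of _ _ 0])

lemma integral_matrix_vector:
  "integral_matrix g \<Longrightarrow> x \<in> R_vecs \<Longrightarrow> g *v x \<in> R_vecs"
  by (auto simp: integral_matrix_def R_vecs_def matrix_vector_mult_def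
      intro!: integral_fls_sum integral_fls_closed)

lemma integral_matrix_mult:
  "integral_matrix g \<Longrightarrow> integral_matrix h \<Longrightarrow> integral_matrix (g ** h)"
  by (auto simp: integral_matrix_def matrix_matrix_mult_def
      intro!: integral_fls_sum integral_fls_closed)

lemma mat_mult_nth: "(mat a ** h) $ i $ j = a * h $ i $ j" for h :: "('a::comm_semiring_1)^'n^'m"
  by (simp add: matrix_matrix_mult_def mat_def if_distrib[of "\<lambda>u. u * _"] cong: if_cong)

lemma mult_mat_nth: "(h ** mat a) $ i $ j = a * h $ i $ j" for h :: "('a::comm_semiring_1)^'n^'m"
  by (simp add: matrix_matrix_mult_def mat_def if_distrib[of "\<lambda>u. _ * u"] mult.commute cong: if_cong)

lemma mat_commute: "mat a ** h = h ** mat a" for h :: "('a::comm_semiring_1)^'n^'n"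
  by (simp add: vec_eq_iff mat_mult_nth mult_mat_nth)

lemma mat_mult_vec: "mat a *v x = a *s x" for x :: "('a::comm_semiring_1)^'n"
  by (simp add: vec_eq_iff matrix_vector_mult_def mat_def if_distrib[of "\<lambda>u. u * _"] cong: if_cong)

lemma t_pow_mult: "t_pow k ** t_pow l = (t_pow (k + l) :: ('n::finite) Fmat)"
  by (simp add: vec_eq_iff mat_mult_nth) (simp add: mat_def fls_X_intpow_times_fls_X_intpow)

lemma det_t_pow: "det (t_pow k :: ('n::finite) Fmat) = fls_X_intpow (int CARD('n) * k)"
  by (subst det_diagonal) (auto simp: mat_def fls_X_intpow_power)

lemma det_t_pow_nz [simp]: "det (t_pow k :: ('n::finite) Fmat) \<noteq> 0"
  by (simp add: det_t_pow)

lemma t_pow_matrices_R: "(t_pow (int k) :: ('n::finite) Fmat) \<in> matrices_R"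
  using det_t_pow_nz[of "int k"]
  by (simp add: matrices_R_iff integral_matrix_def) (auto simp: mat_def integral_fls_iff)

text \<open>The finitely many entries of h have finitely many coefficients at negative powers altogether.\<close>

lemma clear_denominators:
  fixes h :: "('n::finite) Fmat"
  obtains K where "\<And>k. k \<ge> K \<Longrightarrow> integral_matrix (t_pow (int k) ** h)"
proof -
  define K where "K = Max ((\<lambda>(i, j). nat (- fls_subdegree (h $ i $ j))) ` UNIV)"
  have "integral_matrix (t_pow (int k) ** h)" if "k \<ge> K" for k
    unfolding integral_matrix_def mat_mult_nth integral_fls_iff
  proof (intro allI impI)
    fix i j and m :: int assume "m < 0"
    have "nat (- fls_subdegree (h $ i $ j)) \<le> K"
      unfolding K_def by (rule Max_ge) (auto intro!: rev_image_eqI[of "(i, j)"])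
    then have "m - int k < fls_subdegree (h $ i $ j)" using \<open>m < 0\<close> that by linarith
    then show "fls_nth (fls_X_intpow (int k) * h $ i $ j) m = 0"
      by (simp add: fls_X_intpow_times_conv_shift)
  qed
  then show ?thesis using that by blast
qed

lemma matrix_inv_cancel:
  fixes g :: "('a::field)^'n^'n"
  assumes "det g \<noteq> 0"
  shows "g ** matrix_inv g = mat 1" "matrix_inv g ** g = mat 1"
    "g *v (matrix_inv g *v x) = x" "matrix_inv g *v (g *v x) = x"
proof -
  have "invertible g" using assms by (simp add: invertible_det_nz)
  then show 1: "g ** matrix_inv g = mat 1" "matrix_inv g ** g = mat 1"
    unfolding matrix_inv_def invertible_def by (metis (mono_tags, lifting) someI_ex)+
  show "g *v (matrix_inv g *v x) = x" "matrix_inv g *v (g *v x) = x"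
    by (simp_all add: matrix_vector_mul_assoc 1)
qed

lemma matrix_inv_unique_right:
  fixes g :: "('a::field)^'n^'n"
  assumes "g ** h = mat 1" shows "matrix_inv g = h"
proof -
  have "det g \<noteq> 0" using assms by (metis det_I det_mul mult_zero_left zero_neq_one)
  then show ?thesis by (metis assms matrix_inv_cancel(2) matrix_mul_assoc matrix_mul_lid matrix_mul_rid)
qed

lemma matrix_inv_mult:
  fixes g h :: "('a::field)^'n^'n"
  assumes "det g \<noteq> 0" "det h \<noteq> 0"
  shows "matrix_inv (g ** h) = matrix_inv h ** matrix_inv g"
  by (rule matrix_inv_unique_right)
     (metis assms matrix_inv_cancel(1) matrix_mul_assoc matrix_mul_rid)

lemma matrix_inv_t_pow: "matrix_inv (t_pow k :: ('n::finite) Fmat) = t_pow (- k)"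
  by (rule matrix_inv_unique_right) (simp only: t_pow_mult, simp)

text \<open>The vectors with poles of order at most N. They exhaust the polar vectors, every finite-dimensional
subspace lies in one of them, and they are the spaces \<open>V_g\<close> of the scalar matrices \<open>t^N\<close>.\<close>

definition polar_vecs :: "nat \<Rightarrow> ('n::finite) Fvec set" where
  "polar_vecs N = {x \<in> Rminus_vecs. \<forall>j. \<forall>i < - int N. fls_nth (x $ j) i = 0}"

lemma polar_vecs_closed:
  "0 \<in> polar_vecs N" "x \<in> polar_vecs N \<Longrightarrow> y \<in> polar_vecs N \<Longrightarrow> x + y \<in> polar_vecs N"
  "x \<in> polar_vecs N \<Longrightarrow> y \<in> polar_vecs N \<Longrightarrow> x - y \<in> polar_vecs N"
  "x \<in> polar_vecs N \<Longrightarrow> rscale c x \<in> polar_vecs N"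
  by (auto simp: polar_vecs_def Rminus_vecs_closed)

lemma polar_vecs_mono: "N \<le> M \<Longrightarrow> polar_vecs N \<subseteq> polar_vecs M"
  by (auto simp: polar_vecs_def)

lemma polar_vecs_subset_Rminus: "polar_vecs N \<subseteq> Rminus_vecs"
  by (auto simp: polar_vecs_def)

lemma Rminus_in_polar:
  assumes "x \<in> Rminus_vecs" obtains N where "x \<in> polar_vecs N"
proof -
  define N where "N = Max (range (\<lambda>j. nat (- fls_subdegree (x $ j))))"
  have "x \<in> polar_vecs N" unfolding polar_vecs_def
  proof (intro CollectI conjI allI impI assms)
    fix j i assume "i < - int N"
    moreover have "nat (- fls_subdegree (x $ j)) \<le> N" unfolding N_def by (rule Max_ge) auto
    ultimately show "fls_nth (x $ j) i = 0" by (intro fls_eq0_below_subdegree) linarith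
  qed
  then show ?thesis by (rule that)
qed

text \<open>Elements of \<open>V_g\<close> are polar parts that g makes integral. In this form \<open>V_g\<close> is visibly a subspace
cut out by linear equations, and no inverse matrix occurs.\<close>

lemma V_space_iff:
  assumes "g \<in> matrices_R"
  shows "x \<in> V_space g \<longleftrightarrow> x \<in> Rminus_vecs \<and> g *v x \<in> R_vecs"
proof
  have g: "integral_matrix g" "det g \<noteq> 0" using assms by (auto simp: matrices_R_iff)
  {
    assume "x \<in> V_space g"
    then obtain r where r: "r \<in> R_vecs" "x = proj_minus (matrix_inv g *v r)"
      by (auto simp: V_space_def)
    have "g *v x = r - g *v (matrix_inv g *v r - x)"
      by (simp add: matrix_vector_mult_diff_distrib matrix_inv_cancel g)
    moreover have "g *v (matrix_inv g *v r - x) \<in> R_vecs"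
      unfolding r(2) by (rule integral_matrix_vector[OF g(1) diff_proj_minus_in_R])
    ultimately show "x \<in> Rminus_vecs \<and> g *v x \<in> R_vecs"
      using r by (simp only: R_vecs_closed(3) proj_minus_in_Rminus simp_thms)
  next
    assume x: "x \<in> Rminus_vecs \<and> g *v x \<in> R_vecs"
    then have "x = proj_minus (matrix_inv g *v (g *v x))"
      by (simp add: matrix_inv_cancel g proj_minus_id)
    then show "x \<in> V_space g" unfolding V_space_def using x by blast
  }
qed

lemma polar_vecs_eq_V_space: "polar_vecs N = V_space (t_pow (int N))"
proof -
  have "(\<forall>i<0. fls_nth f (i - int N) = 0) \<longleftrightarrow> (\<forall>i < - int N. fls_nth f i = 0)" for f :: "real fls"
  proof safe
    fix i assume "\<forall>i<0. fls_nth f (i - int N) = 0" "i < - int N"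
    then show "fls_nth f i = 0" by (auto dest!: spec[of _ "i + int N"])
  qed auto
  then show ?thesis
    by (simp add: set_eq_iff V_space_iff[OF t_pow_matrices_R] polar_vecs_def R_vecs_iff mat_mult_vec
        fls_X_intpow_times_conv_shift)
qed

lemma polar_vecs_iff: "x \<in> polar_vecs N \<longleftrightarrow> x \<in> Rminus_vecs \<and> t_pow (int N) *v x \<in> R_vecs"
  by (simp only: polar_vecs_eq_V_space V_space_iff[OF t_pow_matrices_R])

text \<open>If \<open>t^N g\<^sup>-\<^sup>1\<close> is integral, then \<open>t^N x = (t^N g\<^sup>-\<^sup>1)(g x)\<close> is integral as soon as \<open>g x\<close> is.\<close>

lemma V_space_subset_polar:
  assumes "g \<in> matrices_R" obtains N where "V_space g \<subseteq> polar_vecs N"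
proof -
  have g: "integral_matrix g" "det g \<noteq> 0" using assms by (auto simp: matrices_R_iff)
  obtain N where N: "integral_matrix (t_pow (int N) ** matrix_inv g)"
    using clear_denominators[of "matrix_inv g"] by blast
  have "V_space g \<subseteq> polar_vecs N"
  proof
    fix x assume "x \<in> V_space g"
    then have x: "x \<in> Rminus_vecs" "g *v x \<in> R_vecs" by (auto simp: V_space_iff assms)
    have "t_pow (int N) *v x = (t_pow (int N) ** matrix_inv g) *v (g *v x)"
      by (simp add: g matrix_inv_cancel flip: matrix_vector_mul_assoc)
    with x N show "x \<in> polar_vecs N"
      by (simp add: polar_vecs_eq_V_space V_space_iff t_pow_matrices_R integral_matrix_vector)
  qed
  then show ?thesis by (rule that)
qed

lemma V_space_closed:
  assumes "g \<in> matrices_R"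
  shows "0 \<in> V_space g" "x \<in> V_space g \<Longrightarrow> y \<in> V_space g \<Longrightarrow> x + y \<in> V_space g"
    "x \<in> V_space g \<Longrightarrow> y \<in> V_space g \<Longrightarrow> x - y \<in> V_space g"
    "x \<in> V_space g \<Longrightarrow> rscale c x \<in> V_space g"
  using assms
  by (auto simp: V_space_iff Rminus_vecs_closed matrix_vector_right_distrib R_vecs_closed
      matrix_vector_mult_diff_distrib vec.scale)

section \<open>Real-linear maps and the coefficient norm\<close>

abbreviation real_linear :: "(('n::finite) Fvec \<Rightarrow> ('m::finite) Fvec) \<Rightarrow> bool" where
  "real_linear L \<equiv> module_hom rscale rscale L"

lemma real_linearI:
  assumes "\<And>x y. L (x + y) = L x + L y" "\<And>c x. L (rscale c x) = rscale c (L x)"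
  shows "real_linear L"
proof -
  have "module (rscale :: real \<Rightarrow> 'a Fvec \<Rightarrow> _)" for x :: "('a::finite) itself"
    by (rule real_Fvec.module_axioms)
  then show ?thesis using assms by (simp add: module_hom_def module_hom_axioms_def real_Fvec.module_axioms)
qed

lemma real_linear_matrix: "real_linear ((*v) h)"
  by (rule real_linearI) (simp_all add: matrix_vector_right_distrib vec.scale)

lemma real_linear_proj_matrix: "real_linear (\<lambda>x. proj_minus (h *v x))"
  by (rule real_linearI)
     (simp_all add: matrix_vector_right_distrib vec.scale proj_minus_add proj_minus_rscale)

definition unit_vec :: "'n \<times> int \<Rightarrow> ('n::finite) Fvec" where
  "unit_vec p = axis (fst p) (fls_X_intpow (snd p))"

abbreviation polar_index :: "nat \<Rightarrow> ('n::finite \<times> int) set" where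
  "polar_index N \<equiv> UNIV \<times> {- int N..-1}"

lemma coords_unit_vec: "coords (unit_vec p) q = (if p = q then 1 else 0)"
  by (cases p; cases q) (auto simp: coords_def unit_vec_def axis_def)

lemma coords_eqI: "(\<And>p. coords x p = coords y p) \<Longrightarrow> x = y"
  by (rule Fvec_eqI) (auto simp: coords_def)

lemma coords_simps [simp]:
  "coords 0 p = 0" "coords (x + y) p = coords x p + coords y p"
  "coords (x - y) p = coords x p - coords y p" "coords (rscale c x) p = c * coords x p"
  by (cases p; simp add: coords_def)+

lemma coords_sum: "coords (sum f S) p = (\<Sum>s\<in>S. coords (f s) p)"
  by (induction S rule: infinite_finite_induct) auto

lemma polar_vecs_coords: "x \<in> polar_vecs N \<longleftrightarrow> (\<forall>p. p \<notin> polar_index N \<longrightarrow> coords x p = 0)"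
proof -
  have "x \<in> polar_vecs N \<longleftrightarrow> (\<forall>j i. i \<ge> 0 \<or> i < - int N \<longrightarrow> fls_nth (x $ j) i = 0)"
    by (auto simp: polar_vecs_def Rminus_vecs_def)
  also have "\<dots> \<longleftrightarrow> (\<forall>j i. (j, i) \<notin> polar_index N \<longrightarrow> coords x (j, i) = 0)"
    by (intro all_cong1) (auto simp: coords_def)
  also have "\<dots> \<longleftrightarrow> (\<forall>p. p \<notin> polar_index N \<longrightarrow> coords x p = 0)"
    by (simp only: split_paired_all split_paired_All)
  finally show ?thesis .
qed

lemma unit_vec_in_polar: "p \<in> polar_index N \<Longrightarrow> unit_vec p \<in> polar_vecs N"
  by (auto simp: polar_vecs_coords coords_unit_vec)

lemma polar_vecs_expand:
  assumes "x \<in> polar_vecs N"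
  shows "x = (\<Sum>p\<in>polar_index N. rscale (coords x p) (unit_vec p))"
proof (rule coords_eqI)
  fix q
  have "coords x q = 0" if "q \<notin> polar_index N"
    using assms that polar_vecs_coords by blast
  then show "coords x q = coords (\<Sum>p\<in>polar_index N. rscale (coords x p) (unit_vec p)) q"
    by (auto simp: coords_sum coords_unit_vec if_distrib cong: if_cong)
qed

lemma real_linear_expand:
  assumes "real_linear L" "x \<in> polar_vecs N"
  shows "L x = (\<Sum>p\<in>polar_index N. rscale (coords x p) (L (unit_vec p)))"
proof -
  have "L x = L (\<Sum>p\<in>polar_index N. rscale (coords x p) (unit_vec p))"
    using polar_vecs_expand[OF assms(2)] by (rule arg_cong)
  also have "\<dots> = (\<Sum>p\<in>polar_index N. rscale (coords x p) (L (unit_vec p)))"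
    by (simp only: module_hom.sum[OF assms(1)] module_hom.scale[OF assms(1)])
  finally show ?thesis .
qed

text \<open>On vectors of bounded pole order, each coefficient of the image under a linear map is a finite linear
combination of coefficients. This makes linear maps measurable without
a choice of bases of subspaces.\<close>

lemma coords_real_linear:
  assumes "real_linear L" "x \<in> polar_vecs N"
  shows "coords (L x) q = (\<Sum>p\<in>polar_index N. coords x p * coords (L (unit_vec p)) q)"
  by (subst real_linear_expand[OF assms]) (simp add: coords_sum)

lemma coeff_norm_polar:
  assumes "x \<in> polar_vecs N"
  shows "coeff_norm x = (\<Sum>p\<in>polar_index N. \<bar>coords x p\<bar>)"
proof -
  have "(\<Sum>i | fls_nth (x $ j) i \<noteq> 0. \<bar>fls_nth (x $ j) i\<bar>) = (\<Sum>i\<in>{- int N..-1}. \<bar>coords x (j, i)\<bar>)" for j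
  proof (intro sum.mono_neutral_cong_left)
    show "{i. fls_nth (x $ j) i \<noteq> 0} \<subseteq> {- int N..-1}"
    proof
      fix i assume "i \<in> {i. fls_nth (x $ j) i \<noteq> 0}"
      then have "(j, i) \<in> polar_index N"
        using assms unfolding polar_vecs_coords coords_def by fastforce
      then show "i \<in> {- int N..-1}" by simp
    qed
  qed (auto simp: coords_def)
  then show ?thesis by (simp add: coeff_norm_def sum.cartesian_product)
qed

lemma Rminus_common_polar:
  assumes "x \<in> Rminus_vecs" "y \<in> Rminus_vecs"
  obtains N where "x \<in> polar_vecs N" "y \<in> polar_vecs N"
proof -
  obtain N M where "x \<in> polar_vecs N" "y \<in> polar_vecs M" using Rminus_in_polar assms by metis
  then show ?thesis
    using polar_vecs_mono[of N "max N M"] polar_vecs_mono[of M "max N M"] by (intro that[of "max N M"]) auto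
qed

lemma coeff_norm_nonneg [simp]: "0 \<le> coeff_norm x"
  by (simp add: coeff_norm_def sum_nonneg)

lemma coeff_norm_0 [simp]: "coeff_norm 0 = 0"
  by (simp add: coeff_norm_def)

lemma coeff_norm_triangle:
  assumes "x \<in> Rminus_vecs" "y \<in> Rminus_vecs"
  shows "coeff_norm (x + y) \<le> coeff_norm x + coeff_norm y"
proof -
  obtain N where N: "x \<in> polar_vecs N" "y \<in> polar_vecs N" using Rminus_common_polar assms .
  show ?thesis
    by (simp add: coeff_norm_polar[of _ N] N polar_vecs_closed flip: sum.distrib)
       (intro sum_mono abs_triangle_ineq)
qed

lemma coeff_norm_rscale:
  assumes "x \<in> Rminus_vecs" shows "coeff_norm (rscale c x) = \<bar>c\<bar> * coeff_norm x"
proof -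
  obtain N where "x \<in> polar_vecs N" using Rminus_in_polar assms .
  then show ?thesis
    by (simp add: coeff_norm_polar[of _ N] polar_vecs_closed sum_distrib_left abs_mult)
qed

lemma coeff_norm_minus_commute: "coeff_norm (x - y) = coeff_norm (y - x)"
  by (simp add: coeff_norm_def abs_minus_commute[of "fls_nth (x $ _) _"] eq_commute[of "fls_nth (x $ _) _"])

lemma coeff_norm_triangle_diff:
  assumes "x \<in> Rminus_vecs" "y \<in> Rminus_vecs"
  shows "coeff_norm x \<le> coeff_norm (x - y) + coeff_norm y"
  using coeff_norm_triangle[of "x - y" y] assms by (simp add: Rminus_vecs_closed)

lemma abs_coords_le:
  assumes "x \<in> Rminus_vecs" shows "\<bar>coords x p\<bar> \<le> coeff_norm x"
proof -
  obtain N where N: "x \<in> polar_vecs N" using Rminus_in_polar assms .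
  show ?thesis
  proof (cases "p \<in> polar_index N")
    case True
    show ?thesis unfolding coeff_norm_polar[OF N]
      by (rule member_le_sum[OF True, where f="\<lambda>p. \<bar>coords x p\<bar>"]) auto
  next
    case False
    then have "coords x p = 0" using N polar_vecs_coords by blast
    then show ?thesis by simp
  qed
qed

lemma coeff_norm_sum_le:
  assumes "\<And>s. s \<in> S \<Longrightarrow> f s \<in> Rminus_vecs"
  shows "coeff_norm (sum f S) \<le> (\<Sum>s\<in>S. coeff_norm (f s))"
proof -
  have "sum f S \<in> Rminus_vecs \<and> coeff_norm (sum f S) \<le> (\<Sum>s\<in>S. coeff_norm (f s))"
    using assms
    by (induction S rule: infinite_finite_induct)
       (auto simp: Rminus_vecs_closed intro: order_trans[OF coeff_norm_triangle])
  then show ?thesis ..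
qed

lemma real_linear_bounded:
  assumes "real_linear L" "\<And>x. x \<in> polar_vecs N \<Longrightarrow> L x \<in> Rminus_vecs"
  obtains C where "C > 0" "\<And>x. x \<in> polar_vecs N \<Longrightarrow> coeff_norm (L x) \<le> C * coeff_norm x"
proof
  let ?C = "1 + (\<Sum>p\<in>polar_index N. coeff_norm (L (unit_vec p)))"
  show "?C > 0" by (simp add: sum_nonneg add_pos_nonneg)
  fix x :: "'a Fvec" assume x: "x \<in> polar_vecs N"
  have Lp: "L (unit_vec p) \<in> Rminus_vecs" if "p \<in> polar_index N" for p
    using assms(2) unit_vec_in_polar that by blast
  have "coeff_norm (L x) \<le> (\<Sum>p\<in>polar_index N. coeff_norm (rscale (coords x p) (L (unit_vec p))))"
    by (subst real_linear_expand[OF assms(1) x], rule coeff_norm_sum_le)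
       (use Lp Rminus_vecs_closed in blast)
  also have "\<dots> \<le> (\<Sum>p\<in>polar_index N. coeff_norm x * coeff_norm (L (unit_vec p)))"
  proof (rule sum_mono)
    fix p assume p: "p \<in> (polar_index N :: ('a \<times> int) set)"
    have "x \<in> Rminus_vecs" using x polar_vecs_subset_Rminus by blast
    then show "coeff_norm (rscale (coords x p) (L (unit_vec p))) \<le> coeff_norm x * coeff_norm (L (unit_vec p))"
      by (simp add: coeff_norm_rscale Lp[OF p] abs_coords_le mult_right_mono)
  qed
  also have "\<dots> \<le> ?C * coeff_norm x"
    by (simp add: sum_distrib_left[symmetric] algebra_simps)
  finally show "coeff_norm (L x) \<le> ?C * coeff_norm x" .
qed

section \<open>Borel sets and compact balls of the spaces V_g\<close>

lemma topspace_fd_topology [simp]: "topspace (fd_topology W) = W"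
  by (simp add: fd_topology_def topspace_pullback_topology)

lemma fd_borel_eq: "fd_borel W = vimage_algebra W coords borel"
proof -
  have "{U. openin (fd_topology W) U} = {coords -` U \<inter> W | U. U \<in> {S. open S}}"
    by (auto simp: fd_topology_def openin_pullback_topology)
  then show ?thesis
    by (simp add: fd_borel_def borel_def vimage_algebra_sigma)
qed

lemma space_fd_borel [simp]: "space (fd_borel W) = W"
  by (simp add: fd_borel_eq)

text \<open>The topology is the initial one for countably many coefficient functionals, so a map is measurable
as soon as its coefficients are.\<close>

lemma measurable_fd_borelI:
  assumes "f \<in> space M \<rightarrow> W" "\<And>p. (\<lambda>x. coords (f x) p) \<in> borel_measurable M"
  shows "f \<in> M \<rightarrow>\<^sub>M fd_borel W"
  unfolding fd_borel_eq using assms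
  by (intro measurable_vimage_algebra2 measurable_coordinatewise_then_product) auto

lemma continuous_map_coords [continuous_intros]:
  "continuous_map (fd_topology W) euclidean (\<lambda>x. coords x p)"
proof -
  have "continuous_map (fd_topology W) euclidean ((\<lambda>c. c p) \<circ> coords)"
    unfolding fd_topology_def
    by (intro continuous_map_pullback) (simp add: continuous_on_product_coordinates)
  then show ?thesis by (simp add: o_def)
qed

lemma fd_borel_measurable_continuous:
  fixes f :: "('n::finite) Fvec \<Rightarrow> 'b::topological_space"
  assumes "continuous_map (fd_topology W) euclidean f"
  shows "f \<in> borel_measurable (fd_borel W)"
proof (rule borel_measurableI)
  fix S :: "'b set" assume "open S"
  then have "openin (fd_topology W) {x \<in> W. f x \<in> S}"
    using openin_continuous_map_preimage[OF assms, of S] by simp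
  moreover have "f -` S \<inter> space (fd_borel W) = {x \<in> W. f x \<in> S}" by auto
  moreover have "U \<in> sets (fd_borel W)" if "openin (fd_topology W) U" for U
    using that unfolding fd_borel_def
    by (intro in_measure_of) (use openin_subset[of "fd_topology W"] in auto)
  ultimately show "f -` S \<inter> space (fd_borel W) \<in> sets (fd_borel W)" by metis
qed

lemma measurable_coords [measurable]: "(\<lambda>x. coords x p) \<in> borel_measurable (fd_borel W)"
  by (intro fd_borel_measurable_continuous continuous_map_coords)

lemma measurable_coords_comp:
  assumes "f \<in> M \<rightarrow>\<^sub>M fd_borel W" shows "(\<lambda>x. coords (f x) p) \<in> borel_measurable M"
  using measurable_compose[OF assms measurable_coords] .

lemma measurable_real_linear:
  assumes "real_linear L" "V \<subseteq> polar_vecs N" "\<And>x. x \<in> V \<Longrightarrow> L x \<in> W"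
  shows "L \<in> fd_borel V \<rightarrow>\<^sub>M fd_borel W"
proof (rule measurable_fd_borelI)
  fix q
  have "(\<lambda>x. \<Sum>p\<in>polar_index N. coords x p * coords (L (unit_vec p)) q) \<in> borel_measurable (fd_borel V)"
    by measurable
  then show "(\<lambda>x. coords (L x) q) \<in> borel_measurable (fd_borel V)"
    by (rule measurable_cong[THEN iffD1, rotated])
       (use assms in \<open>auto simp: coords_real_linear\<close>)
qed (use assms in auto)

lemma measurable_fd_add:
  assumes "f \<in> M \<rightarrow>\<^sub>M fd_borel V" "g \<in> M \<rightarrow>\<^sub>M fd_borel W" "\<And>x. x \<in> space M \<Longrightarrow> f x + g x \<in> U"
  shows "(\<lambda>x. f x + g x) \<in> M \<rightarrow>\<^sub>M fd_borel U"
  using assms(3) measurable_coords_comp[OF assms(1)] measurable_coords_comp[OF assms(2)]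
  by (intro measurable_fd_borelI) auto

lemma measurable_fd_diff:
  assumes "f \<in> M \<rightarrow>\<^sub>M fd_borel V" "g \<in> M \<rightarrow>\<^sub>M fd_borel W" "\<And>x. x \<in> space M \<Longrightarrow> f x - g x \<in> U"
  shows "(\<lambda>x. f x - g x) \<in> M \<rightarrow>\<^sub>M fd_borel U"
  using assms(3) measurable_coords_comp[OF assms(1)] measurable_coords_comp[OF assms(2)]
  by (intro measurable_fd_borelI) auto

lemma continuous_map_coeff_norm:
  assumes "V \<subseteq> polar_vecs N"
  shows "continuous_map (fd_topology V) euclidean coeff_norm"
proof (rule continuous_map_eq)
  show "continuous_map (fd_topology V) euclidean (\<lambda>x. \<Sum>p\<in>polar_index N. \<bar>coords x p\<bar>)"
    by (intro continuous_intros continuous_map_sum continuous_map_real_abs) (auto simp: continuous_map_coords)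
qed (use assms in \<open>auto simp: coeff_norm_polar\<close>)

lemma continuous_map_dist_norm:
  assumes "V \<subseteq> polar_vecs N" "v \<in> polar_vecs N"
  shows "continuous_map (fd_topology V) euclidean (\<lambda>x. coeff_norm (x - v))"
proof (rule continuous_map_eq)
  show "continuous_map (fd_topology V) euclidean (\<lambda>x. \<Sum>p\<in>polar_index N. \<bar>coords x p - coords v p\<bar>)"
    by (intro continuous_map_sum continuous_map_real_abs continuous_map_diff)
       (auto intro!: continuous_map_coords)
next
  fix x assume "x \<in> topspace (fd_topology V)"
  then show "(\<Sum>p\<in>polar_index N. \<bar>coords x p - coords v p\<bar>) = coeff_norm (x - v)"
    using assms by (subst coeff_norm_polar[of _ N]) (auto intro: polar_vecs_closed)
qed

lemma measurable_coeff_norm: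
  assumes "V \<subseteq> polar_vecs N" shows "coeff_norm \<in> borel_measurable (fd_borel V)"
  by (intro fd_borel_measurable_continuous continuous_map_coeff_norm[OF assms])

abbreviation norm_ball :: "('n::finite) Fvec set \<Rightarrow> real \<Rightarrow> 'n Fvec set" where
  "norm_ball V r \<equiv> {x \<in> V. coeff_norm x \<le> r}"

text \<open>The properties of the spaces \<open>V_g\<close> on which the theory of Haar measure depends.\<close>

locale haar_space =
  fixes V :: "('n::finite) Fvec set" and N :: nat
  assumes sub: "V \<subseteq> polar_vecs N"
    and zero: "0 \<in> V" and add: "\<And>x y. x \<in> V \<Longrightarrow> y \<in> V \<Longrightarrow> x + y \<in> V"
    and scale: "\<And>c x. x \<in> V \<Longrightarrow> rscale c x \<in> V"
    and compact_ball: "\<And>r. compactin (fd_topology V) (norm_ball V r)"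

text \<open>In coordinates the ball is the intersection of a compact box with closed conditions: the norm bound,
and the linear equations saying that g makes the vector integral.\<close>

lemma compact_norm_ball_V_space:
  assumes g: "g \<in> matrices_R"
  shows "compactin (fd_topology (V_space g)) (norm_ball (V_space g) r)"
proof -
  obtain N where N: "V_space g \<subseteq> polar_vecs N" using V_space_subset_polar[OF g] .
  define I :: "('a \<times> int) set" where "I = polar_index N"
  define S where "S p = (if p \<in> I then {-r..r} else {0})" for p
  define L where "L q c = (\<Sum>p\<in>I. c p * coords (g *v unit_vec p) q)" for q :: "'a \<times> int" and c
  define K where "K = PiE UNIV S \<inter> {c. (\<Sum>p\<in>I. \<bar>c p\<bar>) \<le> r} \<inter>
    (\<Inter>q\<in>UNIV \<times> {..<0}. {c. L q c = 0})"
  define dec :: "('a \<times> int \<Rightarrow> real) \<Rightarrow> 'a Fvec" where "dec c = (\<Sum>p\<in>I. rscale (c p) (unit_vec p))" for c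
  have "finite I" by (simp add: I_def)
  have coords_dec: "coords (dec c) p = (if p \<in> I then c p else 0)" for c p
    using \<open>finite I\<close> by (simp add: dec_def coords_sum coords_unit_vec if_distrib cong: if_cong)
  have compS: "compact (PiE UNIV S)"
    using compactin_PiE[of "\<lambda>_. euclidean" UNIV S]
    by (auto simp: S_def simp flip: compactin_euclidean_iff euclidean_product_topology)
       (auto simp: compactin_euclidean_iff)
  have cont: "continuous_on UNIV (\<lambda>c::'a \<times> int \<Rightarrow> real. c p)" for p
    by (rule continuous_on_product_coordinates)
  have clo: "closed {c::'a \<times> int \<Rightarrow> real. (\<Sum>p\<in>I. \<bar>c p\<bar>) \<le> r}" "closed {c. L q c = 0}" for q
    unfolding L_def by (intro closed_Collect_le closed_Collect_eq continuous_intros cont)+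
  then have "compact K" unfolding K_def Int_assoc by (intro compact_Int_closed compS closed_Int closed_INT) auto
  have polar_dec: "dec c \<in> polar_vecs N" for c
    unfolding polar_vecs_coords by (simp add: coords_dec I_def)
  have dec_V: "dec c \<in> V_space g \<longleftrightarrow> (\<forall>q\<in>UNIV \<times> {..<0}. L q c = 0)" for c
  proof -
    have "L q c = coords (g *v dec c) q" for q
      unfolding L_def coords_real_linear[OF real_linear_matrix polar_dec]
      by (simp add: I_def[symmetric] coords_dec)
    then show ?thesis
      using polar_dec[of c] polar_vecs_subset_Rminus by (auto simp: V_space_iff[OF g] R_vecs_iff coords_def)
  qed
  have norm_dec: "coeff_norm (dec c) = (\<Sum>p\<in>I. \<bar>c p\<bar>)" for c
    unfolding coeff_norm_polar[OF polar_dec] by (simp add: I_def[symmetric] coords_dec)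
  have K_I: "c p = 0" if "c \<in> K" "p \<notin> I" for c p
  proof -
    have "c p \<in> S p" using that by (auto simp: K_def)
    then show ?thesis using that by (simp add: S_def)
  qed
  have ball: "dec ` K = norm_ball (V_space g) r"
  proof (intro equalityI subsetI)
    fix x assume "x \<in> dec ` K"
    then show "x \<in> norm_ball (V_space g) r" by (auto simp: dec_V norm_dec K_def)
  next
    fix x assume x: "x \<in> norm_ball (V_space g) r"
    then have xN: "x \<in> polar_vecs N" using N by auto
    have 1: "x = dec (coords x)" unfolding dec_def I_def by (rule polar_vecs_expand[OF xN])
    have "coords x p \<in> S p" for p
    proof (cases "p \<in> I")
      case True
      have "\<bar>coords x p\<bar> \<le> r"
        using abs_coords_le[of x p] x xN polar_vecs_subset_Rminus by fastforce
      then show ?thesis using True by (auto simp: S_def)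
    next
      case False
      then have "coords x p = 0" using xN unfolding polar_vecs_coords I_def by blast
      then show ?thesis using False by (simp add: S_def)
    qed
    then have "coords x \<in> K"
      using x norm_dec[of "coords x"] dec_V[of "coords x"] unfolding 1[symmetric] K_def
      by (auto simp: PiE_UNIV_domain)
    then show "x \<in> dec ` K" using 1 by blast
  qed
  have "continuous_map (top_of_set K) (fd_topology (V_space g)) dec"
    unfolding fd_topology_def
  proof (rule continuous_map_pullback')
    have "continuous_on K (\<lambda>c. c)" by (rule continuous_on_id)
    then have "continuous_on K (coords \<circ> dec)"
      by (rule continuous_on_cong[THEN iffD1, rotated 2]) (auto simp: coords_dec fun_eq_iff K_I)
    then show "continuous_map (top_of_set K) euclidean (coords \<circ> dec)" by simp
    show "topspace (top_of_set K) \<subseteq> dec -` V_space g" using ball by auto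
  qed
  moreover have "compactin (top_of_set K) K" using \<open>compact K\<close> by (simp add: compactin_subtopology)
  ultimately show ?thesis using image_compactin ball by metis
qed

lemma haar_space_V_space:
  assumes "g \<in> matrices_R" obtains N where "haar_space (V_space g) N"
proof -
  obtain N where N: "V_space g \<subseteq> polar_vecs N" using V_space_subset_polar[OF assms] .
  then have "haar_space (V_space g) N"
    by unfold_locales (use assms V_space_closed compact_norm_ball_V_space in auto)
  then show ?thesis by (rule that)
qed

context haar_space begin

lemma Rminus: "x \<in> V \<Longrightarrow> x \<in> Rminus_vecs"
  using sub polar_vecs_subset_Rminus by blast

lemma uminus: "x \<in> V \<Longrightarrow> - x \<in> V"
proof -
  have "rscale (- 1) x = - x" for x :: "'n Fvec" by (rule coords_eqI) (simp add: coords_def split: prod.split)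
  then show "x \<in> V \<Longrightarrow> - x \<in> V" using scale[of x "-1"] by simp
qed

lemma diff: "x \<in> V \<Longrightarrow> y \<in> V \<Longrightarrow> x - y \<in> V"
  using add[of x "- y"] uminus by simp

lemma norm_measurable [measurable]: "coeff_norm \<in> borel_measurable (fd_borel V)"
  using measurable_coeff_norm[OF sub] .

lemma norm_ball_sets [measurable]: "norm_ball V r \<in> sets (fd_borel V)"
proof -
  have "{x \<in> space (fd_borel V). coeff_norm x \<le> r} \<in> sets (fd_borel V)" by measurable
  then show ?thesis by simp
qed

lemma translate_measurable [measurable]: "v \<in> V \<Longrightarrow> (\<lambda>x. x + v) \<in> fd_borel V \<rightarrow>\<^sub>M fd_borel V"
  by (rule measurable_fd_add[where V=V and W=V]) (auto intro: add measurable_const)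

lemma translate_image: "v \<in> V \<Longrightarrow> A \<subseteq> V \<Longrightarrow> (\<lambda>x. x + v) ` A = (\<lambda>x. x + (- v)) -` A \<inter> V"
  using diff add by (auto simp: image_iff) (metis diff_add_cancel)+

lemma compact_imp_norm_ball:
  assumes "compactin (fd_topology V) K" obtains r where "K \<subseteq> norm_ball V r"
proof -
  have "compact (coeff_norm ` K)"
    using image_compactin[OF assms continuous_map_coeff_norm[OF sub]] by simp
  then have "bounded (coeff_norm ` K)" by (rule compact_imp_bounded)
  then obtain r where "\<forall>x\<in>K. coeff_norm x \<le> r" unfolding bounded_iff by fastforce
  then show ?thesis using compactin_subset_topspace[OF assms] by (intro that[of r]) auto
qed

lemma haar_measureI:
  assumes "space \<mu> = V" "sets \<mu> = sets (fd_borel V)"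
    and trans: "\<And>A v. A \<in> sets (fd_borel V) \<Longrightarrow> v \<in> V \<Longrightarrow> emeasure \<mu> ((\<lambda>x. x + v) -` A \<inter> V) = emeasure \<mu> A"
    and fin: "\<And>r. emeasure \<mu> (norm_ball V r) < \<infinity>" and "emeasure \<mu> V \<noteq> 0"
  shows "haar_measure V \<mu>"
  unfolding haar_measure_def
proof (intro conjI ballI allI impI assms)
  fix A v assume "A \<in> sets \<mu>" "v \<in> V"
  moreover from this have "A \<subseteq> V" using sets.sets_into_space[of A \<mu>] assms by auto
  ultimately show "emeasure \<mu> ((\<lambda>x. x + v) ` A) = emeasure \<mu> A"
    using trans[of A "- v"] uminus assms(2) by (simp only: translate_image)
next
  fix K assume "compactin (fd_topology V) K"
  then obtain r where "K \<subseteq> norm_ball V r" using compact_imp_norm_ball by blast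
  moreover have "norm_ball V r \<in> sets \<mu>" using assms by simp
  ultimately have "emeasure \<mu> K \<le> emeasure \<mu> (norm_ball V r)" by (intro emeasure_mono)
  then show "emeasure \<mu> K < \<infinity>" using fin[of r] by (rule le_less_trans)
qed

text \<open>Compactness covers the ball of radius 2 by finitely many translates of the unit ball; by scaling,
the same number of translates serves for every radius.\<close>

lemma unit_ball_covering:
  obtains T where "finite T" "T \<subseteq> V"
    "\<And>r. r > 0 \<Longrightarrow> norm_ball V (2 * r) \<subseteq> (\<Union>v\<in>T. (\<lambda>x. x + rscale r v) ` norm_ball V r)"
proof -
  define U where "U v = {x \<in> V. coeff_norm (x - v) < 1}" for v
  have openU: "openin (fd_topology V) (U v)" if "v \<in> V" for v
  proof -
    have "continuous_map (fd_topology V) euclidean (\<lambda>x. coeff_norm (x - v))"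
      using that sub by (intro continuous_map_dist_norm[OF sub]) auto
    from openin_continuous_map_preimage[OF this, of "{..<1}"] show ?thesis
      by (simp add: U_def)
  qed
  have "norm_ball V 2 \<subseteq> \<Union> (U ` norm_ball V 2)" by (auto simp: U_def)
  moreover have "openin (fd_topology V) W" if "W \<in> U ` norm_ball V 2" for W
    using that openU by auto
  ultimately have "\<exists>F. finite F \<and> F \<subseteq> U ` norm_ball V 2 \<and> norm_ball V 2 \<subseteq> \<Union> F"
    by (intro compactinD[OF compact_ball[of 2]])
  then obtain F where F: "finite F" "F \<subseteq> U ` norm_ball V 2" "norm_ball V 2 \<subseteq> \<Union> F"
    by (elim exE conjE)
  from finite_subset_image[OF F(1,2)]
  obtain T where T: "finite T" "T \<subseteq> norm_ball V 2" "F = U ` T"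
    by (elim exE conjE)
  have "norm_ball V (2 * r) \<subseteq> (\<Union>v\<in>T. (\<lambda>x. x + rscale r v) ` norm_ball V r)" if r: "r > 0" for r
  proof
    fix x assume x: "x \<in> norm_ball V (2 * r)"
    define y where "y = rscale (1 / r) x"
    have "x = rscale r y" using r unfolding y_def by (intro coords_eqI) simp
    have "y \<in> norm_ball V 2"
      using x r by (simp add: y_def scale coeff_norm_rscale Rminus field_simps)
    then obtain v where v: "v \<in> T" "y \<in> U v" using F(3) T(3) by blast
    then have yv: "y - v \<in> V" "coeff_norm (y - v) < 1" using T(2) by (auto simp: U_def diff)
    then have "coeff_norm (rscale r (y - v)) \<le> r"
      using r by (subst coeff_norm_rscale) (auto simp: Rminus)
    then have "rscale r (y - v) \<in> norm_ball V r" using yv scale by blast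
    moreover have "x = rscale r (y - v) + rscale r v"
      unfolding \<open>x = rscale r y\<close> by (intro coords_eqI) (simp add: algebra_simps)
    ultimately show "x \<in> (\<Union>v\<in>T. (\<lambda>x. x + rscale r v) ` norm_ball V r)" using v(1) by blast
  qed
  note * = this
  have T2: "T \<subseteq> V" using T(2) by blast
  show ?thesis by (rule that[OF T(1) T2 *])
qed

end

locale haar = haar_space V N for V :: "('n::finite) Fvec set" and N +
  fixes \<mu> :: "'n Fvec measure"
  assumes haar: "haar_measure V \<mu>"
begin

lemma space_mu [simp]: "space \<mu> = V" and sets_mu [simp, measurable_cong]: "sets \<mu> = sets (fd_borel V)"
  using haar by (auto simp: haar_measure_def)

lemma emeasure_translate:
  "A \<in> sets (fd_borel V) \<Longrightarrow> v \<in> V \<Longrightarrow> emeasure \<mu> ((\<lambda>x. x + v) ` A) = emeasure \<mu> A"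
  using haar by (auto simp: haar_measure_def)

lemma translate_sets:
  assumes "A \<in> sets (fd_borel V)" "v \<in> V" shows "(\<lambda>x. x + v) ` A \<in> sets (fd_borel V)"
proof -
  have "(\<lambda>x. x + (- v)) -` A \<inter> space (fd_borel V) \<in> sets (fd_borel V)"
    by (rule measurable_sets[OF translate_measurable]) (use assms uminus in auto)
  then show ?thesis using assms sets.sets_into_space[OF assms(1)] by (simp add: translate_image)
qed

lemma emeasure_ball_finite: "emeasure \<mu> (norm_ball V r) < \<infinity>"
  using haar compact_ball by (auto simp: haar_measure_def)

lemma union_balls: "(\<Union>n. norm_ball V (real n)) = V"
  by (auto intro: real_arch_simple)

sublocale sigma_finite_measure \<mu>
proof
  show "\<exists>A. countable A \<and> A \<subseteq> sets \<mu> \<and> \<Union> A = space \<mu> \<and> (\<forall>a\<in>A. emeasure \<mu> a \<noteq> \<infinity>)"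
    using union_balls emeasure_ball_finite
    by (intro exI[of _ "range (\<lambda>n. norm_ball V (real n))"]) (auto simp: less_top[symmetric])
qed

lemma distr_translate: "v \<in> V \<Longrightarrow> distr \<mu> \<mu> (\<lambda>x. x + v) = \<mu>"
proof (rule measure_eqI)
  fix A assume v: "v \<in> V" and "A \<in> sets (distr \<mu> \<mu> (\<lambda>x. x + v))"
  then have A: "A \<in> sets (fd_borel V)" by simp
  then have "(\<lambda>x. x + v) -` A \<inter> V = (\<lambda>x. x + (- v)) ` A"
    using sets.sets_into_space[OF A] uminus[OF v] by (subst translate_image) auto
  then show "emeasure (distr \<mu> \<mu> (\<lambda>x. x + v)) A = emeasure \<mu> A"
    using A v uminus[OF v] by (simp add: emeasure_distr emeasure_translate del: add_uminus_conv_diff)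
qed simp

lemma nn_integral_translate:
  assumes "f \<in> borel_measurable (fd_borel V)" "v \<in> V"
  shows "(\<integral>\<^sup>+x. f (x + v) \<partial>\<mu>) = (\<integral>\<^sup>+x. f x \<partial>\<mu>)"
  by (subst (2) distr_translate[OF assms(2), symmetric], subst nn_integral_distr)
     (use assms in auto)

lemma integral_translate:
  fixes f :: "_ \<Rightarrow> complex"
  assumes "f \<in> borel_measurable (fd_borel V)" "v \<in> V"
  shows "(\<integral>x. f (x + v) \<partial>\<mu>) = (\<integral>x. f x \<partial>\<mu>)"
  by (subst (2) distr_translate[OF assms(2), symmetric], subst integral_distr)
     (use assms in auto)

lemma ball_growth:
  obtains m :: nat where "\<And>r. r > 0 \<Longrightarrow> emeasure \<mu> (norm_ball V (2 * r)) \<le> of_nat m * emeasure \<mu> (norm_ball V r)"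
proof -
  obtain T where T: "finite T" "T \<subseteq> V"
    "\<And>r. r > 0 \<Longrightarrow> norm_ball V (2 * r) \<subseteq> (\<Union>v\<in>T. (\<lambda>x. x + rscale r v) ` norm_ball V r)"
    using unit_ball_covering by blast
  have "emeasure \<mu> (norm_ball V (2 * r)) \<le> of_nat (card T) * emeasure \<mu> (norm_ball V r)" if r: "r > 0" for r
  proof -
    have sets: "(\<lambda>x. x + rscale r v) ` norm_ball V r \<in> sets \<mu>" if "v \<in> T" for v
      using translate_sets[of "norm_ball V r" "rscale r v"] that T(2) scale norm_ball_sets by auto
    have "emeasure \<mu> (norm_ball V (2 * r)) \<le> emeasure \<mu> (\<Union>v\<in>T. (\<lambda>x. x + rscale r v) ` norm_ball V r)"
      by (rule emeasure_mono[OF T(3)[OF r]]) (use sets T(1) in auto)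
    also have "\<dots> \<le> (\<Sum>v\<in>T. emeasure \<mu> ((\<lambda>x. x + rscale r v) ` norm_ball V r))"
      by (rule emeasure_subadditive_finite) (use sets T(1) in auto)
    also have "\<dots> = (\<Sum>v\<in>T. emeasure \<mu> (norm_ball V r))"
      by (rule sum.cong) (use T(2) scale emeasure_translate norm_ball_sets in auto)
    finally show ?thesis by simp
  qed
  then show ?thesis by (rule that)
qed

text \<open>Doubling the radius multiplies the volume by at most the fixed number of translates.\<close>

lemma ball_growth_power:
  obtains m :: nat where "\<And>j. emeasure \<mu> (norm_ball V (2 ^ j)) \<le> of_nat (m ^ j) * emeasure \<mu> (norm_ball V 1)"
proof -
  obtain m :: nat where m: "\<And>r. r > 0 \<Longrightarrow> emeasure \<mu> (norm_ball V (2 * r)) \<le> of_nat m * emeasure \<mu> (norm_ball V r)"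
    using ball_growth by blast
  have "emeasure \<mu> (norm_ball V (2 ^ j)) \<le> of_nat (m ^ j) * emeasure \<mu> (norm_ball V 1)" for j
  proof (induction j)
    case (Suc j)
    have "emeasure \<mu> (norm_ball V (2 ^ Suc j)) \<le> of_nat m * emeasure \<mu> (norm_ball V (2 ^ j))"
      using m[of "2 ^ j"] by simp
    also have "\<dots> \<le> of_nat m * (of_nat (m ^ j) * emeasure \<mu> (norm_ball V 1))"
      by (rule mult_left_mono[OF Suc]) simp
    finally show ?case by (simp add: mult.assoc)
  qed simp
  then show ?thesis by (rule that)
qed

text \<open>Otherwise all balls, and hence the whole space, would be null sets by the covering estimate.\<close>

lemma emeasure_unit_ball_pos: "0 < emeasure \<mu> (norm_ball V 1)"
proof (rule ccontr)
  assume "\<not> 0 < emeasure \<mu> (norm_ball V 1)"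
  then have z: "emeasure \<mu> (norm_ball V 1) = 0" by simp
  obtain m :: nat where m: "\<And>j. emeasure \<mu> (norm_ball V (2 ^ j)) \<le> of_nat (m ^ j) * emeasure \<mu> (norm_ball V 1)"
    using ball_growth_power by blast
  have "emeasure \<mu> (\<Union>j. norm_ball V (2 ^ j)) = 0"
    by (rule emeasure_UN_eq_0) (use m z in auto)
  moreover have "(\<Union>j. norm_ball V (2 ^ j)) = V"
    by (auto) (meson less_imp_le one_less_numeral_iff real_arch_pow semiring_norm(76))
  ultimately show False using haar by (simp add: haar_measure_def)
qed

text \<open>Polynomial growth of balls: the dyadic shells contribute a geometric series once \<open>2^k\<close> exceeds twice
the growth factor m.\<close>

lemma decay_integrable:
  obtains k where "integrable \<mu> (\<lambda>x. 1 / (1 + coeff_norm x) ^ k)"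
proof -
  obtain m :: nat where m: "\<And>j. emeasure \<mu> (norm_ball V (2 ^ j)) \<le> of_nat (m ^ j) * emeasure \<mu> (norm_ball V 1)"
    using ball_growth_power by blast
  \<comment> \<open>The j-th shell has measure of order m^j and the integrand is at most 2^(-jk) there.\<close>
  obtain k where k: "2 * real m < 2 ^ k" using real_arch_pow[of 2 "2 * real m"] by auto
  define M where "M = measure \<mu> (norm_ball V 1)"
  have M: "emeasure \<mu> (norm_ball V 1) = ennreal M"
    unfolding M_def using emeasure_ball_finite[of 1] by (intro emeasure_eq_ennreal_measure) auto
  have M0: "M \<ge> 0" by (simp add: M_def)
  let ?f = "\<lambda>x. 1 / (1 + coeff_norm x) ^ k"
  let ?g = "\<lambda>j x. ennreal ((1 / 2 ^ j) ^ k) * indicator (norm_ball V (2 ^ Suc j)) x"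
  have bound: "ennreal (?f x) \<le> (\<Sum>j. ?g j x)" if x: "x \<in> V" for x
  proof -
    define j where "j = (LEAST j. coeff_norm x \<le> 2 ^ Suc j)"
    obtain i where "coeff_norm x < 2 ^ i" using real_arch_pow[of 2] by auto
    then have "coeff_norm x \<le> 2 ^ Suc i" by simp (smt (verit) zero_le_power)
    then have j: "coeff_norm x \<le> 2 ^ Suc j" unfolding j_def by (rule LeastI)
    have "2 ^ j \<le> 1 + coeff_norm x"
    proof (cases j)
      case (Suc i)
      have "\<not> coeff_norm x \<le> 2 ^ Suc i" using not_less_Least[of i "\<lambda>j. coeff_norm x \<le> 2 ^ Suc j"] Suc
        by (simp add: j_def)
      then show ?thesis by (simp add: Suc)
    qed simp
    then have "?f x \<le> (1 / 2 ^ j) ^ k"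
      by (simp add: power_one_over inverse_eq_divide[symmetric] power_inverse)
         (intro le_imp_inverse_le power_mono; simp)
    then have "ennreal (?f x) \<le> ?g j x" using x j by (simp add: ennreal_leI)
    also have "?g j x \<le> (\<Sum>j. ?g j x)"
      using sum_le_suminf[of "\<lambda>j. ?g j x" "{j}"] by (simp only: sum.insert sum.empty finite.intros empty_iff not_False_eq_True add_0_right zero_le summableI)
    finally show ?thesis .
  qed
  have "(\<integral>\<^sup>+x. ennreal (?f x) \<partial>\<mu>) \<le> (\<integral>\<^sup>+x. (\<Sum>j. ?g j x) \<partial>\<mu>)"
    by (rule nn_integral_mono) (use bound in auto)
  also have "\<dots> = (\<Sum>j. \<integral>\<^sup>+x. ?g j x \<partial>\<mu>)"
    by (rule nn_integral_suminf) measurable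
  also have "\<dots> = (\<Sum>j. ennreal ((1 / 2 ^ j) ^ k) * emeasure \<mu> (norm_ball V (2 ^ Suc j)))"
    by (intro suminf_cong nn_integral_cmult_indicator) simp
  also have "\<dots> \<le> (\<Sum>j. ennreal (real m * M * (1 / 2) ^ j))"
  proof (rule suminf_le)
    fix j
    have "ennreal ((1 / 2 ^ j) ^ k) * emeasure \<mu> (norm_ball V (2 ^ Suc j)) \<le>
        ennreal ((1 / 2 ^ j) ^ k) * (ennreal (real m ^ Suc j) * ennreal M)"
      using m[of "Suc j"] M by (intro mult_left_mono) (auto simp: ennreal_of_nat_eq_real_of_nat)
    also have "\<dots> = ennreal ((1 / 2 ^ j) ^ k * (real m ^ Suc j * M))"
      using M0 by (simp add: ennreal_mult)
    also have "(1 / 2 ^ j) ^ k * (real m ^ Suc j * M) = real m * M * (real m / 2 ^ k) ^ j"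
      by (simp add: power_divide power_mult[symmetric] mult.commute field_simps)
    also have "ennreal \<dots> \<le> ennreal (real m * M * (1 / 2) ^ j)"
      using k M0 by (intro ennreal_leI mult_left_mono power_mono) (auto simp: field_simps)
    finally show "ennreal ((1 / 2 ^ j) ^ k) * emeasure \<mu> (norm_ball V (2 ^ Suc j)) \<le>
      ennreal (real m * M * (1 / 2) ^ j)" .
  qed auto
  also have "\<dots> < \<infinity>"
    using M0 by (subst suminf_ennreal_eq[OF _ sums_mult[OF geometric_sums]]) auto
  finally have "(\<integral>\<^sup>+x. ennreal (?f x) \<partial>\<mu>) < \<infinity>" .
  then have "integrable \<mu> ?f"
    by (intro integrableI_nonneg) auto
  then show ?thesis by (rule that)
qed

lemma haar_scale:
  assumes "c > 0" shows "haar_measure V (scale_measure (ennreal c) \<mu>)"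
proof -
  have "emeasure \<mu> ((\<lambda>x. x + v) -` A \<inter> V) = emeasure \<mu> A" if "A \<in> sets (fd_borel V)" "v \<in> V" for A v
    using emeasure_distr[of "\<lambda>x. x + v" \<mu> \<mu> A] that by (simp add: distr_translate)
  moreover have "emeasure \<mu> V \<noteq> 0" using haar by (simp add: haar_measure_def)
  ultimately show ?thesis
    using assms emeasure_ball_finite
    by (intro haar_measureI)
       (auto simp: space_scale_measure ennreal_mult_eq_top_iff less_top[symmetric] ennreal_mult_less_top)
qed

end

text \<open>The double integral of \<open>1_E(y) 1_A(x + y)\<close> for the unit ball E is evaluated in two ways: translating x
first gives the left side, translating y by -x first gives the right side, because E is symmetric.\<close>

lemma (in haar_space) haar_unique_cross:
  assumes "haar_measure V \<mu>" "haar_measure V \<nu>" "A \<in> sets (fd_borel V)"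
  shows "emeasure \<mu> A * emeasure \<nu> (norm_ball V 1) = emeasure \<nu> A * emeasure \<mu> (norm_ball V 1)"
proof -
  interpret m: haar V N \<mu> by unfold_locales fact
  interpret n: haar V N \<nu> by unfold_locales fact
  interpret mn: pair_sigma_finite \<mu> \<nu> ..
  let ?E = "norm_ball V 1"
  have A [measurable]: "A \<in> sets (fd_borel V)" by fact
  have E [measurable]: "?E \<in> sets (fd_borel V)" by simp
  have plus [measurable]: "(\<lambda>(x, y). x + y) \<in> fd_borel V \<Otimes>\<^sub>M fd_borel V \<rightarrow>\<^sub>M fd_borel V"
    unfolding split_beta
    by (rule measurable_fd_add[of _ _ V _ V]) (auto simp: space_pair_measure intro: add)
  have minus [measurable]: "(\<lambda>(x, y). y - x) \<in> fd_borel V \<Otimes>\<^sub>M fd_borel V \<rightarrow>\<^sub>M fd_borel V"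
    unfolding split_beta
    by (rule measurable_fd_diff[of _ _ V _ V]) (auto simp: space_pair_measure intro: diff)
  have sym: "indicator ?E (y - x) = (indicator ?E (x + (- y)) :: ennreal)" if "x \<in> V" "y \<in> V" for x y
    using that diff coeff_norm_minus_commute[of x y] by (auto simp: indicator_def)
  have [measurable]: "(\<lambda>(x, y). indicator ?E y * indicator A (x + y) :: ennreal) \<in> borel_measurable (\<mu> \<Otimes>\<^sub>M \<nu>)"
    "(\<lambda>(x, y). indicator ?E (y - x) * indicator A y :: ennreal) \<in> borel_measurable (\<mu> \<Otimes>\<^sub>M \<nu>)"
    using plus minus by measurable
  have "emeasure \<mu> A * emeasure \<nu> ?E = (\<integral>\<^sup>+y. emeasure \<mu> A * indicator ?E y \<partial>\<nu>)"
    by (rule nn_integral_cmult_indicator[symmetric]) simp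
  also have "\<dots> = (\<integral>\<^sup>+y. indicator ?E y * emeasure \<mu> A \<partial>\<nu>)"
    by (simp only: mult.commute)
  also have "\<dots> = (\<integral>\<^sup>+y. (\<integral>\<^sup>+x. indicator ?E y * indicator A (x + y) \<partial>\<mu>) \<partial>\<nu>)"
  proof (rule nn_integral_cong)
    fix y assume "y \<in> space \<nu>"
    then have y [measurable]: "y \<in> V" by simp
    have "(\<integral>\<^sup>+x. indicator ?E y * indicator A (x + y) \<partial>\<mu>) = indicator ?E y * (\<integral>\<^sup>+x. indicator A (x + y) \<partial>\<mu>)"
      by (rule nn_integral_cmult) measurable
    also have "(\<integral>\<^sup>+x. indicator A (x + y) \<partial>\<mu>) = emeasure \<mu> A"
      using m.nn_integral_translate[OF _ y, of "indicator A"] by simp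
    finally show "indicator ?E y * emeasure \<mu> A = (\<integral>\<^sup>+x. indicator ?E y * indicator A (x + y) \<partial>\<mu>)" ..
  qed
  also have "\<dots> = (\<integral>\<^sup>+x. (\<integral>\<^sup>+y. indicator ?E y * indicator A (x + y) \<partial>\<nu>) \<partial>\<mu>)"
    by (rule mn.Fubini') measurable
  also have "\<dots> = (\<integral>\<^sup>+x. (\<integral>\<^sup>+y. indicator ?E (y - x) * indicator A y \<partial>\<nu>) \<partial>\<mu>)"
  proof (rule nn_integral_cong)
    fix x assume "x \<in> space \<mu>"
    then have x: "x \<in> V" by simp
    have "(\<lambda>y. indicator ?E (y - x) * indicator A y :: ennreal) \<in> borel_measurable (fd_borel V)"
    proof (intro borel_measurable_times_ennreal)
      show "(\<lambda>y. indicator ?E (y - x) :: ennreal) \<in> borel_measurable (fd_borel V)"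
        using measurable_compose[OF translate_measurable[OF uminus[OF x]] borel_measurable_indicator[OF E]]
        by simp
    qed measurable
    from n.nn_integral_translate[OF this x]
    show "(\<integral>\<^sup>+y. indicator ?E y * indicator A (x + y) \<partial>\<nu>) = (\<integral>\<^sup>+y. indicator ?E (y - x) * indicator A y \<partial>\<nu>)"
      by (simp add: add.commute)
  qed
  also have "\<dots> = (\<integral>\<^sup>+y. (\<integral>\<^sup>+x. indicator ?E (y - x) * indicator A y \<partial>\<mu>) \<partial>\<nu>)"
    by (rule mn.Fubini'[symmetric]) measurable
  also have "\<dots> = (\<integral>\<^sup>+y. indicator A y * emeasure \<mu> ?E \<partial>\<nu>)"
  proof (rule nn_integral_cong)
    fix y assume "y \<in> space \<nu>"
    then have y: "y \<in> V" by simp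
    have "(\<integral>\<^sup>+x. indicator ?E (y - x) * indicator A y \<partial>\<mu>) = (\<integral>\<^sup>+x. indicator A y * indicator ?E (x + (- y)) \<partial>\<mu>)"
      by (intro nn_integral_cong) (use y in \<open>simp add: sym mult.commute del: add_uminus_conv_diff\<close>)
    also have "\<dots> = indicator A y * (\<integral>\<^sup>+x. indicator ?E (x + (- y)) \<partial>\<mu>)"
      by (rule nn_integral_cmult, unfold measurable_cong_sets[OF m.sets_mu HOL.refl])
         (use measurable_compose[OF translate_measurable[OF uminus[OF y]] borel_measurable_indicator[OF E]] in simp)
    also have "\<dots> = indicator A y * emeasure \<mu> ?E"
      using m.nn_integral_translate[OF _ uminus[OF y], of "indicator ?E"] by simp
    finally show "(\<integral>\<^sup>+x. indicator ?E (y - x) * indicator A y \<partial>\<mu>) = indicator A y * emeasure \<mu> ?E" .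
  qed
  also have "\<dots> = emeasure \<nu> A * emeasure \<mu> ?E"
    by (simp add: nn_integral_multc)
  finally show ?thesis .
qed

lemma (in haar_space) haar_unique:
  assumes "haar_measure V \<mu>" "haar_measure V \<nu>"
  obtains c where "c > 0" "\<mu> = scale_measure (ennreal c) \<nu>"
proof -
  interpret m: haar V N \<mu> by unfold_locales fact
  interpret n: haar V N \<nu> by unfold_locales fact
  let ?E = "norm_ball V 1"
  define a where "a = measure \<mu> ?E"
  define b where "b = measure \<nu> ?E"
  have E: "emeasure \<mu> ?E = ennreal a" "emeasure \<nu> ?E = ennreal b"
    unfolding a_def b_def using m.emeasure_ball_finite[of 1] n.emeasure_ball_finite[of 1]
    by (auto intro!: emeasure_eq_ennreal_measure)
  have ab: "a > 0" "b > 0"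
    using m.emeasure_unit_ball_pos n.emeasure_unit_ball_pos unfolding E by auto
  have "\<mu> = scale_measure (ennreal (a / b)) \<nu>"
  proof (rule measure_eqI)
    fix A assume "A \<in> sets \<mu>"
    then have "emeasure \<mu> A * ennreal b = emeasure \<nu> A * ennreal a"
      using haar_unique_cross[OF assms, of A] E by simp
    then have "emeasure \<mu> A * ennreal b * ennreal (1 / b) = emeasure \<nu> A * ennreal a * ennreal (1 / b)"
      by simp
    moreover have "ennreal b * ennreal (1 / b) = 1" "ennreal a * ennreal (1 / b) = ennreal (a / b)"
      using ab by (simp_all flip: ennreal_mult)
    ultimately have "emeasure \<mu> A = emeasure \<nu> A * (ennreal a * ennreal (1 / b))"
      by (simp only: mult.assoc mult_1_right)
    also have "ennreal a * ennreal (1 / b) = ennreal (a / b)" by fact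
    finally have "emeasure \<mu> A = ennreal (a / b) * emeasure \<nu> A" by (simp only: mult.commute)
    then show "emeasure \<mu> A = emeasure (scale_measure (ennreal (a / b)) \<nu>) A" by simp
  qed simp
  then show ?thesis using ab by (intro that[of "a / b"]) auto
qed

section \<open>The product of Haar measures\<close>

lemma Mhat_iff: "(g, \<mu>) \<in> Mhat \<longleftrightarrow> g \<in> matrices_R \<and> haar_measure (V_space g) \<mu>"
  by (simp add: Mhat_def)

lemma Mhat_haar:
  assumes "(g, \<mu>) \<in> Mhat" obtains N where "haar (V_space g) N \<mu>"
proof -
  obtain N where "haar_space (V_space g) N" using haar_space_V_space assms unfolding Mhat_iff by metis
  then have "haar (V_space g) N \<mu>" using assms by (simp add: haar_def haar_axioms_def Mhat_iff)
  then show ?thesis by (rule that)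
qed

lemma Mhat_sigma_finite:
  assumes "(g, \<mu>) \<in> Mhat" shows "sigma_finite_measure \<mu>"
proof -
  obtain N where "haar (V_space g) N \<mu>" using Mhat_haar[OF assms] .
  then interpret haar "V_space g" N \<mu> .
  show ?thesis by (rule sigma_finite_measure_axioms)
qed

lemma Mhat_sets: "(g, \<mu>) \<in> Mhat \<Longrightarrow> sets \<mu> = sets (fd_borel (V_space g))"
  and Mhat_space: "(g, \<mu>) \<in> Mhat \<Longrightarrow> space \<mu> = V_space g"
  by (auto simp: Mhat_iff haar_measure_def)

lemma matrices_R_mult: "g \<in> matrices_R \<Longrightarrow> h \<in> matrices_R \<Longrightarrow> g ** h \<in> matrices_R"
  by (simp add: matrices_R_iff integral_matrix_mult det_mul)

lemma matrices_R_cancel: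
  assumes "g \<in> matrices_R"
  shows "g *v (matrix_inv g *v x) = x" "matrix_inv g *v (g *v x) = x"
  using assms by (auto simp: matrices_R_iff matrix_inv_cancel)

lemma matrices_R_vector: "g \<in> matrices_R \<Longrightarrow> x \<in> R_vecs \<Longrightarrow> g *v x \<in> R_vecs"
  by (simp add: matrices_R_iff integral_matrix_vector)

text \<open>The map \<open>V_g1 \<times> V_g2 \<rightarrow> V_(g1 g2)\<close> occurring in the product of measures. It is a linear
bijection; \<open>glue_fst\<close> recovers the first component from its value.\<close>

abbreviation glue :: "('n::finite) Fmat \<Rightarrow> 'n Fvec \<Rightarrow> 'n Fvec \<Rightarrow> 'n Fvec" where
  "glue g y z \<equiv> proj_minus (matrix_inv g *v y + z)"

lemma proj_matrix_proj:
  assumes "g \<in> matrices_R" shows "proj_minus (g *v proj_minus x) = proj_minus (g *v x)"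
proof (rule proj_minus_cong[symmetric])
  have "g *v x - g *v proj_minus x = g *v (x - proj_minus x)"
    by (simp add: matrix_vector_mult_diff_distrib)
  then show "g *v x - g *v proj_minus x \<in> R_vecs"
    by (simp add: matrices_R_vector[OF assms])
qed

lemma V_space_iff_proj:
  assumes "g \<in> matrices_R"
  shows "x \<in> V_space g \<longleftrightarrow> x \<in> Rminus_vecs \<and> proj_minus (g *v x) = 0"
  by (simp add: V_space_iff[OF assms] proj_minus_eq_0_iff)

lemma glue_in_V_space:
  assumes "g1 \<in> matrices_R" "g2 \<in> matrices_R" "y \<in> V_space g1" "z \<in> V_space g2"
  shows "glue g2 y z \<in> V_space (g1 ** g2)"
proof -
  have "(g1 ** g2) *v (matrix_inv g2 *v y + z) = g1 *v y + g1 *v (g2 *v z)"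
    by (simp add: matrix_vector_right_distrib matrices_R_cancel assms flip: matrix_vector_mul_assoc)
  also have "g1 *v y + g1 *v (g2 *v z) \<in> R_vecs"
    using assms by (intro R_vecs_closed(2)[OF _ matrices_R_vector]) (simp_all add: V_space_iff)
  finally show ?thesis
    by (simp add: V_space_iff_proj proj_matrix_proj matrices_R_mult assms proj_minus_eq_0_iff)
qed

lemma glue_fst:
  assumes "g \<in> matrices_R" "y \<in> Rminus_vecs" "z \<in> V_space g"
  shows "proj_minus (g *v glue g y z) = y"
proof -
  have "proj_minus (g *v glue g y z) = proj_minus (y + g *v z)"
    by (simp add: proj_matrix_proj assms matrix_vector_right_distrib matrices_R_cancel)
  also have "\<dots> = y"
    using assms by (simp add: proj_minus_add proj_minus_id V_space_iff_proj)
  finally show ?thesis .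
qed

lemma glue_eq:
  assumes "z \<in> Rminus_vecs" shows "glue g y z = proj_minus (matrix_inv g *v y) + z"
  by (simp add: proj_minus_add proj_minus_id assms)

lemma glue_surj:
  assumes "g1 \<in> matrices_R" "g2 \<in> matrices_R" "v \<in> V_space (g1 ** g2)"
  obtains y z where "y \<in> V_space g1" "z \<in> V_space g2" "v = glue g2 y z"
proof -
  define y where "y = proj_minus (g2 *v v)"
  define z where "z = v - proj_minus (matrix_inv g2 *v y)"
  have v: "v \<in> Rminus_vecs" "(g1 ** g2) *v v \<in> R_vecs"
    using assms by (auto simp: V_space_iff matrices_R_mult)
  have y: "y \<in> V_space g1"
    using v by (simp add: V_space_iff_proj assms y_def proj_matrix_proj proj_minus_eq_0_iff matrix_vector_mul_assoc)
  have "proj_minus (g2 *v z) = proj_minus (g2 *v v) - proj_minus (g2 *v proj_minus (matrix_inv g2 *v y))"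
    by (simp add: z_def matrix_vector_mult_diff_distrib proj_minus_diff)
  also have "\<dots> = 0"
    by (simp add: proj_matrix_proj assms matrices_R_cancel) (simp add: y_def proj_minus_id)
  finally have z: "z \<in> V_space g2"
    using v by (simp add: V_space_iff_proj assms z_def Rminus_vecs_closed)
  have "v = glue g2 y z"
    using z by (subst glue_eq) (auto simp: z_def V_space_iff assms)
  with y z show ?thesis by (rule that)
qed

lemma glue_add: "glue g (y + y') (z + z') = glue g y z + glue g y' z'"
  by (simp add: matrix_vector_right_distrib algebra_simps flip: proj_minus_add)

text \<open>Both components are images of the value under linear maps of bounded pole order, hence are bounded
by it.\<close>

lemma glue_bounded_below:
  assumes "g1 \<in> matrices_R" "g2 \<in> matrices_R"
  obtains C where "C > 0"
    "\<And>y z. y \<in> V_space g1 \<Longrightarrow> z \<in> V_space g2 \<Longrightarrow>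
       coeff_norm y \<le> C * coeff_norm (glue g2 y z) \<and> coeff_norm z \<le> C * coeff_norm (glue g2 y z)"
proof -
  obtain N where N: "V_space (g1 ** g2) \<subseteq> polar_vecs N" using V_space_subset_polar matrices_R_mult assms by blast
  obtain N1 where N1: "V_space g1 \<subseteq> polar_vecs N1" using V_space_subset_polar assms by blast
  obtain A where A: "A > 0" "\<And>x. x \<in> polar_vecs N \<Longrightarrow> coeff_norm (proj_minus (g2 *v x)) \<le> A * coeff_norm x"
    by (rule real_linear_bounded[OF real_linear_proj_matrix[of g2]]) auto
  obtain B where B: "B > 0" "\<And>x. x \<in> polar_vecs N1 \<Longrightarrow> coeff_norm (proj_minus (matrix_inv g2 *v x)) \<le> B * coeff_norm x"
    by (rule real_linear_bounded[OF real_linear_proj_matrix[of "matrix_inv g2"]]) auto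
  have "coeff_norm y \<le> (A + B * A + 1) * coeff_norm (glue g2 y z) \<and> coeff_norm z \<le> (A + B * A + 1) * coeff_norm (glue g2 y z)"
    if y: "y \<in> V_space g1" and z: "z \<in> V_space g2" for y z
  proof -
    let ?w = "glue g2 y z"
    have w: "?w \<in> polar_vecs N" using glue_in_V_space[OF assms y z] N by blast
    have R: "y \<in> Rminus_vecs" "z \<in> Rminus_vecs" using y z by (auto simp: V_space_iff assms)
    have "coeff_norm y \<le> A * coeff_norm ?w"
      using A(2)[OF w] glue_fst[OF assms(2) R(1) z] by simp
    have "coeff_norm z = coeff_norm (?w - proj_minus (matrix_inv g2 *v y))"
      by (simp add: glue_eq R)
    also have "\<dots> \<le> coeff_norm ?w + coeff_norm (proj_minus (matrix_inv g2 *v y))"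
      using coeff_norm_triangle_diff[of "?w - proj_minus (matrix_inv g2 *v y)" "?w"]
        coeff_norm_minus_commute[of "?w - proj_minus (matrix_inv g2 *v y)" "?w"]
        coeff_norm_rscale[of "proj_minus (matrix_inv g2 *v y)" "-1"]
      by (simp add: Rminus_vecs_closed)
    also have "\<dots> \<le> coeff_norm ?w + B * coeff_norm y" using B(2) y N1 by auto
    also have "\<dots> \<le> coeff_norm ?w + B * (A * coeff_norm ?w)" using \<open>coeff_norm y \<le> _\<close> B(1) by simp
    finally have "coeff_norm z \<le> coeff_norm ?w + B * (A * coeff_norm ?w)" .
    moreover have "0 \<le> A * coeff_norm ?w" "0 \<le> B * (A * coeff_norm ?w)" "0 \<le> coeff_norm ?w"
      using A(1) B(1) by auto
    moreover have "(A + B * A + 1) * coeff_norm ?w = A * coeff_norm ?w + B * (A * coeff_norm ?w) + coeff_norm ?w"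
      by (simp only: ring_distribs mult.assoc mult_1_left)
    ultimately show ?thesis using \<open>coeff_norm y \<le> A * coeff_norm ?w\<close> by linarith
  qed
  moreover have "A + B * A + 1 > 0" using A(1) B(1) by (simp add: add_pos_pos)
  ultimately show ?thesis by (intro that[of "A + B * A + 1"]) auto
qed

lemma glue_measurable:
  assumes "g1 \<in> matrices_R" "g2 \<in> matrices_R"
  shows "(\<lambda>(y, z). glue g2 y z) \<in> fd_borel (V_space g1) \<Otimes>\<^sub>M fd_borel (V_space g2) \<rightarrow>\<^sub>M fd_borel (V_space (g1 ** g2))"
proof -
  obtain N1 where N1: "V_space g1 \<subseteq> polar_vecs N1" using V_space_subset_polar assms by blast
  have 1: "(\<lambda>y. proj_minus (matrix_inv g2 *v y)) \<in> fd_borel (V_space g1) \<rightarrow>\<^sub>M fd_borel UNIV"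
    by (rule measurable_real_linear[OF real_linear_proj_matrix N1]) auto
  have "(\<lambda>p. proj_minus (matrix_inv g2 *v fst p) + snd p)
     \<in> fd_borel (V_space g1) \<Otimes>\<^sub>M fd_borel (V_space g2) \<rightarrow>\<^sub>M fd_borel (V_space (g1 ** g2))"
  proof (rule measurable_fd_add[where V=UNIV and W="V_space g2"])
    show "(\<lambda>p. proj_minus (matrix_inv g2 *v fst p)) \<in> fd_borel (V_space g1) \<Otimes>\<^sub>M fd_borel (V_space g2) \<rightarrow>\<^sub>M fd_borel UNIV"
      by (rule measurable_compose[OF measurable_fst 1])
    fix p assume p: "p \<in> space (fd_borel (V_space g1) \<Otimes>\<^sub>M fd_borel (V_space g2))"
    then have "proj_minus (matrix_inv g2 *v fst p) + snd p = glue g2 (fst p) (snd p)"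
      by (subst glue_eq) (auto simp: space_pair_measure V_space_iff assms)
    then show "proj_minus (matrix_inv g2 *v fst p) + snd p \<in> V_space (g1 ** g2)"
      using glue_in_V_space[OF assms] p by (auto simp: space_pair_measure)
  qed simp
  then show ?thesis
  proof (rule measurable_cong[THEN iffD1, rotated])
    fix p assume "p \<in> space (fd_borel (V_space g1) \<Otimes>\<^sub>M fd_borel (V_space g2))"
    then show "proj_minus (matrix_inv g2 *v fst p) + snd p = (case p of (y, z) \<Rightarrow> glue g2 y z)"
      by (auto simp: space_pair_measure V_space_iff assms glue_eq)
  qed
qed

context
  fixes g1 g2 :: "('n::finite) Fmat" and \<mu>1 \<mu>2
  assumes M1: "(g1, \<mu>1) \<in> Mhat" and M2: "(g2, \<mu>2) \<in> Mhat"
begin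

lemma glue_measurable': "(\<lambda>(y, z). glue g2 y z) \<in> \<mu>1 \<Otimes>\<^sub>M \<mu>2 \<rightarrow>\<^sub>M fd_borel (V_space (g1 ** g2))"
  using glue_measurable[of g1 g2] M1 M2
  by (simp add: Mhat_iff measurable_cong_sets[OF sets_pair_measure_cong[OF Mhat_sets[OF M1] Mhat_sets[OF M2]] HOL.refl])

text \<open>The defining formula is the image of the product measure under \<^const>\<open>proj_minus\<close> of the sum. In
particular it is countably additive, so that it is the value of the measure.\<close>

lemma conv_measure_eq_distr:
  "conv_measure g1 \<mu>1 g2 \<mu>2 = distr (\<mu>1 \<Otimes>\<^sub>M \<mu>2) (fd_borel (V_space (g1 ** g2))) (\<lambda>(y, z). glue g2 y z)"
proof -
  interpret sigma_finite_measure \<mu>2 by (rule Mhat_sigma_finite[OF M2])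
  show ?thesis
    unfolding conv_measure_def distr_def space_fd_borel
  proof (rule measure_of_eq)
    show "sets (fd_borel (V_space (g1 ** g2))) \<subseteq> Pow (V_space (g1 ** g2))"
      using sets.space_closed[of "fd_borel (V_space (g1 ** g2))"] by simp
    fix A assume "A \<in> sigma_sets (V_space (g1 ** g2)) (sets (fd_borel (V_space (g1 ** g2))))"
    then have A: "A \<in> sets (fd_borel (V_space (g1 ** g2)))"
      using sets.sigma_sets_eq[of "fd_borel (V_space (g1 ** g2))"] by simp
    show "(\<integral>\<^sup>+y. (\<integral>\<^sup>+z. indicator A (glue g2 y z) \<partial>\<mu>2) \<partial>\<mu>1) =
      emeasure (\<mu>1 \<Otimes>\<^sub>M \<mu>2) ((\<lambda>(y, z). glue g2 y z) -` A \<inter> space (\<mu>1 \<Otimes>\<^sub>M \<mu>2))"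
      by (subst emeasure_pair_measure[OF measurable_sets[OF glue_measurable' A]])
         (auto intro!: nn_integral_cong simp: indicator_def space_pair_measure)
  qed
qed

lemma sets_conv_measure [simp]: "sets (conv_measure g1 \<mu>1 g2 \<mu>2) = sets (fd_borel (V_space (g1 ** g2)))"
  and space_conv_measure [simp]: "space (conv_measure g1 \<mu>1 g2 \<mu>2) = V_space (g1 ** g2)"
  by (simp_all add: conv_measure_eq_distr)

lemma nn_integral_conv_inner_measurable:
  assumes f: "f \<in> borel_measurable (fd_borel (V_space (g1 ** g2)))"
  shows "(\<lambda>y. \<integral>\<^sup>+z. f (glue g2 y z) \<partial>\<mu>2) \<in> borel_measurable \<mu>1"
proof -
  interpret sigma_finite_measure \<mu>2 by (rule Mhat_sigma_finite[OF M2])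
  show ?thesis
    using borel_measurable_nn_integral_fst[OF measurable_compose[OF glue_measurable' f]] by simp
qed

lemma nn_integral_conv:
  assumes f: "f \<in> borel_measurable (fd_borel (V_space (g1 ** g2)))"
  shows "(\<integral>\<^sup>+x. f x \<partial>conv_measure g1 \<mu>1 g2 \<mu>2) = (\<integral>\<^sup>+y. (\<integral>\<^sup>+z. f (glue g2 y z) \<partial>\<mu>2) \<partial>\<mu>1)"
proof -
  interpret sigma_finite_measure \<mu>2 by (rule Mhat_sigma_finite[OF M2])
  show ?thesis
    using nn_integral_fst[OF measurable_compose[OF glue_measurable' f]] f
    by (simp add: conv_measure_eq_distr nn_integral_distr[OF glue_measurable'] case_prod_beta)
qed

lemma glue_section_measurable:
  assumes f: "f \<in> borel_measurable (fd_borel (V_space (g1 ** g2)))" and "y \<in> V_space g1"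
  shows "(\<lambda>z. f (glue g2 y z)) \<in> borel_measurable \<mu>2"
proof -
  have "Pair y \<in> \<mu>2 \<rightarrow>\<^sub>M \<mu>1 \<Otimes>\<^sub>M \<mu>2"
    using assms(2) Mhat_space[OF M1] by (intro measurable_Pair1') simp
  from measurable_compose[OF this measurable_compose[OF glue_measurable' f]] show ?thesis by simp
qed

lemma emeasure_conv:
  assumes "A \<in> sets (fd_borel (V_space (g1 ** g2)))"
  shows "emeasure (conv_measure g1 \<mu>1 g2 \<mu>2) A = (\<integral>\<^sup>+y. (\<integral>\<^sup>+z. indicator A (glue g2 y z) \<partial>\<mu>2) \<partial>\<mu>1)"
  using nn_integral_conv[of "indicator A"] assms by simp

text \<open>Translations of the target lift to translations of the two factors, and preimages of balls lie in
products of balls.\<close>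

lemma Mhat_conv: "(g1 ** g2, conv_measure g1 \<mu>1 g2 \<mu>2) \<in> Mhat"
proof -
  have g: "g1 \<in> matrices_R" "g2 \<in> matrices_R" using M1 M2 by (auto simp: Mhat_iff)
  obtain N1 where "haar (V_space g1) N1 \<mu>1" using Mhat_haar[OF M1] .
  then interpret h1: haar "V_space g1" N1 \<mu>1 .
  obtain N2 where "haar (V_space g2) N2 \<mu>2" using Mhat_haar[OF M2] .
  then interpret h2: haar "V_space g2" N2 \<mu>2 .
  let ?V = "V_space (g1 ** g2)"
  obtain N where "haar_space ?V N" using haar_space_V_space[OF matrices_R_mult[OF g]] .
  then interpret h: haar_space ?V N .
  have "haar_measure ?V (conv_measure g1 \<mu>1 g2 \<mu>2)"
  proof (rule h.haar_measureI)
    fix A v assume A: "A \<in> sets (fd_borel ?V)" and v: "v \<in> ?V"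
    obtain y0 z0 where yz: "y0 \<in> V_space g1" "z0 \<in> V_space g2" "v = glue g2 y0 z0"
      using glue_surj[OF g v] .
    have A': "(\<lambda>x. x + v) -` A \<inter> ?V \<in> sets (fd_borel ?V)"
      using measurable_sets[OF h.translate_measurable[OF v] A] by simp
    let ?I = "\<lambda>y. \<integral>\<^sup>+z. indicator A (glue g2 y z) \<partial>\<mu>2"
    have iA: "(indicator A :: _ \<Rightarrow> ennreal) \<in> borel_measurable (fd_borel ?V)" using A by simp
    have "emeasure (conv_measure g1 \<mu>1 g2 \<mu>2) ((\<lambda>x. x + v) -` A \<inter> ?V) =
       (\<integral>\<^sup>+y. (\<integral>\<^sup>+z. indicator A (glue g2 (y + y0) (z + z0)) \<partial>\<mu>2) \<partial>\<mu>1)"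
      unfolding emeasure_conv[OF A']
      by (intro nn_integral_cong)
         (use glue_in_V_space[OF g] in \<open>auto simp: indicator_def glue_add yz(3)\<close>)
    also have "\<dots> = (\<integral>\<^sup>+y. ?I (y + y0) \<partial>\<mu>1)"
    proof (rule nn_integral_cong)
      fix y assume "y \<in> space \<mu>1"
      then have "y + y0 \<in> V_space g1" using yz h1.add by simp
      then show "(\<integral>\<^sup>+z. indicator A (glue g2 (y + y0) (z + z0)) \<partial>\<mu>2) = ?I (y + y0)"
        using h2.nn_integral_translate[of "\<lambda>z. indicator A (glue g2 (y + y0) z)" z0]
          glue_section_measurable[OF iA] yz(2) by (simp cong: measurable_cong_sets)
    qed
    also have "\<dots> = (\<integral>\<^sup>+y. ?I y \<partial>\<mu>1)"
      by (rule h1.nn_integral_translate[OF _ yz(1)])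
         (use nn_integral_conv_inner_measurable[OF iA] in \<open>simp cong: measurable_cong_sets\<close>)
    also have "\<dots> = emeasure (conv_measure g1 \<mu>1 g2 \<mu>2) A" by (simp only: emeasure_conv[OF A])
    finally show "emeasure (conv_measure g1 \<mu>1 g2 \<mu>2) ((\<lambda>x. x + v) -` A \<inter> ?V) =
      emeasure (conv_measure g1 \<mu>1 g2 \<mu>2) A" .
  next
    fix r
    obtain C where C: "C > 0"
      "\<And>y z. y \<in> V_space g1 \<Longrightarrow> z \<in> V_space g2 \<Longrightarrow>
       coeff_norm y \<le> C * coeff_norm (glue g2 y z) \<and> coeff_norm z \<le> C * coeff_norm (glue g2 y z)"
      using glue_bounded_below[OF g] by blast
    let ?B1 = "norm_ball (V_space g1) (C * r)" and ?B2 = "norm_ball (V_space g2) (C * r)"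
    have "emeasure (conv_measure g1 \<mu>1 g2 \<mu>2) (norm_ball ?V r) \<le>
      (\<integral>\<^sup>+y. (\<integral>\<^sup>+z. indicator ?B1 y * indicator ?B2 z \<partial>\<mu>2) \<partial>\<mu>1)"
      unfolding emeasure_conv[OF h.norm_ball_sets]
    proof (intro nn_integral_mono)
      fix y z assume "y \<in> space \<mu>1" "z \<in> space \<mu>2"
      moreover have "C * coeff_norm (glue g2 y z) \<le> C * r" if "coeff_norm (glue g2 y z) \<le> r"
        using that C(1) by simp
      ultimately show "indicator (norm_ball ?V r) (glue g2 y z) \<le> (indicator ?B1 y * indicator ?B2 z :: ennreal)"
        using C(2)[of y z] by (auto simp: indicator_def)
    qed
    also have "\<dots> = emeasure \<mu>1 ?B1 * emeasure \<mu>2 ?B2"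
      by (simp add: nn_integral_cmult nn_integral_multc h1.norm_ball_sets h2.norm_ball_sets)
    also have "\<dots> < \<infinity>"
      using h1.emeasure_ball_finite h2.emeasure_ball_finite by (simp add: ennreal_mult_less_top)
    finally show "emeasure (conv_measure g1 \<mu>1 g2 \<mu>2) (norm_ball ?V r) < \<infinity>" .
  next
    have "?V \<in> sets (fd_borel ?V)" using sets.top[of "fd_borel ?V"] by simp
    from emeasure_conv[OF this]
    have "emeasure (conv_measure g1 \<mu>1 g2 \<mu>2) ?V = (\<integral>\<^sup>+y. (\<integral>\<^sup>+z. indicator ?V (glue g2 y z) \<partial>\<mu>2) \<partial>\<mu>1)" .
    also have "\<dots> = (\<integral>\<^sup>+y. (\<integral>\<^sup>+z. 1 \<partial>\<mu>2) \<partial>\<mu>1)"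
      by (intro nn_integral_cong) (simp add: glue_in_V_space[OF g])
    also have "\<dots> = emeasure \<mu>2 (V_space g2) * emeasure \<mu>1 (V_space g1)" by simp
    also have "\<dots> \<noteq> 0" using M1 M2 by (simp add: Mhat_iff haar_measure_def)
    finally show "emeasure (conv_measure g1 \<mu>1 g2 \<mu>2) ?V \<noteq> 0" .
  qed simp_all
  then show ?thesis by (simp add: Mhat_iff matrices_R_mult g)
qed

end

lemma Mhat_mult_closed: "\<alpha> \<in> Mhat \<Longrightarrow> \<beta> \<in> Mhat \<Longrightarrow> Mhat_mult \<alpha> \<beta> \<in> Mhat"
  by (cases \<alpha>; cases \<beta>) (simp add: Mhat_mult_def Mhat_conv)

text \<open>The two iterated integrals differ in where polar parts are taken. This changes the innermost argument by
an element of \<open>V_g3\<close>, which translation invariance of the third measure absorbs.\<close>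

lemma conv_measure_assoc:
  assumes M1: "(g1, \<mu>1) \<in> Mhat" and M2: "(g2, \<mu>2) \<in> Mhat" and M3: "(g3, \<mu>3) \<in> Mhat"
  shows "conv_measure (g1 ** g2) (conv_measure g1 \<mu>1 g2 \<mu>2) g3 \<mu>3 =
         conv_measure g1 \<mu>1 (g2 ** g3) (conv_measure g2 \<mu>2 g3 \<mu>3)"
proof (rule measure_eqI)
  note M12 = Mhat_conv[OF M1 M2] and M23 = Mhat_conv[OF M2 M3]
  have g: "g1 \<in> matrices_R" "g2 \<in> matrices_R" "g3 \<in> matrices_R" using M1 M2 M3 by (auto simp: Mhat_iff)
  obtain N3 where "haar (V_space g3) N3 \<mu>3" using Mhat_haar[OF M3] .
  then interpret h3: haar "V_space g3" N3 \<mu>3 .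
  show "sets (conv_measure (g1 ** g2) (conv_measure g1 \<mu>1 g2 \<mu>2) g3 \<mu>3) =
        sets (conv_measure g1 \<mu>1 (g2 ** g3) (conv_measure g2 \<mu>2 g3 \<mu>3))"
    by (simp add: sets_conv_measure[OF M12 M3] sets_conv_measure[OF M1 M23] matrix_mul_assoc)
  fix A assume "A \<in> sets (conv_measure (g1 ** g2) (conv_measure g1 \<mu>1 g2 \<mu>2) g3 \<mu>3)"
  then have A: "A \<in> sets (fd_borel (V_space (g1 ** g2 ** g3)))" "A \<in> sets (fd_borel (V_space (g1 ** (g2 ** g3))))"
    by (simp_all add: sets_conv_measure[OF M12 M3] matrix_mul_assoc)
  have iA: "(indicator A :: _ \<Rightarrow> ennreal) \<in> borel_measurable (fd_borel (V_space (g1 ** g2 ** g3)))"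
    "(indicator A :: _ \<Rightarrow> ennreal) \<in> borel_measurable (fd_borel (V_space (g1 ** (g2 ** g3))))"
    using A by simp_all
  let ?J = "\<lambda>w. \<integral>\<^sup>+z. indicator A (glue g3 w z) \<partial>\<mu>3"
  have J: "?J \<in> borel_measurable (fd_borel (V_space (g1 ** g2)))"
    using nn_integral_conv_inner_measurable[OF M12 M3 iA(1)]
    by (simp add: sets_conv_measure[OF M1 M2] cong: measurable_cong_sets)
  have "emeasure (conv_measure (g1 ** g2) (conv_measure g1 \<mu>1 g2 \<mu>2) g3 \<mu>3) A =
     (\<integral>\<^sup>+y. (\<integral>\<^sup>+z. ?J (glue g2 y z) \<partial>\<mu>2) \<partial>\<mu>1)"
    by (simp only: emeasure_conv[OF M12 M3 A(1)] nn_integral_conv[OF M1 M2 J])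
  also have "\<dots> = (\<integral>\<^sup>+y. (\<integral>\<^sup>+w. indicator A (glue (g2 ** g3) y w) \<partial>conv_measure g2 \<mu>2 g3 \<mu>3) \<partial>\<mu>1)"
  proof (rule nn_integral_cong)
    fix y assume "y \<in> space \<mu>1"
    then have y: "y \<in> V_space g1" by (simp add: Mhat_space[OF M1])
    have f: "(\<lambda>w. indicator A (glue (g2 ** g3) y w) :: ennreal) \<in> borel_measurable (fd_borel (V_space (g2 ** g3)))"
      using glue_section_measurable[OF M1 M23 iA(2) y]
      by (simp add: sets_conv_measure[OF M2 M3] cong: measurable_cong_sets)
    have "(\<integral>\<^sup>+w. indicator A (glue (g2 ** g3) y w) \<partial>conv_measure g2 \<mu>2 g3 \<mu>3) =
      (\<integral>\<^sup>+z. (\<integral>\<^sup>+u. indicator A (glue (g2 ** g3) y (glue g3 z u)) \<partial>\<mu>3) \<partial>\<mu>2)"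
      by (rule nn_integral_conv[OF M2 M3 f])
    also have "\<dots> = (\<integral>\<^sup>+z. ?J (glue g2 y z) \<partial>\<mu>2)"
    proof (rule nn_integral_cong)
      fix z assume "z \<in> space \<mu>2"
      then have z: "z \<in> V_space g2" by (simp add: Mhat_space[OF M2])
      define r where "r = matrix_inv g2 *v y + z - glue g2 y z"
      have "r \<in> R_vecs" by (simp add: r_def)
      define v where "v = proj_minus (matrix_inv g3 *v r)"
      have v: "v \<in> V_space g3"
        using \<open>r \<in> R_vecs\<close> unfolding v_def V_space_def by blast
      have eq: "glue (g2 ** g3) y (glue g3 z u) = glue g3 (glue g2 y z) (u + v)" for u
      proof -
        have "glue (g2 ** g3) y (glue g3 z u) = proj_minus (matrix_inv g3 *v (matrix_inv g2 *v y + z) + u)"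
          using g by (intro proj_minus_cong)
            (simp add: matrix_inv_mult matrices_R_iff matrix_vector_right_distrib
              matrix_vector_mul_assoc R_vecs_iff proj_minus_nth)
        also have "matrix_inv g2 *v y + z = glue g2 y z + r" by (simp add: r_def)
        also have "proj_minus (matrix_inv g3 *v (glue g2 y z + r) + u) = glue g3 (glue g2 y z) (u + v)"
          unfolding v_def
          by (intro proj_minus_cong)
            (simp add: matrix_vector_right_distrib R_vecs_iff proj_minus_nth)
        finally show ?thesis .
      qed
      have w: "glue g2 y z \<in> V_space (g1 ** g2)" by (rule glue_in_V_space[OF g(1,2) y z])
      have "(\<lambda>u. indicator A (glue g3 (glue g2 y z) u) :: ennreal) \<in> borel_measurable (fd_borel (V_space g3))"
        using glue_section_measurable[OF M12 M3 iA(1) w] by (simp cong: measurable_cong_sets)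
      then show "(\<integral>\<^sup>+u. indicator A (glue (g2 ** g3) y (glue g3 z u)) \<partial>\<mu>3) = ?J (glue g2 y z)"
        unfolding eq using h3.nn_integral_translate[OF _ v, of "\<lambda>u. indicator A (glue g3 (glue g2 y z) u)"] by simp
    qed
    finally show "(\<integral>\<^sup>+z. ?J (glue g2 y z) \<partial>\<mu>2) =
      (\<integral>\<^sup>+w. indicator A (glue (g2 ** g3) y w) \<partial>conv_measure g2 \<mu>2 g3 \<mu>3)" ..
  qed
  also have "\<dots> = emeasure (conv_measure g1 \<mu>1 (g2 ** g3) (conv_measure g2 \<mu>2 g3 \<mu>3)) A"
    by (rule emeasure_conv[OF M1 M23 A(2), symmetric])
  finally show "emeasure (conv_measure (g1 ** g2) (conv_measure g1 \<mu>1 g2 \<mu>2) g3 \<mu>3) A =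
    emeasure (conv_measure g1 \<mu>1 (g2 ** g3) (conv_measure g2 \<mu>2 g3 \<mu>3)) A" .
qed

lemma Mhat_mult_assoc:
  "\<alpha> \<in> Mhat \<Longrightarrow> \<beta> \<in> Mhat \<Longrightarrow> \<gamma> \<in> Mhat \<Longrightarrow> Mhat_mult (Mhat_mult \<alpha> \<beta>) \<gamma> = Mhat_mult \<alpha> (Mhat_mult \<beta> \<gamma>)"
  by (cases \<alpha>; cases \<beta>; cases \<gamma>) (simp add: Mhat_mult_def conv_measure_assoc matrix_mul_assoc)

definition Mhat_scale :: "real \<Rightarrow> ('n::finite) Fmat \<times> 'n Fvec measure \<Rightarrow> 'n Fmat \<times> 'n Fvec measure" where
  "Mhat_scale c \<alpha> = (fst \<alpha>, scale_measure (ennreal c) (snd \<alpha>))"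

lemma Mhat_scale_closed:
  assumes "c > 0" "\<alpha> \<in> Mhat" shows "Mhat_scale c \<alpha> \<in> Mhat"
proof (cases \<alpha>)
  case (Pair g \<mu>)
  then obtain N where "haar (V_space g) N \<mu>" using Mhat_haar assms by metis
  from haar.haar_scale[OF this assms(1)] show ?thesis
    using assms(2) by (simp add: Pair Mhat_scale_def Mhat_iff)
qed

lemma Mhat_unique:
  assumes "(g, \<mu>) \<in> Mhat" "(g, \<nu>) \<in> Mhat"
  obtains c where "c > 0" "(g, \<mu>) = Mhat_scale c (g, \<nu>)"
proof -
  obtain N where "haar_space (V_space g) N" using haar_space_V_space assms unfolding Mhat_iff by metis
  then interpret haar_space "V_space g" N .
  obtain c where "c > 0" "\<mu> = scale_measure (ennreal c) \<nu>"
    using haar_unique assms unfolding Mhat_iff by metis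
  then show ?thesis by (intro that[of c]) (simp_all add: Mhat_scale_def)
qed

lemma Mhat_scale_scale: "a > 0 \<Longrightarrow> b > 0 \<Longrightarrow> Mhat_scale a (Mhat_scale b \<alpha>) = Mhat_scale (a * b) \<alpha>"
  by (simp add: Mhat_scale_def ennreal_mult)

lemma Mhat_scale_1 [simp]: "Mhat_scale 1 \<alpha> = \<alpha>"
  by (simp add: Mhat_scale_def)

lemma Mhat_mult_scale_left:
  assumes "c > 0" "\<alpha> \<in> Mhat" "\<beta> \<in> Mhat"
  shows "Mhat_mult (Mhat_scale c \<alpha>) \<beta> = Mhat_scale c (Mhat_mult \<alpha> \<beta>)"
proof -
  obtain g1 \<mu>1 g2 \<mu>2 where [simp]: "\<alpha> = (g1, \<mu>1)" "\<beta> = (g2, \<mu>2)" by (cases \<alpha>; cases \<beta>)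
  have M: "(g1, scale_measure (ennreal c) \<mu>1) \<in> Mhat" "(g1, \<mu>1) \<in> Mhat" "(g2, \<mu>2) \<in> Mhat"
    using Mhat_scale_closed[OF assms(1,2)] assms by (simp_all add: Mhat_scale_def)
  have "conv_measure g1 (scale_measure (ennreal c) \<mu>1) g2 \<mu>2 = scale_measure (ennreal c) (conv_measure g1 \<mu>1 g2 \<mu>2)"
  proof (rule measure_eqI)
    fix A assume "A \<in> sets (conv_measure g1 (scale_measure (ennreal c) \<mu>1) g2 \<mu>2)"
    then have A: "A \<in> sets (fd_borel (V_space (g1 ** g2)))" by (simp add: sets_conv_measure[OF M(1,3)])
    show "emeasure (conv_measure g1 (scale_measure (ennreal c) \<mu>1) g2 \<mu>2) A =
      emeasure (scale_measure (ennreal c) (conv_measure g1 \<mu>1 g2 \<mu>2)) A"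
      using nn_integral_conv_inner_measurable[OF M(2,3), of "indicator A"] A
      by (simp add: emeasure_conv[OF M(1,3)] emeasure_conv[OF M(2,3)] nn_integral_scale_measure)
  qed (simp add: sets_conv_measure[OF M(1,3)] sets_conv_measure[OF M(2,3)])
  then show ?thesis by (simp add: Mhat_mult_def Mhat_scale_def)
qed

lemma Mhat_mult_scale_right:
  assumes "c > 0" "\<alpha> \<in> Mhat" "\<beta> \<in> Mhat"
  shows "Mhat_mult \<alpha> (Mhat_scale c \<beta>) = Mhat_scale c (Mhat_mult \<alpha> \<beta>)"
proof -
  obtain g1 \<mu>1 g2 \<mu>2 where [simp]: "\<alpha> = (g1, \<mu>1)" "\<beta> = (g2, \<mu>2)" by (cases \<alpha>; cases \<beta>)
  have M: "(g2, scale_measure (ennreal c) \<mu>2) \<in> Mhat" "(g1, \<mu>1) \<in> Mhat" "(g2, \<mu>2) \<in> Mhat"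
    using Mhat_scale_closed[OF assms(1,3)] assms by (simp_all add: Mhat_scale_def)
  have "conv_measure g1 \<mu>1 g2 (scale_measure (ennreal c) \<mu>2) = scale_measure (ennreal c) (conv_measure g1 \<mu>1 g2 \<mu>2)"
  proof (rule measure_eqI)
    fix A assume "A \<in> sets (conv_measure g1 \<mu>1 g2 (scale_measure (ennreal c) \<mu>2))"
    then have A: "A \<in> sets (fd_borel (V_space (g1 ** g2)))" by (simp add: sets_conv_measure[OF M(2,1)])
    have iA: "(indicator A :: _ \<Rightarrow> ennreal) \<in> borel_measurable (fd_borel (V_space (g1 ** g2)))" using A by simp
    have "emeasure (conv_measure g1 \<mu>1 g2 (scale_measure (ennreal c) \<mu>2)) A =
      (\<integral>\<^sup>+y. ennreal c * (\<integral>\<^sup>+z. indicator A (glue g2 y z) \<partial>\<mu>2) \<partial>\<mu>1)"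
      unfolding emeasure_conv[OF M(2,1) A]
      by (intro nn_integral_cong nn_integral_scale_measure glue_section_measurable[OF M(2,3) iA])
         (simp add: Mhat_space[OF M(2)])
    then show "emeasure (conv_measure g1 \<mu>1 g2 (scale_measure (ennreal c) \<mu>2)) A =
      emeasure (scale_measure (ennreal c) (conv_measure g1 \<mu>1 g2 \<mu>2)) A"
      using nn_integral_conv_inner_measurable[OF M(2,3) iA]
      by (simp add: emeasure_conv[OF M(2,3) A] nn_integral_cmult)
  qed (simp add: sets_conv_measure[OF M(2,1)] sets_conv_measure[OF M(2,3)])
  then show ?thesis by (simp add: Mhat_mult_def Mhat_scale_def)
qed

section \<open>The standard measures\<close>

definition st_index :: "nat \<Rightarrow> (nat \<times> 'n::finite) set" where
  "st_index l = {1..l} \<times> UNIV"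

definition st_coords :: "nat \<Rightarrow> (nat \<times> 'n \<Rightarrow> real) \<Rightarrow> ('n::finite) Fvec" where
  "st_coords l c = (\<chi> j. \<Sum>i\<in>{1..l}. fls_const (c (i, j)) * fls_X_intpow (- int i))"

abbreviation st_lebesgue :: "nat \<Rightarrow> (nat \<times> 'n::finite \<Rightarrow> real) measure" where
  "st_lebesgue l \<equiv> (\<Pi>\<^sub>M p\<in>st_index l. lborel)"

lemma finite_st_index [simp]: "finite (st_index l)"
  by (simp add: st_index_def)

lemma mu_st_eq: "mu_st l = distr (st_lebesgue l) (fd_borel (polar_vecs l)) (st_coords l)"
  by (simp add: mu_st_def st_index_def st_coords_def[abs_def] polar_vecs_eq_V_space)

lemma coords_st_coords:
  "coords (st_coords l c) (j, i) = (if - int l \<le> i \<and> i < 0 then c (nat (- i), j) else 0)"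
proof -
  have "coords (st_coords l c) (j, i) = (\<Sum>k\<in>{1..l}. if i = - int k then c (k, j) else 0)"
    by (simp add: coords_def st_coords_def fls_nth_sum) (intro sum.cong; auto)
  also have "\<dots> = (\<Sum>k\<in>{1..l}. if k = nat (- i) \<and> i < 0 then c (k, j) else 0)"
    by (intro sum.cong) auto
  also have "\<dots> = (if - int l \<le> i \<and> i < 0 then c (nat (- i), j) else 0)"
    by (cases "i < 0") (auto simp: nat_le_iff)
  finally show ?thesis .
qed

lemma st_coords_in_polar [simp]: "st_coords l c \<in> polar_vecs l"
  unfolding polar_vecs_coords split_paired_All coords_st_coords by auto

lemma measurable_st_coords [measurable]:
  "(st_coords l :: _ \<Rightarrow> ('n::finite) Fvec) \<in> st_lebesgue l \<rightarrow>\<^sub>M fd_borel (polar_vecs l)"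
proof (rule measurable_fd_borelI)
  fix p :: "'n \<times> int"
  obtain j i where p: "p = (j, i)" by (cases p)
  have "(\<lambda>c. c (nat (- i), j)) \<in> borel_measurable (st_lebesgue l)" if "- int l \<le> i \<and> i < 0"
  proof -
    have "(nat (- i), j) \<in> st_index l" using that by (auto simp: st_index_def nat_le_iff)
    then show ?thesis using measurable_component_singleton[of "(nat (- i), j)" "st_index l" "\<lambda>_. lborel"] by simp
  qed
  then show "(\<lambda>c. coords (st_coords l c) p) \<in> borel_measurable (st_lebesgue l)"
    unfolding p coords_st_coords
    by (cases "- int l \<le> i \<and> i < 0") (simp_all only: if_True if_False simp_thms measurable_const, simp)
qed simp

lemma emeasure_lborel_shift:
  assumes "A \<in> sets borel" shows "emeasure lborel ((\<lambda>x. x + a) -` A) = emeasure lborel (A :: real set)"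
proof -
  have "emeasure lborel A = emeasure (distr lborel borel ((+) a)) A" by (simp add: lborel_distr_plus)
  also have "\<dots> = emeasure lborel ((+) a -` A)" using assms by (simp add: emeasure_distr)
  also have "(+) a = (\<lambda>x. x + a)" by (simp add: fun_eq_iff add.commute)
  finally show ?thesis ..
qed

text \<open>Checked on boxes, which determine a product measure.\<close>

lemma product_lborel_translate:
  fixes a :: "'i \<Rightarrow> real"
  assumes "finite I"
  shows "distr (\<Pi>\<^sub>M p\<in>I. lborel) (\<Pi>\<^sub>M p\<in>I. lborel) (\<lambda>c. \<lambda>p\<in>I. c p + a p) = (\<Pi>\<^sub>M p\<in>I. (lborel :: real measure))"
proof -
  interpret product_sigma_finite "\<lambda>_::'i. lborel :: real measure" ..
  have meas: "(\<lambda>c. \<lambda>p\<in>I. c p + a p) \<in> (\<Pi>\<^sub>M p\<in>I. lborel) \<rightarrow>\<^sub>M (\<Pi>\<^sub>M p\<in>I. (lborel :: real measure))"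
    by measurable
  show ?thesis
  proof (rule PiM_eqI[OF assms])
    fix A :: "'i \<Rightarrow> real set" assume A: "\<And>i. i \<in> I \<Longrightarrow> A i \<in> sets lborel"
    have "(\<lambda>c. \<lambda>p\<in>I. c p + a p) -` Pi\<^sub>E I A \<inter> space (\<Pi>\<^sub>M p\<in>I. (lborel :: real measure)) = (\<Pi>\<^sub>E p\<in>I. (\<lambda>x. x + a p) -` A p)"
      by (auto simp: space_PiM PiE_def Pi_def)
    moreover have "(\<lambda>x. x + a p) -` A p \<in> sets lborel" if "p \<in> I" for p
    proof -
      have "(\<lambda>x. x + a p) -` A p \<inter> space borel \<in> sets borel"
        by (rule measurable_sets[of _ borel borel]) (use A[OF that] in auto)
      then show ?thesis by simp
    qed
    ultimately show "emeasure (distr (\<Pi>\<^sub>M p\<in>I. lborel) (\<Pi>\<^sub>M p\<in>I. lborel) (\<lambda>c. \<lambda>p\<in>I. c p + a p)) (Pi\<^sub>E I A) =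
       (\<Prod>i\<in>I. emeasure lborel (A i))"
      using A assms meas by (simp add: emeasure_distr emeasure_PiM emeasure_lborel_shift)
  qed simp
qed

lemma t_pow_mult_nat: "t_pow (int l) ** t_pow (int m) = (t_pow (int (l + m)) :: ('n::finite) Fmat)"
  by (simp only: t_pow_mult of_nat_add)

text \<open>The cube of volume 1 for the standard measure; it fixes the scalar when standard measures are
compared.\<close>

definition unit_cube :: "nat \<Rightarrow> ('n::finite) Fvec set" where
  "unit_cube l = {x \<in> polar_vecs l. \<forall>p\<in>polar_index l. 0 \<le> coords x p \<and> coords x p \<le> 1}"

lemma unit_cube_sets: "unit_cube l \<in> sets (fd_borel (polar_vecs l))"
proof -
  have "{x \<in> space (fd_borel (polar_vecs l)). \<forall>p\<in>polar_index l. 0 \<le> coords x p \<and> coords x p \<le> 1} \<in> sets (fd_borel (polar_vecs l))"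
    by measurable
  then show ?thesis by (simp add: unit_cube_def)
qed

lemma emeasure_mu_st_unit_cube: "emeasure (mu_st l) (unit_cube l :: ('n::finite) Fvec set) = 1"
proof -
  interpret product_sigma_finite "\<lambda>_::nat \<times> 'n. lborel :: real measure" ..
  have "st_coords l -` (unit_cube l :: 'n Fvec set) \<inter> space (st_lebesgue l) = (\<Pi>\<^sub>E p\<in>st_index l. {0..1})"
  proof -
    have "(\<forall>p\<in>polar_index l. 0 \<le> coords (st_coords l c) p \<and> coords (st_coords l c) p \<le> 1) \<longleftrightarrow>
      (\<forall>p\<in>st_index l. c p \<in> {0..1})" for c :: "nat \<times> 'n \<Rightarrow> real"
    proof safe
      fix i :: nat and j :: 'n assume "(i, j) \<in> st_index l"
        and *: "\<forall>p\<in>polar_index l. 0 \<le> coords (st_coords l c) p \<and> coords (st_coords l c) p \<le> 1"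
      then have "1 \<le> i" "i \<le> l" by (auto simp: st_index_def)
      then show "c (i, j) \<in> {0..1}"
        using bspec[OF *, of "(j, - int i)"] by (simp add: coords_st_coords)
    next
      fix i :: int and j :: 'n assume "i \<in> {- int l..-1}" and *: "\<forall>p\<in>st_index l. c p \<in> {0..1}"
      then show "0 \<le> coords (st_coords l c) (j, i)" "coords (st_coords l c) (j, i) \<le> 1"
        using bspec[OF *, of "(nat (- i), j)"] by (auto simp: coords_st_coords st_index_def nat_le_iff)
    qed
    note eq = this
    have eq2: "(c \<in> st_coords l -` (unit_cube l :: 'n Fvec set) \<inter> space (st_lebesgue l) \<longleftrightarrow> c \<in> (\<Pi>\<^sub>E p\<in>st_index l. {0..1}))"
      for c :: "nat \<times> 'n \<Rightarrow> real"
      unfolding unit_cube_def vimage_eq Int_iff mem_Collect_eq eq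
      by (simp add: space_PiM PiE_iff conj_commute)
    show ?thesis by (simp only: set_eq_iff eq2 simp_thms)
  qed
  then show ?thesis
    by (simp add: mu_st_eq emeasure_distr unit_cube_sets emeasure_PiM)
qed

lemma Mhat_mu_st: "(t_pow (int l) :: ('n::finite) Fmat, mu_st l) \<in> Mhat"
proof -
  have tl: "(t_pow (int l) :: 'n Fmat) \<in> matrices_R" by (rule t_pow_matrices_R)
  obtain N where "haar_space (V_space (t_pow (int l) :: 'n Fmat)) N" using haar_space_V_space[OF tl] .
  then interpret haar_space "polar_vecs l :: 'n Fvec set" N by (simp only: polar_vecs_eq_V_space)
  interpret product_sigma_finite "\<lambda>_::nat \<times> 'n. lborel :: real measure" ..
  have "haar_measure (polar_vecs l) (mu_st l :: 'n Fvec measure)"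
  proof (rule haar_measureI)
    fix A :: "'n Fvec set" and v :: "'n Fvec" assume A: "A \<in> sets (fd_borel (polar_vecs l))" and v: "v \<in> polar_vecs l"
    define a where "a = (\<lambda>(i, j). coords v (j, - int i))"
    have shift: "st_coords l c + v = st_coords l (\<lambda>p\<in>st_index l. c p + a p)" for c
    proof (rule coords_eqI)
      fix q :: "'n \<times> int"
      obtain j i where q: "q = (j, i)" by (cases q)
      show "coords (st_coords l c + v) q = coords (st_coords l (\<lambda>p\<in>st_index l. c p + a p)) q"
      proof (cases "- int l \<le> i \<and> i < 0")
        case True
        then show ?thesis by (auto simp: q coords_st_coords st_index_def a_def nat_le_iff)
      next
        case False
        then have "coords v q = 0"
          using v unfolding polar_vecs_coords by (auto simp: q)
        with False show ?thesis by (auto simp: q coords_st_coords)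
      qed
    qed
    have meas: "(\<lambda>c. \<lambda>p\<in>st_index l. c p + a p) \<in> st_lebesgue l \<rightarrow>\<^sub>M st_lebesgue l" by measurable
    have "emeasure (mu_st l) ((\<lambda>x. x + v) -` A \<inter> polar_vecs l) =
      emeasure (st_lebesgue l) ((\<lambda>c. \<lambda>p\<in>st_index l. c p + a p) -` (st_coords l -` A \<inter> space (st_lebesgue l)) \<inter> space (st_lebesgue l))"
      using measurable_sets[OF translate_measurable[OF v] A] measurable_space[OF meas]
      by (simp add: mu_st_eq emeasure_distr)
         (intro arg_cong[where f="emeasure (st_lebesgue l)"]; auto simp flip: shift intro: add v)
    also have "\<dots> = emeasure (distr (st_lebesgue l) (st_lebesgue l) (\<lambda>c. \<lambda>p\<in>st_index l. c p + a p))
        (st_coords l -` A \<inter> space (st_lebesgue l))"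
      by (rule emeasure_distr[symmetric, OF meas]) (rule measurable_sets[OF measurable_st_coords A])
    also have "\<dots> = emeasure (mu_st l) A"
      using A by (simp add: product_lborel_translate mu_st_eq emeasure_distr)
    finally show "emeasure (mu_st l) ((\<lambda>x. x + v) -` A \<inter> polar_vecs l) = emeasure (mu_st l) A" .
  next
    fix r :: real
    have sub: "st_coords l -` norm_ball (polar_vecs l :: 'n Fvec set) r \<inter> space (st_lebesgue l) \<subseteq> (\<Pi>\<^sub>E p\<in>st_index l. {-r..r})"
    proof
      fix c :: "nat \<times> 'n \<Rightarrow> real"
      assume c: "c \<in> st_coords l -` norm_ball (polar_vecs l) r \<inter> space (st_lebesgue l)"
      have "c (i, j) \<in> {-r..r}" if "(i, j) \<in> st_index l" for i j
      proof -
        have "1 \<le> i" "i \<le> l" using that by (auto simp: st_index_def)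
        moreover have "\<bar>coords (st_coords l c) (j, - int i)\<bar> \<le> r"
          using abs_coords_le[of "st_coords l c" "(j, - int i)"] c polar_vecs_subset_Rminus by fastforce
        ultimately show ?thesis by (auto simp: coords_st_coords)
      qed
      then show "c \<in> (\<Pi>\<^sub>E p\<in>st_index l. {-r..r})" using c by (auto simp: space_PiM PiE_def Pi_def)
    qed
    have "emeasure (mu_st l) (norm_ball (polar_vecs l :: 'n Fvec set) r) \<le> emeasure (st_lebesgue l) (\<Pi>\<^sub>E p\<in>st_index l :: (nat \<times> 'n) set. {-r..r})"
      unfolding mu_st_eq by (subst emeasure_distr[OF measurable_st_coords norm_ball_sets], rule emeasure_mono[OF sub])
        (auto intro!: sets_PiM_I_finite)
    also have "\<dots> < \<infinity>"
      by (subst emeasure_PiM) (auto simp: emeasure_lborel_Icc_eq ennreal_power less_top[symmetric] ennreal_prod_eq_top)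
    finally show "emeasure (mu_st l) (norm_ball (polar_vecs l :: 'n Fvec set) r) < \<infinity>" .
  next
    have "polar_vecs l \<in> sets (mu_st l :: 'n Fvec measure)"
      using sets.top[of "fd_borel (polar_vecs l :: 'n Fvec set)"] by (simp add: mu_st_eq)
    then have "emeasure (mu_st l) (unit_cube l :: 'n Fvec set) \<le> emeasure (mu_st l) (polar_vecs l :: 'n Fvec set)"
      by (intro emeasure_mono) (auto simp: unit_cube_def)
    then have "1 \<le> emeasure (mu_st l) (polar_vecs l :: 'n Fvec set)"
      by (simp only: emeasure_mu_st_unit_cube)
    then show "emeasure (mu_st l) (polar_vecs l :: 'n Fvec set) \<noteq> 0" by auto
  qed (simp_all add: mu_st_eq)
  then show ?thesis using tl by (simp only: Mhat_iff polar_vecs_eq_V_space simp_thms)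
qed

text \<open>The gluing map for \<open>t^m\<close> places the coefficients of the first vector below those of the second, so
it carries the product of the two cubes onto the cube.\<close>

lemma emeasure_conv_unit_cube:
  "emeasure (conv_measure (t_pow (int l)) (mu_st l) (t_pow (int m)) (mu_st m))
     (unit_cube (l + m) :: ('n::finite) Fvec set) = 1"
proof -
  let ?Q = "unit_cube (l + m) :: 'n Fvec set"
  have Q: "?Q \<in> sets (fd_borel (V_space (t_pow (int l) ** t_pow (int m))))"
    using unit_cube_sets[of "l + m"] unfolding t_pow_mult_nat polar_vecs_eq_V_space .
  have glue_coords: "coords (glue (t_pow (int m)) y z) (j, i) =
      (if i < 0 then (if i < - int m then coords y (j, i + int m) else coords z (j, i)) else 0)"
    if "y \<in> polar_vecs l" "z \<in> polar_vecs m" for y z :: "'n Fvec" and j i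
  proof -
    have "coords y (j, i + int m) = 0" if "i \<ge> - int m"
      using \<open>y \<in> polar_vecs l\<close> that unfolding polar_vecs_coords by auto
    moreover have "coords z (j, i) = 0" if "i < - int m"
      using \<open>z \<in> polar_vecs m\<close> that unfolding polar_vecs_coords by auto
    moreover have "coords (glue (t_pow (int m)) y z) (j, i) =
        (if i < 0 then coords y (j, i + int m) + coords z (j, i) else 0)"
      by (simp add: coords_def proj_minus_nth matrix_inv_t_pow mat_mult_vec fls_X_intpow_times_conv_shift(1)[where i="- int m", simplified])
    ultimately show ?thesis by auto
  qed
  have iff: "glue (t_pow (int m)) y z \<in> ?Q \<longleftrightarrow> y \<in> unit_cube l \<and> z \<in> unit_cube m"
    if y: "y \<in> polar_vecs l" and z: "z \<in> polar_vecs m" for y z :: "'n Fvec"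
  proof -
    have "glue (t_pow (int m)) y z \<in> polar_vecs (l + m)"
      using glue_in_V_space[OF t_pow_matrices_R t_pow_matrices_R, of y l z m] y z
      unfolding t_pow_mult_nat polar_vecs_eq_V_space by simp
    moreover have "(\<forall>p\<in>polar_index (l + m). 0 \<le> coords (glue (t_pow (int m)) y z) p \<and> coords (glue (t_pow (int m)) y z) p \<le> 1)
      \<longleftrightarrow> (\<forall>p\<in>polar_index l. 0 \<le> coords y p \<and> coords y p \<le> 1) \<and> (\<forall>p\<in>polar_index m. 0 \<le> coords z p \<and> coords z p \<le> 1)"
      (is "?L \<longleftrightarrow> ?Y \<and> ?Z")
    proof (intro iffI conjI ballI)
      fix p :: "'n \<times> int" assume L: ?L and "p \<in> polar_index l"
      then obtain j i where p: "p = (j, i)" "- int l \<le> i" "i \<le> -1" by auto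
      then show "0 \<le> coords y p" "coords y p \<le> 1"
        using bspec[OF L, of "(j, i - int m)"] by (auto simp: glue_coords[OF y z])
    next
      fix p :: "'n \<times> int" assume L: ?L and "p \<in> polar_index m"
      then obtain j i where p: "p = (j, i)" "- int m \<le> i" "i \<le> -1" by auto
      then show "0 \<le> coords z p" "coords z p \<le> 1"
        using bspec[OF L, of "(j, i)"] by (auto simp: glue_coords[OF y z])
    next
      fix p :: "'n \<times> int" assume YZ: "?Y \<and> ?Z" and "p \<in> polar_index (l + m)"
      then obtain j i where p: "p = (j, i)" "- int (l + m) \<le> i" "i \<le> -1" by auto
      then show "0 \<le> coords (glue (t_pow (int m)) y z) p" "coords (glue (t_pow (int m)) y z) p \<le> 1"
        using YZ p by (auto simp: glue_coords[OF y z])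
    qed
    ultimately show ?thesis using y z by (simp add: unit_cube_def)
  qed
  have sp: "space (mu_st k :: 'n Fvec measure) = polar_vecs k" for k by (simp add: mu_st_eq)
  have ss: "unit_cube k \<in> sets (mu_st k :: 'n Fvec measure)" for k by (simp add: mu_st_eq unit_cube_sets)
  have "emeasure (conv_measure (t_pow (int l)) (mu_st l) (t_pow (int m)) (mu_st m)) ?Q =
     (\<integral>\<^sup>+y. (\<integral>\<^sup>+z. indicator ?Q (glue (t_pow (int m)) y z) \<partial>mu_st m) \<partial>mu_st l)"
    by (rule emeasure_conv[OF Mhat_mu_st Mhat_mu_st Q])
  also have "\<dots> = (\<integral>\<^sup>+y. (\<integral>\<^sup>+z. indicator (unit_cube l) y * indicator (unit_cube m) z
      \<partial>(mu_st m :: 'n Fvec measure)) \<partial>(mu_st l :: 'n Fvec measure))"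
    by (intro nn_integral_cong) (simp add: sp iff indicator_def)
  also have "\<dots> = 1"
    using ss by (simp add: nn_integral_cmult emeasure_mu_st_unit_cube)
  finally show ?thesis .
qed

text \<open>The distinguished lift \<open>T_l\<close> of the scalar matrix \<open>t^l\<close>.\<close>

definition t_lift :: "nat \<Rightarrow> ('n::finite) Fmat \<times> 'n Fvec measure" where
  "t_lift l = (t_pow (int l), mu_st l)"

lemma t_lift_Mhat [simp]: "t_lift l \<in> Mhat"
  by (simp only: t_lift_def Mhat_mu_st)

text \<open>By uniqueness the two Haar measures are proportional, and they agree on the unit cube.\<close>

lemma t_lift_mult: "Mhat_mult (t_lift l) (t_lift m) = (t_lift (l + m) :: ('n::finite) Fmat \<times> _)"
proof -
  let ?c = "conv_measure (t_pow (int l) :: 'n Fmat) (mu_st l) (t_pow (int m)) (mu_st m)"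
  have "(t_pow (int (l + m)), ?c) \<in> Mhat"
    using Mhat_conv[OF Mhat_mu_st Mhat_mu_st, of l m] unfolding t_pow_mult_nat .
  then obtain c where c: "c > 0" "(t_pow (int (l + m)), ?c) = Mhat_scale c (t_pow (int (l + m)), mu_st (l + m))"
    using Mhat_unique[OF _ Mhat_mu_st] by blast
  then have eq: "?c = scale_measure (ennreal c) (mu_st (l + m))" by (simp add: Mhat_scale_def)
  have "1 = ennreal c"
    using arg_cong[OF eq, of "\<lambda>M. emeasure M (unit_cube (l + m))"]
    by (simp add: emeasure_conv_unit_cube emeasure_mu_st_unit_cube)
  then have "?c = mu_st (l + m)" using eq by simp
  then show ?thesis by (simp only: t_lift_def Mhat_mult_def prod.case t_pow_mult_nat)
qed

lemma V_space_1: "V_space (mat 1) = {0 :: ('n::finite) Fvec}"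
proof -
  have "polar_vecs 0 = {0 :: 'n Fvec}"
    by (auto simp: polar_vecs_def Rminus_vecs_def intro!: Fvec_eqI) (metis not_le)
  then show ?thesis by (simp add: polar_vecs_eq_V_space)
qed

lemma nn_integral_mu_st_0:
  fixes f :: "('n::finite) Fvec \<Rightarrow> ennreal"
  shows "(\<integral>\<^sup>+y. f y \<partial>mu_st 0) = f 0"
proof -
  have V: "polar_vecs 0 = {0 :: 'n Fvec}" using V_space_1 by (simp add: polar_vecs_eq_V_space)
  have sp: "space (mu_st 0 :: 'n Fvec measure) = {0}" by (simp add: mu_st_eq V)
  have "unit_cube 0 = {0 :: 'n Fvec}" by (auto simp: unit_cube_def V)
  then have "emeasure (mu_st 0) {0 :: 'n Fvec} = 1" using emeasure_mu_st_unit_cube[where 'n='n and l=0] by simp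
  moreover have "(\<integral>\<^sup>+y. f y \<partial>mu_st 0) = (\<integral>\<^sup>+y. f 0 \<partial>(mu_st 0 :: 'n Fvec measure))"
    by (rule nn_integral_cong) (simp add: sp)
  ultimately show ?thesis by (simp add: sp)
qed

lemma t_lift_0: "t_lift 0 = (mat 1, mu_st 0)"
  by (simp add: t_lift_def)

lemma matrix_inv_mat_1: "matrix_inv (mat 1) = (mat 1 :: ('n::finite) Fmat)"
  by (rule matrix_inv_unique_right) simp

lemma Mhat_mult_1_left:
  assumes "\<alpha> \<in> Mhat" shows "Mhat_mult (t_lift 0) \<alpha> = \<alpha>"
proof -
  obtain g \<mu> where [simp]: "\<alpha> = (g, \<mu>)" by (cases \<alpha>)
  have M: "(mat 1, mu_st 0) \<in> Mhat" "(g, \<mu>) \<in> Mhat" using assms t_lift_Mhat[of 0] by (simp_all add: t_lift_0)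
  have "conv_measure (mat 1) (mu_st 0) g \<mu> = \<mu>"
  proof (rule measure_eqI)
    show s: "sets (conv_measure (mat 1) (mu_st 0) g \<mu>) = sets \<mu>"
      by (simp add: sets_conv_measure[OF M] Mhat_sets[OF M(2)])
    fix A assume "A \<in> sets (conv_measure (mat 1) (mu_st 0) g \<mu>)"
    then have A: "A \<in> sets (fd_borel (V_space (mat 1 ** g)))" "A \<in> sets \<mu>"
      using s by (auto simp: sets_conv_measure[OF M])
    have "emeasure (conv_measure (mat 1) (mu_st 0) g \<mu>) A = (\<integral>\<^sup>+z. indicator A (glue g 0 z) \<partial>\<mu>)"
      unfolding emeasure_conv[OF M A(1)] nn_integral_mu_st_0 ..
    also have "\<dots> = (\<integral>\<^sup>+z. indicator A z \<partial>\<mu>)"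
      using M(2) by (intro nn_integral_cong) (simp add: Mhat_space[OF M(2)] Mhat_iff V_space_iff proj_minus_id)
    finally show "emeasure (conv_measure (mat 1) (mu_st 0) g \<mu>) A = emeasure \<mu> A" using A by simp
  qed
  then show ?thesis by (simp add: t_lift_0 Mhat_mult_def)
qed

lemma Mhat_mult_1_right:
  assumes "\<alpha> \<in> Mhat" shows "Mhat_mult \<alpha> (t_lift 0) = \<alpha>"
proof -
  obtain g \<mu> where [simp]: "\<alpha> = (g, \<mu>)" by (cases \<alpha>)
  have M: "(g, \<mu>) \<in> Mhat" "(mat 1, mu_st 0) \<in> Mhat" using assms t_lift_Mhat[of 0] by (simp_all add: t_lift_0)
  have "conv_measure g \<mu> (mat 1) (mu_st 0) = \<mu>"
  proof (rule measure_eqI)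
    show s: "sets (conv_measure g \<mu> (mat 1) (mu_st 0)) = sets \<mu>"
      by (simp add: sets_conv_measure[OF M] Mhat_sets[OF M(1)])
    fix A assume "A \<in> sets (conv_measure g \<mu> (mat 1) (mu_st 0))"
    then have A: "A \<in> sets (fd_borel (V_space (g ** mat 1)))" "A \<in> sets \<mu>"
      using s by (auto simp: sets_conv_measure[OF M])
    have "emeasure (conv_measure g \<mu> (mat 1) (mu_st 0)) A = (\<integral>\<^sup>+y. indicator A (glue (mat 1) y 0) \<partial>\<mu>)"
      unfolding emeasure_conv[OF M A(1)] nn_integral_mu_st_0 ..
    also have "\<dots> = (\<integral>\<^sup>+z. indicator A z \<partial>\<mu>)"
      using M(1) by (intro nn_integral_cong)
        (simp add: Mhat_space[OF M(1)] Mhat_iff V_space_iff proj_minus_id matrix_inv_mat_1)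
    finally show "emeasure (conv_measure g \<mu> (mat 1) (mu_st 0)) A = emeasure \<mu> A" using A by simp
  qed
  then show ?thesis by (simp add: t_lift_0 Mhat_mult_def)
qed

text \<open>The complementary factor is \<open>t^m g\<^sup>-\<^sup>1\<close> for large m.\<close>

lemma matrices_R_complement:
  fixes g :: "('n::finite) Fmat"
  assumes "g \<in> matrices_R"
  obtains m h where "h \<in> matrices_R" "h ** g = t_pow (int m)"
proof -
  have d: "det g \<noteq> 0" using assms by (simp add: matrices_R_iff)
  obtain m where m: "integral_matrix (t_pow (int m) ** matrix_inv g)"
    using clear_denominators[of "matrix_inv g"] by blast
  let ?h = "t_pow (int m) ** matrix_inv g"
  have e: "?h ** g = t_pow (int m)" by (simp add: matrix_inv_cancel d flip: matrix_mul_assoc)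
  then have "det ?h \<noteq> 0" using det_t_pow_nz[where 'n='n] by (metis det_mul mult_zero_left)
  then show ?thesis using m e by (intro that[of ?h m]) (auto simp: matrices_R_iff)
qed

text \<open>If \<open>h g = t^m\<close>, then \<open>V_(t^m)\<close> is the glued product of \<open>V_h\<close> and \<open>V_g\<close>. Restricting the standard
measure to a strip that is bounded in the direction of \<open>V_h\<close> and projecting to \<open>V_g\<close> gives a Haar
measure: translations by \<open>V_g\<close> preserve the strip.\<close>

lemma haar_measure_exists:
  fixes g :: "('n::finite) Fmat"
  assumes g: "g \<in> matrices_R" obtains \<mu> where "(g, \<mu>) \<in> Mhat"
proof -
  obtain m h where h: "h \<in> matrices_R" "h ** g = t_pow (int m)" using matrices_R_complement[OF g] .
  obtain Nm where "haar (V_space (t_pow (int m) :: 'n Fmat)) Nm (mu_st m)" using Mhat_haar[OF Mhat_mu_st] .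
  then interpret m: haar "V_space (h ** g)" Nm "mu_st m" unfolding h(2) .
  obtain N where "haar_space (V_space g) N" using haar_space_V_space[OF g] .
  then interpret V: haar_space "V_space g" N .
  \<comment> \<open>The two components of w with respect to the gluing map.\<close>
  define p where "p w = proj_minus (g *v w)" for w
  define q where "q w = w - proj_minus (matrix_inv g *v p w)" for w
  have split: "p w \<in> V_space h \<and> q w \<in> V_space g \<and> w = glue g (p w) (q w)" if w: "w \<in> V_space (h ** g)" for w
  proof -
    obtain y z where yz: "y \<in> V_space h" "z \<in> V_space g" "w = glue g y z" using glue_surj[OF h(1) g w] .
    then have "p w = y" "z \<in> Rminus_vecs"
      using glue_fst[OF g, of y z] h(1) g by (auto simp: p_def V_space_iff)
    moreover from this have "q w = z" by (simp add: q_def yz(3) glue_eq)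
    ultimately show ?thesis using yz by simp
  qed
  have p_shift: "p (w + z) = p w" and q_shift: "q (w + z) = q w + z" if "z \<in> V_space g" for w z
  proof -
    show "p (w + z) = p w" using that by (simp add: p_def matrix_vector_right_distrib proj_minus_add V_space_iff_proj g)
    then show "q (w + z) = q w + z" by (simp add: q_def)
  qed
  obtain C where C: "C > 0" "\<And>w. w \<in> polar_vecs Nm \<Longrightarrow> coeff_norm (p w) \<le> C * coeff_norm w"
    unfolding p_def by (rule real_linear_bounded[OF real_linear_proj_matrix[of g]]) auto
  obtain Nh where Nh: "V_space h \<subseteq> polar_vecs Nh" using V_space_subset_polar[OF h(1)] .
  obtain D where D: "D > 0" "\<And>y. y \<in> polar_vecs Nh \<Longrightarrow> coeff_norm (proj_minus (matrix_inv g *v y)) \<le> D * coeff_norm y"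
    by (rule real_linear_bounded[OF real_linear_proj_matrix[of "matrix_inv g"]]) auto
  have V_sub: "V_space g \<subseteq> V_space (h ** g)"
    using matrices_R_vector[OF h(1)] by (auto simp: V_space_iff g matrices_R_mult h(1) matrix_vector_mul_assoc[symmetric])
  have p_meas: "p \<in> fd_borel (V_space (h ** g)) \<rightarrow>\<^sub>M fd_borel (V_space h)"
    unfolding p_def by (rule measurable_real_linear[OF real_linear_proj_matrix m.sub]) (use split in \<open>auto simp: p_def\<close>)
  have "(\<lambda>w. proj_minus (matrix_inv g *v p w)) \<in> fd_borel (V_space (h ** g)) \<rightarrow>\<^sub>M fd_borel UNIV"
    by (rule measurable_compose[OF p_meas measurable_real_linear[OF real_linear_proj_matrix Nh]]) auto
  then have q_meas: "q \<in> fd_borel (V_space (h ** g)) \<rightarrow>\<^sub>M fd_borel (V_space g)"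
    unfolding q_def by (rule measurable_fd_diff[OF measurable_ident_sets[OF HOL.refl]])
      (use split in \<open>auto simp: q_def\<close>)
  \<comment> \<open>The strip has width C so that it contains the unit ball, which has positive measure.\<close>
  define S where "S = {w \<in> V_space (h ** g). coeff_norm (p w) \<le> C}"
  have S: "S \<in> sets (fd_borel (V_space (h ** g)))"
  proof -
    have "(\<lambda>w. coeff_norm (p w)) \<in> borel_measurable (fd_borel (V_space (h ** g)))"
      by (rule measurable_compose[OF p_meas measurable_coeff_norm[OF Nh]])
    then have "{w \<in> space (fd_borel (V_space (h ** g))). coeff_norm (p w) \<le> C} \<in> sets (fd_borel (V_space (h ** g)))"
      by measurable
    then show ?thesis by (simp add: S_def)
  qed
  define \<mu> where "\<mu> = distr (density (mu_st m) (indicator S)) (fd_borel (V_space g)) q"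
  have em: "emeasure \<mu> A = (\<integral>\<^sup>+w. indicator S w * indicator A (q w) \<partial>mu_st m)" if A: "A \<in> sets (fd_borel (V_space g))" for A
  proof -
    have qA: "q -` A \<inter> V_space (h ** g) \<in> sets (fd_borel (V_space (h ** g)))"
      using measurable_sets[OF q_meas A] by simp
    have "emeasure \<mu> A = emeasure (density (mu_st m) (indicator S)) (q -` A \<inter> V_space (h ** g))"
      unfolding \<mu>_def using q_meas A by (subst emeasure_distr) (auto cong: measurable_cong_sets)
    also have "\<dots> = (\<integral>\<^sup>+w. indicator S w * indicator (q -` A \<inter> V_space (h ** g)) w \<partial>mu_st m)"
      using S qA by (intro emeasure_density) auto
    also have "\<dots> = (\<integral>\<^sup>+w. indicator S w * indicator A (q w) \<partial>mu_st m)"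
      by (intro nn_integral_cong) (auto simp: indicator_def)
    finally show ?thesis .
  qed
  have "haar_measure (V_space g) \<mu>"
  proof (rule V.haar_measureI)
    fix A v assume A: "A \<in> sets (fd_borel (V_space g))" and v: "v \<in> V_space g"
    have A': "(\<lambda>x. x + v) -` A \<inter> V_space g \<in> sets (fd_borel (V_space g))"
      using measurable_sets[OF V.translate_measurable[OF v] A] by simp
    have vV: "v \<in> V_space (h ** g)" using v V_sub by blast
    have meas: "(\<lambda>w. indicator S w * indicator A (q w) :: ennreal) \<in> borel_measurable (fd_borel (V_space (h ** g)))"
      using S measurable_compose[OF q_meas borel_measurable_indicator[OF A]]
      by (intro borel_measurable_times_ennreal) auto
    have "emeasure \<mu> ((\<lambda>x. x + v) -` A \<inter> V_space g) = (\<integral>\<^sup>+w. indicator S (w + v) * indicator A (q (w + v)) \<partial>mu_st m)"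
      unfolding em[OF A']
    proof (rule nn_integral_cong)
      fix w assume "w \<in> space (mu_st m :: 'n Fvec measure)"
      then have w: "w \<in> V_space (h ** g)" by simp
      then show "indicator S w * indicator ((\<lambda>x. x + v) -` A \<inter> V_space g) (q w) =
        (indicator S (w + v) * indicator A (q (w + v)) :: ennreal)"
        using split[OF w] m.add[OF w vV] by (auto simp: S_def indicator_def p_shift[OF v] q_shift[OF v])
    qed
    also have "\<dots> = emeasure \<mu> A"
      unfolding em[OF A] by (rule m.nn_integral_translate[OF meas vV])
    finally show "emeasure \<mu> ((\<lambda>x. x + v) -` A \<inter> V_space g) = emeasure \<mu> A" .
  next
    fix r :: real
    have "emeasure \<mu> (norm_ball (V_space g) r) \<le> (\<integral>\<^sup>+w. indicator (norm_ball (V_space (h ** g)) (D * C + r)) w \<partial>mu_st m)"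
      unfolding em[OF V.norm_ball_sets]
    proof (rule nn_integral_mono)
      fix w assume "w \<in> space (mu_st m :: 'n Fvec measure)"
      then have w: "w \<in> V_space (h ** g)" by simp
      have "coeff_norm w \<le> D * C + r" if "coeff_norm (p w) \<le> C" "coeff_norm (q w) \<le> r"
      proof -
        have R: "q w \<in> Rminus_vecs" using split[OF w] V.Rminus by blast
        have "coeff_norm w = coeff_norm (proj_minus (matrix_inv g *v p w) + q w)"
          using split[OF w] R by (simp add: glue_eq)
        also have "\<dots> \<le> coeff_norm (proj_minus (matrix_inv g *v p w)) + coeff_norm (q w)"
          by (rule coeff_norm_triangle) (use R in auto)
        also have "\<dots> \<le> D * coeff_norm (p w) + r" using D(2)[of "p w"] split[OF w] Nh that by auto
        also have "\<dots> \<le> D * C + r" using that D(1) by simp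
        finally show ?thesis .
      qed
      then show "indicator S w * indicator (norm_ball (V_space g) r) (q w) \<le>
         (indicator (norm_ball (V_space (h ** g)) (D * C + r)) w :: ennreal)"
        using w by (auto simp: indicator_def S_def)
    qed
    also have "\<dots> = emeasure (mu_st m) (norm_ball (V_space (h ** g)) (D * C + r))" by simp
    also have "\<dots> < \<infinity>" by (rule m.emeasure_ball_finite)
    finally show "emeasure \<mu> (norm_ball (V_space g) r) < \<infinity>" .
  next
    have V: "V_space g \<in> sets (fd_borel (V_space g))" using sets.top[of "fd_borel (V_space g)"] by simp
    have "norm_ball (V_space (h ** g)) 1 \<subseteq> S"
    proof
      fix w assume w: "w \<in> norm_ball (V_space (h ** g)) 1"
      have "C * coeff_norm w \<le> C * 1" using w C(1) by (intro mult_left_mono) auto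
      then show "w \<in> S" using w C(2)[of w] m.sub by (auto simp: S_def)
    qed
    then have "emeasure (mu_st m) (norm_ball (V_space (h ** g)) 1) \<le> emeasure (mu_st m) S"
      using S by (intro emeasure_mono) auto
    moreover have "emeasure \<mu> (V_space g) = emeasure (mu_st m) S"
    proof -
      have "emeasure \<mu> (V_space g) = (\<integral>\<^sup>+w. indicator S w \<partial>mu_st m)"
        unfolding em[OF V] by (rule nn_integral_cong) (use split in \<open>auto simp: indicator_def\<close>)
      then show ?thesis using S by simp
    qed
    ultimately show "emeasure \<mu> (V_space g) \<noteq> 0"
      using m.emeasure_unit_ball_pos by auto
  qed (simp_all add: \<mu>_def)
  then show ?thesis using g by (intro that[of \<mu>]) (simp add: Mhat_iff)
qed

section \<open>Homomorphisms from matrices factor through the determinant\<close>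

definition diag_matrix :: "('n \<Rightarrow> 'a::zero) \<Rightarrow> 'a^'n^'n" where
  "diag_matrix a = (\<chi> i j. if i = j then a i else 0)"

text \<open>The identity matrix with column k modified off the diagonal. Left multiplication adds multiples of
row k to all other rows at once; these matrices form an additive group in e.\<close>

definition column_shear :: "'n \<Rightarrow> ('n \<Rightarrow> 'a::field) \<Rightarrow> 'a^'n^'n" where
  "column_shear k e = (\<chi> r s. if r = s then 1 else if s = k then e r else 0)"

lemma diag_matrix_mult_nth:
  fixes A :: "'a::field^'n^'n"
  shows "(diag_matrix a ** A) $ r $ s = a r * A $ r $ s" "(A ** diag_matrix a) $ r $ s = A $ r $ s * a s"
  by (simp_all add: matrix_matrix_mult_def diag_matrix_def if_distrib[of "\<lambda>u. u * _"] if_distrib[of "\<lambda>u. _ * u"] cong: if_cong)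

lemma diag_matrix_mult: "diag_matrix a ** diag_matrix b = (diag_matrix (\<lambda>i. a i * b i) :: 'a::field^'n^'n)"
  by (simp add: vec_eq_iff diag_matrix_mult_nth) (simp add: diag_matrix_def)

lemma det_diag_matrix: "det (diag_matrix a :: 'a::field^'n^'n) = (\<Prod>i\<in>UNIV. a i)"
  by (subst det_diagonal) (auto simp: diag_matrix_def)

lemma column_shear_mult_nth:
  fixes A :: "'a::field^'n^'n"
  shows "(column_shear k e ** A) $ r $ s = A $ r $ s + (if r = k then 0 else e r * A $ k $ s)"
proof -
  have "column_shear k e $ r $ q * A $ q $ s =
    (if q = r then A $ r $ s else 0) + (if q = k then (if r = k then 0 else e r * A $ k $ s) else 0)" for q
    by (auto simp: column_shear_def)
  then show ?thesis by (simp add: matrix_matrix_mult_def sum.distrib)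
qed

lemma column_shear_add:
  "column_shear k e ** column_shear k e' = column_shear k (\<lambda>r. e r + e' r)"
  by (simp add: vec_eq_iff column_shear_mult_nth) (simp add: column_shear_def)

lemma column_shear_conj:
  fixes c :: "'a::field"
  shows "diag_matrix (\<lambda>r. if r = k then 1 else c) ** column_shear k e =
    column_shear k (\<lambda>r. c * e r) ** (diag_matrix (\<lambda>r. if r = k then 1 else c) :: 'a^'n^'n)"
  by (simp add: vec_eq_iff diag_matrix_mult_nth) (simp add: column_shear_def)

lemma det_nz_vec_zero:
  fixes A :: "'a::field^'n^'n"
  assumes "det A \<noteq> 0" "A *v v = 0" shows "v = 0"
  by (metis assms matrix_inv_cancel(4) matrix_vector_mult_0_right)

lemma det_column_shear_nz: "det (column_shear k e :: 'a::field^'n^'n) \<noteq> 0"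
proof -
  have "column_shear k e ** column_shear k (\<lambda>r. - e r) = (mat 1 :: 'a^'n^'n)"
    by (simp add: column_shear_add) (simp add: column_shear_def mat_def vec_eq_iff)
  then show ?thesis by (metis det_I det_mul mult_zero_left zero_neq_one)
qed

text \<open>Conjugation by the diagonal matrix with entry 1 at k and 2 elsewhere doubles e, that is, squares the
shear. A homomorphism to a commutative group does not see conjugation, so its value at the shear
equals its own square.\<close>

lemma multiplicative_column_shear:
  fixes \<psi> :: "('a::field_char_0)^'n^'n \<Rightarrow> 'b::field"
  assumes mult: "\<And>A B. det A \<noteq> 0 \<Longrightarrow> det B \<noteq> 0 \<Longrightarrow> \<psi> (A ** B) = \<psi> A * \<psi> B"
    and nz: "\<And>A. det A \<noteq> 0 \<Longrightarrow> \<psi> A \<noteq> 0"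
  shows "\<psi> (column_shear k e) = 1"
proof -
  let ?D = "diag_matrix (\<lambda>r. if r = k then 1 else 2) :: 'a^'n^'n"
  have D: "det ?D \<noteq> 0" by (simp add: det_diag_matrix)
  have "\<psi> ?D * \<psi> (column_shear k e) = \<psi> (column_shear k (\<lambda>r. 2 * e r)) * \<psi> ?D"
    using arg_cong[OF column_shear_conj[of k 2 e], of \<psi>] by (simp add: mult D det_column_shear_nz)
  then have "\<psi> (column_shear k e) = \<psi> (column_shear k (\<lambda>r. 2 * e r))"
    using nz[OF D] by simp
  also have "\<dots> = \<psi> (column_shear k e) * \<psi> (column_shear k e)"
    by (simp add: column_shear_add flip: mult[OF det_column_shear_nz det_column_shear_nz] mult_2)
  finally show ?thesis using nz[OF det_column_shear_nz] by (metis mult_cancel_left1)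
qed

lemma det_column_shear: "det (column_shear k e :: ('a::field_char_0)^'n^'n) = 1"
  by (rule multiplicative_column_shear) (auto simp: det_mul)

text \<open>Otherwise column k would be a combination of the columns outside \<open>insert k U\<close>, which are multiples of
unit vectors; the vector v below exhibits the dependence.\<close>

lemma exists_pivot:
  fixes A :: "'a::field^'n^'n"
  assumes d: "det A \<noteq> 0" and k: "k \<notin> U" and c: "\<And>s r. s \<notin> insert k U \<Longrightarrow> r \<noteq> s \<Longrightarrow> A $ r $ s = 0"
  shows "\<exists>r\<in>insert k U. A $ r $ k \<noteq> 0"
proof (rule ccontr)
  assume "\<not> ?thesis"
  then have z: "A $ r $ k = 0" if "r \<in> insert k U" for r using that by blast
  have diag: "A $ s $ s \<noteq> 0" if "s \<notin> insert k U" for s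
  proof
    assume "A $ s $ s = 0"
    then have "A $ r $ s = 0" for r using c[OF that, of r] by (cases "r = s") auto
    then have "A *v axis s 1 = 0"
      by (simp add: vec_eq_iff matrix_vector_mult_def axis_def if_distrib cong: if_cong)
    then have "axis s (1 :: 'a) = 0" by (rule det_nz_vec_zero[OF d])
    then have "axis s (1 :: 'a) $ s = 0" by simp
    then show False by (simp add: axis_def)
  qed
  define v where "v = (\<chi> s. if s = k then 1 else if s \<in> U then 0 else - A $ s $ k / A $ s $ s)"
  have "(A *v v) $ r = 0" for r
  proof -
    have "A $ r $ s * v $ s = (if s = k then A $ r $ k else 0) + (if s = r then (if r \<in> insert k U then 0 else - A $ r $ k) else 0)" for s
      using diag[of s] c[of s r] k by (auto simp: v_def)
    then have "(A *v v) $ r = A $ r $ k + (if r \<in> insert k U then 0 else - A $ r $ k)"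
      by (simp add: matrix_vector_mult_def sum.distrib)
    then show ?thesis using z[of r] by auto
  qed
  then have "A *v v = 0" by (simp add: vec_eq_iff)
  moreover have "v $ k = 1" by (simp add: v_def)
  ultimately show False using det_nz_vec_zero[OF d] by (metis zero_index zero_neq_one)
qed

text \<open>Gauss-Jordan elimination by shears, which change neither the determinant nor the value of the
homomorphism. The set U contains the columns that are still to be cleared.\<close>

lemma multiplicative_diagonalize:
  fixes \<psi> :: "('a::field_char_0)^'n^'n \<Rightarrow> 'b::field"
  assumes mult: "\<And>A B. det A \<noteq> 0 \<Longrightarrow> det B \<noteq> 0 \<Longrightarrow> \<psi> (A ** B) = \<psi> A * \<psi> B"
    and nz: "\<And>A. det A \<noteq> 0 \<Longrightarrow> \<psi> A \<noteq> 0" and A: "det A \<noteq> 0"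
  shows "\<exists>a. det A = (\<Prod>i\<in>UNIV. a i) \<and> \<psi> A = \<psi> (diag_matrix a)"
proof -
  have shear: "det (column_shear k e ** B) = det B \<and> \<psi> (column_shear k e ** B) = \<psi> B" if "det B \<noteq> 0"
    for k :: 'n and e and B :: "'a^'n^'n"
    using that multiplicative_column_shear[of \<psi>, OF mult nz]
    by (simp add: det_mul det_column_shear mult)
  have "\<exists>a. det A = (\<Prod>i\<in>UNIV. a i) \<and> \<psi> A = \<psi> (diag_matrix a)"
    if "finite U" "det A \<noteq> 0" "\<And>s r. s \<notin> U \<Longrightarrow> r \<noteq> s \<Longrightarrow> A $ r $ s = 0" for U :: "'n set" and A :: "'a^'n^'n"
    using that
  proof (induction U arbitrary: A rule: finite_induct)
    case empty
    then have "A = diag_matrix (\<lambda>i. A $ i $ i)" by (simp add: vec_eq_iff diag_matrix_def)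
    then show ?case by (metis det_diag_matrix)
  next
    case (insert k U)
    have step: ?case if B: "det B = det A" "\<psi> B = \<psi> A" and Bk: "B $ k $ k \<noteq> 0"
      and Bc: "\<And>s r. s \<notin> insert k U \<Longrightarrow> r \<noteq> s \<Longrightarrow> B $ r $ s = 0" for B :: "'a^'n^'n"
    proof -
      define C where "C = column_shear k (\<lambda>r. - B $ r $ k / B $ k $ k) ** B"
      have C: "det C = det A" "\<psi> C = \<psi> A" using shear[of B] B insert.prems unfolding C_def by auto
      have "C $ r $ s = 0" if "s \<notin> U" "r \<noteq> s" for r s
      proof (cases "s = k")
        case True
        then show ?thesis using that Bk by (simp add: C_def column_shear_mult_nth)
      next
        case False
        then show ?thesis using that Bc[of s r] Bc[of s k] by (simp add: C_def column_shear_mult_nth)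
      qed
      then show ?thesis using insert.IH[of C] C insert.prems by auto
    qed
    obtain r where r: "r \<in> insert k U" "A $ r $ k \<noteq> 0"
      using exists_pivot[OF insert.prems(1) insert.hyps(2) insert.prems(2)] by blast
    show ?case
    proof (cases "A $ k $ k = 0")
      case False
      then show ?thesis using step[of A] insert.prems by auto
    next
      case True
      then have rk: "r \<noteq> k" "r \<in> U" using r by auto
      \<comment> \<open>Adding row r to the other row k makes the pivot nonzero.\<close>
      define B where "B = column_shear r (\<lambda>q. if q = k then 1 else 0) ** A"
      have "det B = det A" "\<psi> B = \<psi> A" using shear[OF insert.prems(1)] by (auto simp: B_def)
      moreover have "B $ k $ k \<noteq> 0" using True r rk by (simp add: B_def column_shear_mult_nth)
      moreover have "B $ q $ s = 0" if s: "s \<notin> insert k U" "q \<noteq> s" for q s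
      proof -
        have "r \<noteq> s" using s rk by auto
        then show ?thesis using s insert.prems(2)[OF s] insert.prems(2)[OF s(1), of r]
          by (simp add: B_def column_shear_mult_nth)
      qed
      ultimately show ?thesis by (rule step)
    qed
  qed
  from this[of UNIV A] A show ?thesis by simp
qed

definition diag_entry :: "'n \<Rightarrow> 'a::field \<Rightarrow> 'a^'n^'n" where
  "diag_entry k x = diag_matrix (\<lambda>i. if i = k then x else 1)"

lemma det_diag_entry: "det (diag_entry k x :: 'a::field^'n^'n) = x"
  by (simp add: diag_entry_def det_diag_matrix)

lemma diag_entry_mult: "diag_entry k x ** diag_entry k y = diag_entry k (x * y)"
  by (auto simp: diag_entry_def diag_matrix_mult intro!: arg_cong[where f=diag_matrix])

text \<open>The two matrices are conjugate under a permutation matrix.\<close>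

lemma multiplicative_diag_entry_swap:
  fixes \<psi> :: "('a::field)^'n^'n \<Rightarrow> 'b::field"
  assumes mult: "\<And>A B. det A \<noteq> 0 \<Longrightarrow> det B \<noteq> 0 \<Longrightarrow> \<psi> (A ** B) = \<psi> A * \<psi> B"
    and nz: "\<And>A. det A \<noteq> 0 \<Longrightarrow> \<psi> A \<noteq> 0" and x: "x \<noteq> 0"
  shows "\<psi> (diag_entry i x) = \<psi> (diag_entry j x)"
proof -
  define P where "P = ((\<chi> r s. if s = Transposition.transpose i j r then 1 else 0) :: 'a^'n^'n)"
  have PP: "P ** P = mat 1"
    by (simp add: vec_eq_iff P_def matrix_matrix_mult_def mat_def if_distrib[of "\<lambda>u. u * _"] cong: if_cong)
  have dP: "det P \<noteq> 0" by (metis PP det_I det_mul mult_zero_left zero_neq_one)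
  have "P ** diag_entry i x = diag_entry j x ** P"
    by (simp add: vec_eq_iff diag_entry_def diag_matrix_mult_nth)
       (auto simp: P_def Transposition.transpose_def split: if_splits)
  then have "\<psi> P * \<psi> (diag_entry i x) = \<psi> (diag_entry j x) * \<psi> P"
    using x by (metis mult dP det_diag_entry)
  then show ?thesis using nz[OF dP] by simp
qed

lemma multiplicative_diag_matrix:
  fixes \<psi> :: "('a::field)^'n^'n \<Rightarrow> 'b::field"
  assumes mult: "\<And>A B. det A \<noteq> 0 \<Longrightarrow> det B \<noteq> 0 \<Longrightarrow> \<psi> (A ** B) = \<psi> A * \<psi> B"
    and nz: "\<And>A. det A \<noteq> 0 \<Longrightarrow> \<psi> A \<noteq> 0" and a: "\<And>i. a i \<noteq> 0"
  shows "\<psi> (diag_matrix a) = \<psi> (diag_entry k (\<Prod>i\<in>UNIV. a i))"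
proof -
  have "\<psi> (diag_matrix (\<lambda>i. if i \<in> S then a i else 1)) = \<psi> (diag_entry k (\<Prod>i\<in>S. a i))" if "finite S" for S
    using that
  proof (induction S rule: finite_induct)
    case (insert j S)
    have "diag_matrix (\<lambda>i. if i \<in> insert j S then a i else 1) =
        diag_entry j (a j) ** diag_matrix (\<lambda>i. if i \<in> S then a i else 1)"
      unfolding diag_entry_def diag_matrix_mult
      by (rule arg_cong[where f=diag_matrix]) (use insert.hyps in \<open>auto simp: fun_eq_iff\<close>)
    then have "\<psi> (diag_matrix (\<lambda>i. if i \<in> insert j S then a i else 1)) =
       \<psi> (diag_entry k (a j)) * \<psi> (diag_entry k (\<Prod>i\<in>S. a i))"
      using a by (simp add: mult det_diag_entry det_diag_matrix insert.IH
        multiplicative_diag_entry_swap[of \<psi>, OF mult nz a, of j _ k])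
    also have "\<dots> = \<psi> (diag_entry k (\<Prod>i\<in>insert j S. a i))"
      using a insert.hyps by (simp add: mult[symmetric] det_diag_entry diag_entry_mult)
    finally show ?case .
  qed (simp add: diag_entry_def)
  from this[of UNIV] show ?thesis by simp
qed

lemma multiplicative_through_det:
  fixes \<psi> :: "('a::field_char_0)^'n^'n \<Rightarrow> 'b::field"
  assumes mult: "\<And>A B. det A \<noteq> 0 \<Longrightarrow> det B \<noteq> 0 \<Longrightarrow> \<psi> (A ** B) = \<psi> A * \<psi> B"
    and nz: "\<And>A. det A \<noteq> 0 \<Longrightarrow> \<psi> A \<noteq> 0" and A: "det A \<noteq> 0"
  shows "\<psi> A = \<psi> (diag_entry k (det A))"
proof -
  obtain a where a: "det A = (\<Prod>i\<in>UNIV. a i)" "\<psi> A = \<psi> (diag_matrix a)"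
    using multiplicative_diagonalize[of \<psi>, OF mult nz A] by blast
  have "a i \<noteq> 0" for i using a(1) A by auto
  from multiplicative_diag_matrix[of \<psi> a k, OF mult nz this] a show ?thesis by simp
qed

lemma fls_inverse_principal_unit:
  fixes u :: "real fls"
  assumes "u \<in> range fps_to_fls" "fls_nth u 0 = 1"
  shows "inverse u \<in> range fps_to_fls" "fls_nth (inverse u) 0 = 1"
proof -
  have s: "fls_subdegree u = 0"
    by (rule fls_subdegree_eqI) (use assms in \<open>auto simp: integral_fls_iff\<close>)
  have u: "u \<noteq> 0" using assms(2) by auto
  have si: "fls_subdegree (inverse u) = 0" using s by simp
  then show "inverse u \<in> range fps_to_fls" by (auto simp: integral_fls_iff)
  have "u * inverse u = 1" using u by simp
  then have "fls_nth u (fls_subdegree u) * fls_nth (inverse u) (fls_subdegree (inverse u)) = 1"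
    by (metis fls_times_base add_0 fls_one_nth s si)
  then show "fls_nth (inverse u) 0 = 1" using s si assms by simp
qed

text \<open>By \<open>multiplicative_through_det\<close> it remains to evaluate the character \<open>\<theta>\<close> of the nonzero elements of F, and
an element with leading coefficient 1 or -1 is a sign times a power of t times a unit congruent to
1 modulo t.\<close>

lemma multiplicative_trivial_on_GL0:
  fixes \<psi> :: "('n::finite) Fmat \<Rightarrow> real"
  assumes mult: "\<And>A B. det A \<noteq> 0 \<Longrightarrow> det B \<noteq> 0 \<Longrightarrow> \<psi> (A ** B) = \<psi> A * \<psi> B"
    and pos: "\<And>A. det A \<noteq> 0 \<Longrightarrow> \<psi> A > 0"
    and t: "\<psi> (mat fls_X) = 1"
    and cong: "\<And>A B. A ** B = mat 1 \<Longrightarrow> integral_matrix A \<Longrightarrow> integral_matrix B \<Longrightarrow>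
        (\<And>i j. fls_nth (B $ i $ j) 0 = (if i = j then 1 else 0)) \<Longrightarrow> \<psi> A = 1"
    and g: "g \<in> GL0"
  shows "\<psi> g = 1"
proof -
  obtain k :: 'n where True by blast
  define \<theta> where "\<theta> x = \<psi> (diag_entry k x)" for x
  have nz: "\<psi> A \<noteq> 0" if "det A \<noteq> 0" for A using pos[OF that] by simp
  have \<theta>_mult: "\<theta> (x * y) = \<theta> x * \<theta> y" if "x \<noteq> 0" "y \<noteq> 0" for x y
    using that by (simp add: \<theta>_def mult det_diag_entry flip: diag_entry_mult)
  have \<theta>_pos: "\<theta> x > 0" if "x \<noteq> 0" for x using that pos by (simp add: \<theta>_def det_diag_entry)
  have "\<theta> 1 = 1" using \<theta>_mult[of 1 1] \<theta>_pos[of 1] by simp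
  have \<theta>_power: "\<theta> (x ^ m) = \<theta> x ^ m" if "x \<noteq> 0" for x m
    by (induction m) (simp_all add: \<open>\<theta> 1 = 1\<close> \<theta>_mult that)
  have "mat fls_X = (diag_matrix (\<lambda>i. fls_X) :: 'n Fmat)" by (simp add: mat_def diag_matrix_def)
  then have "1 = \<theta> (fls_X ^ CARD('n))"
    using multiplicative_diag_matrix[of \<psi> "\<lambda>i. fls_X" k, OF mult nz] t by (simp add: \<theta>_def)
  then have "\<theta> fls_X ^ CARD('n) = 1" by (simp add: \<theta>_power)
  then have \<theta>_X: "\<theta> fls_X = 1"
    using \<theta>_pos[of fls_X] power_eq_iff_eq_base[of "CARD('n)" "\<theta> fls_X" 1] by simp
  have \<theta>_intpow: "\<theta> (fls_X_intpow m) = 1" for m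
  proof -
    have nat: "\<theta> (fls_X_intpow (int m)) = 1" for m
      using \<theta>_power[of fls_X m] by (simp add: \<theta>_X fls_X_power_conv_shift_1)
    show ?thesis
    proof (cases "m \<ge> 0")
      case True
      then show ?thesis using nat[of "nat m"] by simp
    next
      case False
      have "fls_X_intpow m * fls_X_intpow (- m) = (fls_X_intpow (m + - m) :: real fls)"
        by (rule fls_X_intpow_times_fls_X_intpow)
      also have "\<dots> = 1" by simp
      finally have "fls_X_intpow m * fls_X_intpow (- m) = (1 :: real fls)" .
      then have "\<theta> (fls_X_intpow m) * \<theta> (fls_X_intpow (- m)) = 1"
        using \<theta>_mult[of "fls_X_intpow m" "fls_X_intpow (- m)"] \<open>\<theta> 1 = 1\<close> by (simp add: fls_shift_eq0_iff)
      moreover have "\<theta> (fls_X_intpow (- m)) = 1" using nat[of "nat (- m)"] False by simp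
      ultimately show ?thesis by simp
    qed
  qed
  have "\<theta> (- 1) ^ 2 = 1" using \<theta>_power[of "-1" 2] \<open>\<theta> 1 = 1\<close> by simp
  then have \<theta>_neg: "\<theta> (- 1) = 1" using \<theta>_pos[of "- 1"] by (simp add: power2_eq_1_iff)
  have \<theta>_unit: "\<theta> u = 1" if u: "u \<in> range fps_to_fls" "fls_nth u 0 = 1" for u
    unfolding \<theta>_def
  proof (rule cong)
    have "u \<noteq> 0" using u(2) by auto
    have "diag_entry k 1 = (mat 1 :: 'n Fmat)"
      by (simp add: diag_entry_def diag_matrix_def mat_def)
    then show "diag_entry k u ** diag_entry k (inverse u) = (mat 1 :: 'n Fmat)"
      using \<open>u \<noteq> 0\<close> by (simp add: diag_entry_mult)
    have "(0 :: real fls) \<in> range fps_to_fls" "(1 :: real fls) \<in> range fps_to_fls"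
      by (auto simp: integral_fls_iff)
    then show "integral_matrix (diag_entry k u)" "integral_matrix (diag_entry k (inverse u))"
      using u fls_inverse_principal_unit[OF u]
      by (auto simp: integral_matrix_def diag_entry_def diag_matrix_def)
    show "fls_nth (diag_entry k (inverse u) $ i $ j) 0 = (if i = j then 1 else 0)" for i j
      using fls_inverse_principal_unit[OF u] by (auto simp: diag_entry_def diag_matrix_def)
  qed
  define d where "d = det g"
  have d: "d \<noteq> 0" "fls_nth d (fls_subdegree d) \<in> {1, -1}"
    using g by (auto simp: GL0_def invertible_det_nz d_def)
  define s where "s = (if fls_nth d (fls_subdegree d) = 1 then 1 else - 1 :: real fls)"
  define u where "u = s * fls_shift (fls_subdegree d) d"
  have "fls_nth u i = fls_nth s 0 * fls_nth d (i + fls_subdegree d)" for i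
    by (simp add: u_def s_def)
  then have u: "u \<in> range fps_to_fls" "fls_nth u 0 = 1"
    using d by (auto simp: integral_fls_iff s_def)
  have dd: "d = s * u * fls_X_intpow (fls_subdegree d)"
    by (simp add: u_def s_def fls_X_intpow_times_conv_shift)
  have "\<theta> d = \<theta> s * \<theta> u * \<theta> (fls_X_intpow (fls_subdegree d))"
  proof -
    have "s \<noteq> 0" "u \<noteq> 0" using u(2) by (auto simp: s_def)
    then show ?thesis
      by (subst dd) (simp only: \<theta>_mult mult_eq_0_iff fls_X_intpow_nonzero simp_thms)
  qed
  also have "\<theta> s = 1" using \<theta>_neg \<open>\<theta> 1 = 1\<close> by (simp add: s_def)
  finally have "\<theta> d = 1" using \<theta>_unit[OF u] \<theta>_intpow by simp
  then show ?thesis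
    using multiplicative_through_det[of \<psi> g k, OF mult nz] d by (simp add: \<theta>_def d_def)
qed


section \<open>The lifts of the powers of t are central over GL_n(F)_0\<close>

lemma Mhat_scale_inj:
  assumes \<beta>: "\<beta> \<in> Mhat" and c: "c > 0" "d > 0" and eq: "Mhat_scale c \<beta> = Mhat_scale d \<beta>"
  shows "c = d"
proof -
  obtain g \<mu> where [simp]: "\<beta> = (g, \<mu>)" by (cases \<beta>)
  obtain N where "haar (V_space g) N \<mu>" using Mhat_haar[of g \<mu>] \<beta> by auto
  then interpret haar "V_space g" N \<mu> .
  let ?B = "norm_ball (V_space g) 1"
  have "scale_measure (ennreal c) \<mu> = scale_measure (ennreal d) \<mu>" using eq by (simp add: Mhat_scale_def)
  from arg_cong[OF this, of "\<lambda>M. emeasure M ?B"]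
  have "ennreal c * emeasure \<mu> ?B = ennreal d * emeasure \<mu> ?B" by simp
  moreover have r: "emeasure \<mu> ?B = ennreal (measure \<mu> ?B)"
    using emeasure_ball_finite[of 1] by (intro emeasure_eq_ennreal_measure) auto
  moreover have "measure \<mu> ?B > 0" using emeasure_unit_ball_pos unfolding r by simp
  ultimately show ?thesis using c by (simp flip: ennreal_mult)
qed

lemma fst_Mhat_mult [simp]: "fst (Mhat_mult \<alpha> \<beta>) = fst \<alpha> ** fst \<beta>"
  by (simp add: Mhat_mult_def split_beta)

definition commutator_scaling :: "('n::finite) Fmat \<Rightarrow> real \<Rightarrow> bool" where
  "commutator_scaling g c \<longleftrightarrow> c > 0 \<and> (\<forall>\<mu>. (g, \<mu>) \<in> Mhat \<longrightarrow>
     Mhat_mult (t_lift 1) (g, \<mu>) = Mhat_scale c (Mhat_mult (g, \<mu>) (t_lift 1)))"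

definition commutator_factor :: "('n::finite) Fmat \<Rightarrow> real" where
  "commutator_factor g = (SOME c. commutator_scaling g c)"

text \<open>Both products lie over \<open>t g = g t\<close>, so they are proportional. Scaling \<open>\<mu>\<close> scales both, so the factor
depends on g only.\<close>

lemma commutator_factor_props:
  fixes g :: "('n::finite) Fmat"
  assumes g: "g \<in> matrices_R"
  shows "commutator_factor g > 0"
    "(g, \<mu>) \<in> Mhat \<Longrightarrow>
       Mhat_mult (t_lift 1) (g, \<mu>) = Mhat_scale (commutator_factor g) (Mhat_mult (g, \<mu>) (t_lift 1))"
proof -
  obtain \<mu>0 where \<mu>0: "(g, \<mu>0) \<in> Mhat" using haar_measure_exists[OF g] .
  let ?L = "Mhat_mult (t_lift 1) (g, \<mu>0)" and ?R = "Mhat_mult (g, \<mu>0) (t_lift 1)"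
  have LR: "?L \<in> Mhat" "?R \<in> Mhat" by (intro Mhat_mult_closed t_lift_Mhat \<mu>0)+
  have "fst ?L = fst ?R" by (simp add: t_lift_def mat_commute)
  then obtain c where c: "c > 0" "?L = Mhat_scale c ?R"
    using LR Mhat_unique by (metis prod.collapse)
  have "commutator_scaling g c"
    unfolding commutator_scaling_def
  proof (intro conjI allI impI c(1))
    fix \<mu> assume \<mu>: "(g, \<mu>) \<in> Mhat"
    obtain a where a: "a > 0" "(g, \<mu>) = Mhat_scale a (g, \<mu>0)" using Mhat_unique[OF \<mu> \<mu>0] .
    have "Mhat_mult (t_lift 1) (g, \<mu>) = Mhat_scale a (Mhat_scale c ?R)"
      unfolding a(2) by (simp add: Mhat_mult_scale_right a(1) \<mu>0 c(2) del: One_nat_def)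
    also have "\<dots> = Mhat_scale c (Mhat_scale a ?R)"
      by (simp add: Mhat_scale_scale a(1) c(1) mult.commute)
    also have "Mhat_scale a ?R = Mhat_mult (g, \<mu>) (t_lift 1)"
      unfolding a(2) by (simp add: Mhat_mult_scale_left a(1) \<mu>0)
    finally show "Mhat_mult (t_lift 1) (g, \<mu>) = Mhat_scale c (Mhat_mult (g, \<mu>) (t_lift 1))" .
  qed
  then have "commutator_scaling g (commutator_factor g)"
    unfolding commutator_factor_def by (rule someI)
  then show "commutator_factor g > 0"
    "(g, \<mu>) \<in> Mhat \<Longrightarrow>
       Mhat_mult (t_lift 1) (g, \<mu>) = Mhat_scale (commutator_factor g) (Mhat_mult (g, \<mu>) (t_lift 1))"
    by (auto simp: commutator_scaling_def)
qed

lemma commutator_factor_eqI: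
  assumes \<alpha>: "(g, \<mu>) \<in> Mhat" and c: "c > 0"
    and eq: "Mhat_mult (t_lift 1) (g, \<mu>) = Mhat_scale c (Mhat_mult (g, \<mu>) (t_lift 1))"
  shows "commutator_factor g = c"
proof -
  have g: "g \<in> matrices_R" using \<alpha> by (simp add: Mhat_iff)
  show ?thesis
    by (rule Mhat_scale_inj[OF Mhat_mult_closed[OF \<alpha> t_lift_Mhat[of 1]]])
       (use commutator_factor_props[OF g] \<alpha> eq c in auto)
qed

lemma commutator_factor_mult:
  assumes g: "g \<in> matrices_R" and h: "h \<in> matrices_R"
  shows "commutator_factor (g ** h) = commutator_factor g * commutator_factor h"
proof -
  obtain \<mu> where \<mu>: "(g, \<mu>) \<in> Mhat" using haar_measure_exists[OF g] .
  obtain \<nu> where \<nu>: "(h, \<nu>) \<in> Mhat" using haar_measure_exists[OF h] .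
  note cg = commutator_factor_props[OF g] and ch = commutator_factor_props[OF h]
  let ?a = "(g, \<mu>)" and ?b = "(h, \<nu>)" and ?T = "t_lift 1"
  note closed = Mhat_mult_closed \<mu> \<nu> t_lift_Mhat
  have "Mhat_mult ?T (Mhat_mult ?a ?b) = Mhat_mult (Mhat_mult ?T ?a) ?b"
    by (simp add: Mhat_mult_assoc closed)
  also have "\<dots> = Mhat_scale (commutator_factor g) (Mhat_mult ?a (Mhat_mult ?T ?b))"
    by (simp add: cg \<mu> Mhat_mult_scale_left closed Mhat_mult_assoc del: One_nat_def)
  also have "\<dots> = Mhat_scale (commutator_factor g * commutator_factor h) (Mhat_mult (Mhat_mult ?a ?b) ?T)"
    by (simp add: ch cg \<nu> Mhat_mult_scale_right closed Mhat_mult_assoc Mhat_scale_scale del: One_nat_def)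
  finally have "Mhat_mult ?T (Mhat_mult ?a ?b) =
    Mhat_scale (commutator_factor g * commutator_factor h) (Mhat_mult (Mhat_mult ?a ?b) ?T)" .
  moreover have "Mhat_mult ?a ?b = (g ** h, conv_measure g \<mu> h \<nu>)" by (simp add: Mhat_mult_def)
  ultimately show ?thesis
    using commutator_factor_eqI[of "g ** h" "conv_measure g \<mu> h \<nu>"] Mhat_conv[OF \<mu> \<nu>] cg(1) ch(1) by simp
qed

lemma commutator_factor_t_pow: "commutator_factor (t_pow (int k)) = 1"
proof (rule commutator_factor_eqI)
  show "(t_pow (int k), mu_st k) \<in> Mhat" by (rule Mhat_mu_st)
  show "Mhat_mult (t_lift 1) (t_pow (int k), mu_st k) =
    Mhat_scale 1 (Mhat_mult (t_pow (int k), mu_st k) (t_lift 1))"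
    by (simp only: t_lift_mult Mhat_scale_1 add.commute flip: t_lift_def)
qed simp

text \<open>Here \<open>V_g = 0\<close>, so \<open>\<mu>\<close> is a point mass, and the inverse h of g fixes \<open>V_t\<close> pointwise because h is
congruent to the identity modulo t. Both products are therefore the same multiple of the standard
measure.\<close>

lemma commutator_factor_principal_unit:
  fixes g h :: "('n::finite) Fmat"
  assumes gh: "g ** h = mat 1" and g: "integral_matrix g" and h: "integral_matrix h"
    and h1: "\<And>i j. fls_nth (h $ i $ j) 0 = (if i = j then 1 else 0)"
  shows "commutator_factor g = 1"
proof -
  have inv: "matrix_inv g = h" by (rule matrix_inv_unique_right[OF gh])
  have "det g \<noteq> 0" using gh by (metis det_I det_mul mult_zero_left zero_neq_one)
  then have gR: "g \<in> matrices_R" using g by (simp add: matrices_R_iff)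
  obtain \<mu> where \<mu>: "(g, \<mu>) \<in> Mhat" using haar_measure_exists[OF gR] .
  have V0: "V_space g = {0}"
  proof -
    have "x = 0" if "x \<in> Rminus_vecs" "g *v x \<in> R_vecs" for x
    proof -
      have "x = h *v (g *v x)" using inv matrices_R_cancel[OF gR] by metis
      then have "x \<in> R_vecs" using integral_matrix_vector[OF h that(2)] by simp
      then show "x = 0" using that(1) by (metis proj_minus_eq_0_iff proj_minus_id)
    qed
    then show ?thesis by (auto simp: V_space_iff[OF gR] Rminus_vecs_closed R_vecs_closed)
  qed
  have int_mu: "(\<integral>\<^sup>+z. f z \<partial>\<mu>) = f 0 * emeasure \<mu> {0}" for f :: "'n Fvec \<Rightarrow> ennreal"
  proof -
    have sp: "space \<mu> = {0}" using Mhat_space[OF \<mu>] V0 by simp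
    have "(\<integral>\<^sup>+z. f z \<partial>\<mu>) = (\<integral>\<^sup>+z. f 0 \<partial>\<mu>)" by (rule nn_integral_cong) (simp add: sp)
    then show ?thesis by (simp add: sp)
  qed
  let ?t = "t_pow (int 1) :: 'n Fmat"
  have "conv_measure ?t (mu_st 1) g \<mu> = conv_measure g \<mu> ?t (mu_st 1)"
  proof (rule measure_eqI)
    show s: "sets (conv_measure ?t (mu_st 1) g \<mu>) = sets (conv_measure g \<mu> ?t (mu_st 1))"
      by (simp only: sets_conv_measure[OF Mhat_mu_st \<mu>] sets_conv_measure[OF \<mu> Mhat_mu_st] mat_commute)
    fix A assume "A \<in> sets (conv_measure ?t (mu_st 1) g \<mu>)"
    then have A: "A \<in> sets (fd_borel (V_space (?t ** g)))" "A \<in> sets (fd_borel (V_space (g ** ?t)))"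
      using s by (simp_all only: sets_conv_measure[OF Mhat_mu_st \<mu>] sets_conv_measure[OF \<mu> Mhat_mu_st])
    have sp: "space (mu_st 1 :: 'n Fvec measure) = polar_vecs 1" by (simp add: mu_st_eq)
    have eq: "glue g y 0 = y" if y: "y \<in> polar_vecs 1" for y
    proof -
      have "fls_nth ((h *v y - y) $ i) m = 0" if "m < 0" for i m
      proof -
        define h' where "h' = (\<chi> i j. fls_shift 1 ((h - mat 1) $ i $ j))"
        have "h - mat 1 = ?t ** h'"
          by (simp add: h'_def vec_eq_iff mat_mult_nth fls_X_intpow_times_conv_shift)
        also have "\<dots> = h' ** ?t" by (rule mat_commute)
        finally have hh: "h - mat 1 = h' ** ?t" .
        have h': "integral_matrix h'"
          unfolding h'_def integral_matrix_def integral_fls_iff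
        proof (intro allI impI)
          fix i j and m :: int assume "m < 0"
          moreover have "fls_nth (h $ i $ j) (m + 1) = 0" if "m + 1 < 0"
            using h that by (auto simp: integral_matrix_def integral_fls_iff)
          moreover have "m + 1 < 0 \<or> m + 1 = 0" using \<open>m < 0\<close> by linarith
          ultimately show "fls_nth ((\<chi> i j. fls_shift 1 ((h - mat 1) $ i $ j)) $ i $ j) m = 0"
            using h1[of i j] by (auto simp: mat_def)
        qed
        have "?t *v y \<in> R_vecs" using y unfolding polar_vecs_iff by simp
        then have "(h - mat 1) *v y \<in> R_vecs"
          unfolding hh matrix_vector_mul_assoc[symmetric] by (rule integral_matrix_vector[OF h'])
        then have "h *v y - y \<in> R_vecs" by (simp add: matrix_vector_mult_diff_rdistrib)
        then show ?thesis using that unfolding R_vecs_iff by blast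
      qed
      then have "h *v y - y \<in> R_vecs" unfolding R_vecs_iff by blast
      then have "proj_minus (h *v y) = proj_minus y" by (rule proj_minus_cong)
      also have "\<dots> = y" using y polar_vecs_subset_Rminus by (intro proj_minus_id) blast
      finally show ?thesis by (simp add: inv)
    qed
    have glue0: "glue ?t 0 z = z" if "z \<in> polar_vecs 1" for z
      using that polar_vecs_subset_Rminus by (auto intro!: proj_minus_id)
    have "emeasure (conv_measure ?t (mu_st 1) g \<mu>) A = (\<integral>\<^sup>+y. indicator A y * emeasure \<mu> {0} \<partial>(mu_st 1 :: 'n Fvec measure))"
      unfolding emeasure_conv[OF Mhat_mu_st \<mu> A(1)] int_mu
      by (rule nn_integral_cong) (simp only: sp eq)
    also have "\<dots> = (\<integral>\<^sup>+y. indicator A y \<partial>(mu_st 1 :: 'n Fvec measure)) * emeasure \<mu> {0}"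
    proof (rule nn_integral_multc)
      have iA: "(indicator A :: _ \<Rightarrow> ennreal) \<in> borel_measurable (fd_borel (V_space (?t ** g)))"
        using A(1) by simp
      have "(\<lambda>z. indicator A (glue ?t 0 z) :: ennreal) \<in> borel_measurable (mu_st 1)"
      proof (rule glue_section_measurable[OF \<mu> Mhat_mu_st])
        show "(indicator A :: _ \<Rightarrow> ennreal) \<in> borel_measurable (fd_borel (V_space (g ** ?t)))" using A(2) by simp
        show "0 \<in> V_space g" by (simp add: V0)
      qed
      then show "(indicator A :: _ \<Rightarrow> ennreal) \<in> borel_measurable (mu_st 1)"
        by (rule measurable_cong[THEN iffD1, rotated])
           (simp only: sp glue0)
    qed
    also have "(\<integral>\<^sup>+y. indicator A y \<partial>(mu_st 1 :: 'n Fvec measure)) =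
       (\<integral>\<^sup>+z. indicator A (glue ?t 0 z) \<partial>(mu_st 1 :: 'n Fvec measure))"
      by (rule nn_integral_cong) (simp only: sp glue0)
    also have "\<dots> * emeasure \<mu> {0} = emeasure (conv_measure g \<mu> ?t (mu_st 1)) A"
      unfolding emeasure_conv[OF \<mu> Mhat_mu_st A(2)] int_mu ..
    finally show "emeasure (conv_measure ?t (mu_st 1) g \<mu>) A = emeasure (conv_measure g \<mu> ?t (mu_st 1)) A" .
  qed
  then have "Mhat_mult (t_lift 1) (g, \<mu>) = Mhat_scale 1 (Mhat_mult (g, \<mu>) (t_lift 1))"
    by (simp only: t_lift_def Mhat_mult_def prod.case Mhat_scale_1 mat_commute[of "fls_X_intpow (int 1)"])
  then show ?thesis by (intro commutator_factor_eqI[OF \<mu>]) simp_all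
qed

text \<open>Any exponent of t that clears the denominators of g will do, since the factor of a power of t is 1.
This extends the commutator factor from integral matrices to the whole group.\<close>

definition clearing_exponent :: "('n::finite) Fmat \<Rightarrow> nat" where
  "clearing_exponent g = (SOME k. integral_matrix (t_pow (int k) ** g))"

definition commutator_character :: "('n::finite) Fmat \<Rightarrow> real" where
  "commutator_character g = commutator_factor (t_pow (int (clearing_exponent g)) ** g)"

lemma commutator_character_eq:
  fixes g :: "('n::finite) Fmat"
  assumes d: "det g \<noteq> 0" and k: "integral_matrix (t_pow (int k) ** g)"
  shows "commutator_character g = commutator_factor (t_pow (int k) ** g)"
proof -
  have R: "t_pow (int k) ** g \<in> matrices_R" if "integral_matrix (t_pow (int k) ** g)" for k
    using that d det_t_pow_nz[where 'n='n] by (simp add: matrices_R_iff det_mul)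
  have shift: "commutator_factor (t_pow (int (j + k)) ** g) = commutator_factor (t_pow (int k) ** g)"
    if "integral_matrix (t_pow (int k) ** g)" for j k
  proof -
    have "t_pow (int (j + k)) ** g = t_pow (int j) ** (t_pow (int k) ** g)"
      by (simp only: matrix_mul_assoc t_pow_mult_nat)
    then show ?thesis
      by (simp only: commutator_factor_mult[OF t_pow_matrices_R R[OF that]] commutator_factor_t_pow mult_1_left)
  qed
  let ?m = "clearing_exponent g"
  have m: "integral_matrix (t_pow (int ?m) ** g)"
    unfolding clearing_exponent_def by (rule someI[of _ k]) (rule k)
  have "commutator_factor (t_pow (int ?m) ** g) = commutator_factor (t_pow (int (k + ?m)) ** g)"
    using shift[OF m] ..
  also have "\<dots> = commutator_factor (t_pow (int k) ** g)"
    using shift[OF k, of ?m] by (simp only: add.commute)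
  finally show ?thesis by (simp only: commutator_character_def)
qed

lemma commutator_character_integral:
  assumes "g \<in> matrices_R" shows "commutator_character g = commutator_factor g"
  using commutator_character_eq[of g 0] assms by (simp add: matrices_R_iff)

lemma commutator_factor_GL0:
  fixes g :: "('n::finite) Fmat"
  assumes gR: "g \<in> matrices_R" and g: "g \<in> GL0"
  shows "commutator_factor g = 1"
proof -
  have t1: "(mat fls_X :: 'n Fmat) = t_pow (int 1)" by (simp add: fls_X_conv_shift_1)
  have "commutator_character g = 1"
  proof (rule multiplicative_trivial_on_GL0[OF _ _ _ _ g])
    fix A B :: "'n Fmat" assume AB: "det A \<noteq> 0" "det B \<noteq> 0"
    obtain k where k: "integral_matrix (t_pow (int k) ** A)" using clear_denominators[of A] by blast
    obtain l where l: "integral_matrix (t_pow (int l) ** B)" using clear_denominators[of B] by blast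
    have eq: "t_pow (int (k + l)) ** (A ** B) = (t_pow (int k) ** A) ** (t_pow (int l) ** B)"
    proof -
      have "t_pow (int (k + l)) ** (A ** B) = t_pow (int k) ** ((t_pow (int l) ** A) ** B)"
        by (simp only: matrix_mul_assoc flip: t_pow_mult_nat)
      also have "\<dots> = t_pow (int k) ** ((A ** t_pow (int l)) ** B)"
        by (simp only: mat_commute[of _ A])
      finally show ?thesis by (simp only: matrix_mul_assoc)
    qed
    have kl: "integral_matrix (t_pow (int (k + l)) ** (A ** B))"
      unfolding eq by (rule integral_matrix_mult[OF k l])
    have R: "t_pow (int k) ** A \<in> matrices_R" "t_pow (int l) ** B \<in> matrices_R"
      using k l AB det_t_pow_nz[where 'n='n] by (simp_all add: matrices_R_iff det_mul)
    show "commutator_character (A ** B) = commutator_character A * commutator_character B"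
      using AB by (simp only: commutator_character_eq[OF _ kl] commutator_character_eq[OF _ k]
        commutator_character_eq[OF _ l] det_mul mult_eq_0_iff simp_thms eq commutator_factor_mult[OF R])
  next
    fix A :: "'n Fmat" assume A: "det A \<noteq> 0"
    obtain k where k: "integral_matrix (t_pow (int k) ** A)" using clear_denominators[of A] by blast
    then have "t_pow (int k) ** A \<in> matrices_R"
      using A det_t_pow_nz[where 'n='n] by (simp add: matrices_R_iff det_mul)
    then show "commutator_character A > 0"
      using commutator_factor_props(1) commutator_character_eq[OF A k] by simp
  next
    show "commutator_character (mat fls_X :: 'n Fmat) = 1"
      unfolding t1 by (simp only: commutator_character_integral[OF t_pow_matrices_R] commutator_factor_t_pow)
  next
    fix A B :: "'n Fmat"
    assume AB: "A ** B = mat 1" "integral_matrix A" "integral_matrix B"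
      "\<And>i j. fls_nth (B $ i $ j) 0 = (if i = j then 1 else 0)"
    then have "det A \<noteq> 0" by (metis det_I det_mul mult_zero_left zero_neq_one)
    then have "A \<in> matrices_R" using AB by (simp add: matrices_R_iff)
    then show "commutator_character A = 1"
      using commutator_factor_principal_unit[OF AB] by (simp add: commutator_character_integral)
  qed
  then show ?thesis by (simp add: commutator_character_integral[OF gR])
qed

lemma t_lift_central:
  assumes "\<alpha> \<in> Mhat0" shows "Mhat_mult (t_lift l) \<alpha> = Mhat_mult \<alpha> (t_lift l)"
proof -
  obtain g \<mu> where \<alpha>: "\<alpha> = (g, \<mu>)" "\<alpha> \<in> Mhat" "g \<in> GL0" using assms by (auto simp: Mhat0_def)
  have "g \<in> matrices_R" using \<alpha> by (simp add: Mhat_iff)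
  then have T1: "Mhat_mult (t_lift 1) \<alpha> = Mhat_mult \<alpha> (t_lift 1)"
    using commutator_factor_props(2)[of g \<mu>] commutator_factor_GL0[of g] \<alpha> by simp
  show ?thesis
  proof (induction l)
    case 0
    show ?case by (simp only: Mhat_mult_1_left[OF \<alpha>(2)] Mhat_mult_1_right[OF \<alpha>(2)])
  next
    case (Suc l)
    have T: "(t_lift (Suc l) :: 'a Fmat \<times> _) = Mhat_mult (t_lift 1) (t_lift l)" by (simp add: t_lift_mult)
    have "Mhat_mult (t_lift (Suc l)) \<alpha> = Mhat_mult (t_lift 1) (Mhat_mult \<alpha> (t_lift l))"
      by (simp only: T Mhat_mult_assoc t_lift_Mhat \<alpha>(2) Suc)
    also have "\<dots> = Mhat_mult (Mhat_mult \<alpha> (t_lift 1)) (t_lift l)"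
      by (simp only: T1 Mhat_mult_assoc[symmetric] t_lift_Mhat \<alpha>(2))
    also have "\<dots> = Mhat_mult \<alpha> (t_lift (Suc l))"
      by (simp only: T Mhat_mult_assoc t_lift_Mhat \<alpha>(2))
    finally show ?case .
  qed
qed

section \<open>Schwartz functions\<close>

lemma continuous_map_of_lipschitz:
  fixes f :: "('n::finite) Fvec \<Rightarrow> complex"
  assumes V: "V \<subseteq> polar_vecs N"
    and lip: "\<And>x y. x \<in> V \<Longrightarrow> y \<in> V \<Longrightarrow> norm (f y - f x) \<le> K * coeff_norm (y - x)"
  shows "continuous_map (fd_topology V) euclidean f"
proof -
  have "openin (fd_topology V) {x \<in> V. f x \<in> S}" if "open S" for S
  proof (subst openin_subopen, intro ballI)
    fix x assume "x \<in> {x \<in> V. f x \<in> S}"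
    then have x: "x \<in> V" "f x \<in> S" by auto
    then obtain e where e: "e > 0" "\<And>z. norm (z - f x) < e \<Longrightarrow> z \<in> S"
      using \<open>open S\<close> unfolding open_contains_ball by (metis dist_norm dist_commute mem_ball subset_eq)
    define T where "T = {y \<in> V. coeff_norm (y - x) < e / (\<bar>K\<bar> + 1)}"
    have "openin (fd_topology V) T"
      using openin_continuous_map_preimage[OF continuous_map_dist_norm[OF V, of x], of "{..<e / (\<bar>K\<bar> + 1)}"] x V
      by (auto simp: T_def)
    moreover have "x \<in> T" using x e by (auto simp: T_def)
    moreover have "T \<subseteq> {x \<in> V. f x \<in> S}"
    proof
      fix y assume y: "y \<in> T"
      have "norm (f y - f x) \<le> K * coeff_norm (y - x)" using lip x y by (auto simp: T_def)
      also have "\<dots> \<le> (\<bar>K\<bar> + 1) * coeff_norm (y - x)" by (intro mult_right_mono) auto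
      also have "\<dots> < e" using y by (simp add: T_def field_simps)
      finally show "y \<in> {x \<in> V. f x \<in> S}" using e y by (auto simp: T_def)
    qed
    ultimately show "\<exists>T. openin (fd_topology V) T \<and> x \<in> T \<and> T \<subseteq> {x \<in> V. f x \<in> S}" by blast
  qed
  then show ?thesis by (simp add: continuous_map)
qed

text \<open>Functions on the quotient of F^n by R^n.\<close>

definition R_periodic :: "(('n::finite) Fvec \<Rightarrow> complex) \<Rightarrow> bool" where
  "R_periodic f \<longleftrightarrow> (\<forall>x. \<forall>r\<in>R_vecs. f (x + r) = f x)"

abbreviation line_deriv :: "('n::finite) Fvec \<Rightarrow> ('n Fvec \<Rightarrow> complex) \<Rightarrow> 'n Fvec \<Rightarrow> complex" where
  "line_deriv v f \<equiv> (\<lambda>x. vector_derivative (\<lambda>s. f (x + rscale s v)) (at 0))"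

lemma R_periodic_cong:
  assumes "R_periodic f" "x - y \<in> R_vecs" shows "f x = f y"
  using assms(1)[unfolded R_periodic_def, rule_format, OF assms(2), of y] by simp

lemma R_periodic_proj: "R_periodic f \<Longrightarrow> f (proj_minus x) = f x"
  by (rule R_periodic_cong[symmetric]) auto

lemma rscale_add_left: "rscale (a + b) v = rscale a v + rscale b v"
  by (rule coords_eqI) (simp add: algebra_simps)

lemma line_deriv_proj:
  assumes "R_periodic f" shows "line_deriv (proj_minus v) f = line_deriv v f"
proof
  fix x
  have "f (x + rscale s (proj_minus v)) = f (x + rscale s v)" for s
    by (rule R_periodic_cong[OF assms]) (simp add: R_vecs_iff proj_minus_nth)
  then show "line_deriv (proj_minus v) f x = line_deriv v f x" by simp
qed

lemma line_deriv_periodic: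
  assumes "R_periodic f" shows "R_periodic (line_deriv v f)"
  unfolding R_periodic_def
proof (intro allI ballI)
  fix x r assume r: "r \<in> (R_vecs :: 'a Fvec set)"
  have "f (x + r + rscale s v) = f (x + rscale s v)" for s
    by (rule R_periodic_cong[OF assms]) (simp add: r)
  then show "line_deriv v f (x + r) = line_deriv v f x" by simp
qed

lemma dir_deriv_periodic: "R_periodic f \<Longrightarrow> R_periodic (dir_deriv vs f)"
proof (induction vs)
  case (Cons v vs)
  then show ?case using line_deriv_periodic[of "dir_deriv vs f" v] by simp
qed simp

lemma dir_deriv_proj:
  assumes "R_periodic f" shows "dir_deriv (map proj_minus vs) f = dir_deriv vs f"
proof (induction vs)
  case (Cons v vs)
  then show ?case using line_deriv_proj[OF dir_deriv_periodic[OF assms]] by simp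
qed simp

lemma fin_dim_polar_vecs: "fin_dim_subspace (polar_vecs N :: ('n::finite) Fvec set)"
proof -
  let ?B = "unit_vec ` (polar_index N :: ('n \<times> int) set)"
  have sub: "real_Fvec.subspace (polar_vecs N :: 'n Fvec set)"
    by (auto simp: real_Fvec.subspace_def polar_vecs_closed)
  moreover have "polar_vecs N = real_Fvec.span ?B"
  proof
    show "polar_vecs N \<subseteq> real_Fvec.span ?B"
    proof
      fix x :: "'n Fvec" assume "x \<in> polar_vecs N"
      then have "x = (\<Sum>p\<in>polar_index N. rscale (coords x p) (unit_vec p))" by (rule polar_vecs_expand)
      also have "\<dots> \<in> real_Fvec.span ?B"
        by (intro real_Fvec.span_sum real_Fvec.span_scale real_Fvec.span_base) auto
      finally show "x \<in> real_Fvec.span ?B" .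
    qed
    show "real_Fvec.span ?B \<subseteq> polar_vecs N"
      by (rule real_Fvec.span_minimal[OF _ sub]) (auto intro: unit_vec_in_polar)
  qed
  ultimately show ?thesis unfolding fin_dim_subspace_def by (intro conjI exI[of _ ?B]) auto
qed

lemma finite_Rminus_polar:
  assumes "finite B" "B \<subseteq> Rminus_vecs" obtains N where "B \<subseteq> polar_vecs N"
proof -
  have "\<exists>N. B \<subseteq> polar_vecs N" using assms
  proof (induction B rule: finite_induct)
    case (insert b B)
    obtain N where "B \<subseteq> polar_vecs N" using insert by auto
    moreover obtain M where "b \<in> polar_vecs M" using insert.prems Rminus_in_polar by blast
    ultimately show ?case
      using polar_vecs_mono[of N "max N M"] polar_vecs_mono[of M "max N M"]
      by (intro exI[of _ "max N M"]) auto
  qed auto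
  then show ?thesis using that by blast
qed

lemma fin_dim_subset_polar:
  assumes "fin_dim_subspace W" "W \<subseteq> Rminus_vecs" obtains N where "W \<subseteq> polar_vecs N"
proof -
  obtain B where B: "finite B" "W = real_Fvec.span B" using assms by (auto simp: fin_dim_subspace_def)
  then have "B \<subseteq> Rminus_vecs" using assms(2) real_Fvec.span_superset by blast
  then obtain N where "B \<subseteq> polar_vecs N" using finite_Rminus_polar B(1) by blast
  then have "W \<subseteq> polar_vecs N" unfolding B(2)
    by (rule real_Fvec.span_minimal) (auto simp: real_Fvec.subspace_def polar_vecs_closed)
  then show ?thesis by (rule that)
qed

lemma schwartz_periodic: "f \<in> schwartz_space \<Longrightarrow> R_periodic f"
  by (simp add: schwartz_space_def R_periodic_def)

lemma schwartz_on_polar: "f \<in> schwartz_space \<Longrightarrow> schwartz_on (polar_vecs N) f"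
  by (simp add: schwartz_space_def fin_dim_polar_vecs polar_vecs_subset_Rminus)

text \<open>A function in the Schwartz space is controlled on subspaces of polar vectors only. Periodicity
allows all vectors to be replaced by their polar parts, which lie in a common such subspace.\<close>

lemma schwartz_dir_deriv_differentiable:
  assumes f: "f \<in> schwartz_space"
  shows "(\<lambda>s. dir_deriv vs f (x + rscale s v)) differentiable (at 0)"
proof -
  note per = schwartz_periodic[OF f]
  obtain N where N: "set (map proj_minus (x # v # vs)) \<subseteq> polar_vecs N"
    by (rule finite_Rminus_polar[of "set (map proj_minus (x # v # vs))"]) auto
  then have "(\<lambda>s. dir_deriv (map proj_minus vs) f (proj_minus x + rscale s (proj_minus v))) differentiable (at 0)"
    using schwartz_on_polar[OF f, of N] unfolding schwartz_on_def by (auto simp: image_subset_iff)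
  moreover have "dir_deriv vs f (proj_minus x + rscale s (proj_minus v)) = dir_deriv vs f (x + rscale s v)" for s
    by (rule R_periodic_cong[OF dir_deriv_periodic[OF per]]) (simp add: R_vecs_iff proj_minus_nth)
  ultimately show ?thesis by (simp add: dir_deriv_proj[OF per])
qed

lemma schwartz_line_differentiable:
  "f \<in> schwartz_space \<Longrightarrow> (\<lambda>s. f (x + rscale s v)) differentiable (at 0)"
  using schwartz_dir_deriv_differentiable[of f "[]"] by simp

lemma schwartz_dir_deriv_decay:
  assumes f: "f \<in> schwartz_space"
  shows "\<exists>C. \<forall>x\<in>polar_vecs N. coeff_norm x ^ k * norm (dir_deriv vs f x) \<le> C"
proof -
  obtain M where M: "set (map proj_minus vs) \<subseteq> polar_vecs M"
    by (rule finite_Rminus_polar[of "set (map proj_minus vs)"]) auto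
  then have "set (map proj_minus vs) \<subseteq> polar_vecs (max N M)"
    using polar_vecs_mono[of M "max N M"] by auto
  then obtain C where "\<forall>x\<in>polar_vecs (max N M). coeff_norm x ^ k * norm (dir_deriv (map proj_minus vs) f x) \<le> C"
    using schwartz_on_polar[OF f, of "max N M"] unfolding schwartz_on_def by blast
  then show ?thesis
    using polar_vecs_mono[of N "max N M"] by (auto simp: dir_deriv_proj[OF schwartz_periodic[OF f]])
qed

lemma schwartz_decay:
  "f \<in> schwartz_space \<Longrightarrow> \<exists>C. \<forall>x\<in>polar_vecs N. coeff_norm x ^ k * norm (f x) \<le> C"
  using schwartz_dir_deriv_decay[of f N k "[]"] by simp

lemma schwartz_continuous:
  assumes "f \<in> schwartz_space" shows "continuous_map (fd_topology (polar_vecs N)) euclidean f"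
  using schwartz_on_polar[OF assms, of N] unfolding schwartz_on_def
  by (metis dir_deriv.simps(1) empty_set empty_subsetI)

lemma schwartz_measurable:
  assumes "f \<in> schwartz_space" shows "f \<in> borel_measurable (fd_borel (polar_vecs N))"
  by (rule fd_borel_measurable_continuous[OF schwartz_continuous[OF assms]])

lemma line_has_vector_derivative:
  assumes "\<And>x. (\<lambda>s. f (x + rscale s v)) differentiable (at 0)"
  shows "((\<lambda>s. f (x + rscale s v)) has_vector_derivative line_deriv v f (x + rscale s v)) (at s)"
proof -
  have "((\<lambda>h. f (x + rscale s v + rscale h v)) has_vector_derivative line_deriv v f (x + rscale s v)) (at 0)"
    using assms[of "x + rscale s v"] by (simp add: vector_derivative_works)
  then have "((\<lambda>h. f (x + rscale (h + s) v)) has_vector_derivative line_deriv v f (x + rscale s v)) (at (s - s))"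
    by (simp add: rscale_add_left add.assoc add.commute add.left_commute)
  moreover have "((\<lambda>u. u - s) has_vector_derivative 1) (at s)"
    by (auto intro!: derivative_eq_intros)
  ultimately have "((\<lambda>h. f (x + rscale (h + s) v)) \<circ> (\<lambda>u. u - s) has_vector_derivative 1 *\<^sub>R line_deriv v f (x + rscale s v)) (at s)"
    by (intro vector_diff_chain_at)
  then show ?thesis by (simp add: o_def)
qed

lemma line_difference_bound:
  fixes f :: "('n::finite) Fvec \<Rightarrow> complex"
  assumes "\<And>x. (\<lambda>s. f (x + rscale s v)) differentiable (at 0)"
    and "\<And>s. norm (line_deriv v f (x + rscale s v)) \<le> K"
  shows "norm (f (x + rscale s v) - f x) \<le> K * \<bar>s\<bar>"
proof -
  have "norm (f (x + rscale s v) - f (x + rscale 0 v)) \<le> K * norm (s - 0)"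
  proof (rule differentiable_bound[where S=UNIV])
    fix u :: real
    show "((\<lambda>s. f (x + rscale s v)) has_derivative (\<lambda>h. h *\<^sub>R line_deriv v f (x + rscale u v))) (at u within UNIV)"
      using line_has_vector_derivative[OF assms(1)] unfolding has_vector_derivative_def .
    have "onorm (\<lambda>h. h *\<^sub>R line_deriv v f (x + rscale u v)) \<le> norm (line_deriv v f (x + rscale u v))"
      by (rule onorm_le) (simp add: mult.commute)
    then show "onorm (\<lambda>h. h *\<^sub>R line_deriv v f (x + rscale u v)) \<le> K"
      using assms(2)[of u] by linarith
  qed auto
  then show ?thesis by simp
qed

text \<open>Changing one coefficient at a time reduces the estimate to the mean value inequality on a line.\<close>

lemma lipschitz_of_bounded_line_derivs:
  fixes f :: "('n::finite) Fvec \<Rightarrow> complex"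
  assumes diff: "\<And>x v. (\<lambda>s. f (x + rscale s v)) differentiable (at 0)"
    and K: "\<And>p x. p \<in> polar_index N \<Longrightarrow> x \<in> polar_vecs N \<Longrightarrow> norm (line_deriv (unit_vec p) f x) \<le> K"
    and x: "x \<in> polar_vecs N" and y: "y \<in> polar_vecs N"
  shows "norm (f y - f x) \<le> K * coeff_norm (y - x)"
proof -
  let ?a = "coords (y - x)"
  have "norm (f (x + (\<Sum>p\<in>P. rscale (?a p) (unit_vec p))) - f x) \<le> K * (\<Sum>p\<in>P. \<bar>?a p\<bar>)
      \<and> x + (\<Sum>p\<in>P. rscale (?a p) (unit_vec p)) \<in> polar_vecs N"
    if "finite P" "P \<subseteq> polar_index N" for P
    using that
  proof (induction P rule: finite_induct)
    case empty
    then show ?case using x by simp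
  next
    case (insert p P)
    let ?z = "x + (\<Sum>p\<in>P. rscale (?a p) (unit_vec p))"
    have z: "?z \<in> polar_vecs N" and IH: "norm (f ?z - f x) \<le> K * (\<Sum>p\<in>P. \<bar>?a p\<bar>)" using insert by auto
    have p: "p \<in> polar_index N" "unit_vec p \<in> polar_vecs N" using insert.prems unit_vec_in_polar by auto
    have line: "?z + rscale s (unit_vec p) \<in> polar_vecs N" for s
      using z p polar_vecs_closed by blast
    have "norm (f (?z + rscale (?a p) (unit_vec p)) - f ?z) \<le> K * \<bar>?a p\<bar>"
      by (rule line_difference_bound[OF diff K[OF p(1) line]])
    then have "norm (f (?z + rscale (?a p) (unit_vec p)) - f x) \<le> K * \<bar>?a p\<bar> + K * (\<Sum>p\<in>P. \<bar>?a p\<bar>)"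
      using IH norm_triangle_ineq[of "f (?z + rscale (?a p) (unit_vec p)) - f ?z" "f ?z - f x"] by simp
    moreover have "x + (\<Sum>p\<in>insert p P. rscale (?a p) (unit_vec p)) = ?z + rscale (?a p) (unit_vec p)"
      by (simp only: sum.insert[OF insert.hyps]) (simp only: add_ac)
    moreover have "(\<Sum>p\<in>insert p P. \<bar>?a p\<bar>) = \<bar>?a p\<bar> + (\<Sum>p\<in>P. \<bar>?a p\<bar>)"
      using insert.hyps by (rule sum.insert)
    ultimately show ?case using line[of "?a p"] by (simp only: distrib_left simp_thms)
  qed
  from this[of "polar_index N"]
  have "norm (f (x + (\<Sum>p\<in>polar_index N. rscale (?a p) (unit_vec p))) - f x) \<le> K * (\<Sum>p\<in>polar_index N. \<bar>?a p\<bar>)"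
    by simp
  moreover have yx: "y - x \<in> polar_vecs N" using x y polar_vecs_closed by blast
  ultimately show ?thesis
    by (simp only: polar_vecs_expand[OF yx, symmetric] coeff_norm_polar[OF yx, symmetric]) simp
qed

text \<open>The Schwartz space is the largest set of periodic, rapidly decreasing functions that is stable under
directional derivatives. Continuity follows because bounded directional derivatives make a function
Lipschitz on vectors of bounded pole order.\<close>

lemma schwartz_coinduct:
  assumes per: "\<And>f. f \<in> S \<Longrightarrow> R_periodic f"
    and diff: "\<And>f x v. f \<in> S \<Longrightarrow> (\<lambda>s. f (x + rscale s v)) differentiable (at 0)"
    and deriv: "\<And>f v. f \<in> S \<Longrightarrow> line_deriv v f \<in> S"
    and decay: "\<And>f N k. f \<in> S \<Longrightarrow> \<exists>C. \<forall>x\<in>polar_vecs N. coeff_norm x ^ k * norm (f x) \<le> C"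
  shows "S \<subseteq> schwartz_space"
proof
  fix f assume f: "f \<in> S"
  have dd: "dir_deriv vs f \<in> S" for vs by (induction vs) (auto simp: f deriv)
  have cont: "continuous_map (fd_topology W) euclidean h" if h: "h \<in> S" and W: "W \<subseteq> polar_vecs N" for h W N
  proof -
    have "\<exists>C. \<forall>x\<in>polar_vecs N. norm (line_deriv v h x) \<le> C" for v
      using decay[OF deriv[OF h], of N 0 v] by simp
    then obtain C where C: "\<And>v x. x \<in> polar_vecs N \<Longrightarrow> norm (line_deriv v h x) \<le> C v" by metis
    have "norm (line_deriv (unit_vec p) h x) \<le> (\<Sum>p\<in>polar_index N. \<bar>C (unit_vec p)\<bar>)"
      if "p \<in> polar_index N" "x \<in> polar_vecs N" for p x
    proof -
      have "norm (line_deriv (unit_vec p) h x) \<le> \<bar>C (unit_vec p)\<bar>" using C[OF that(2), of "unit_vec p"] by linarith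
      also have "\<dots> \<le> (\<Sum>p\<in>polar_index N. \<bar>C (unit_vec p)\<bar>)"
        by (rule member_le_sum[OF that(1), where f="\<lambda>p. \<bar>C (unit_vec p)\<bar>"]) auto
      finally show ?thesis .
    qed
    from lipschitz_of_bounded_line_derivs[OF diff[OF h] this]
    show ?thesis using W by (intro continuous_map_of_lipschitz[OF W]) blast
  qed
  show "f \<in> schwartz_space"
    unfolding schwartz_space_def
  proof (intro CollectI conjI)
    show "\<forall>x. \<forall>r\<in>R_vecs. f (x + r) = f x" using per[OF f] by (simp only: R_periodic_def)
    show "\<forall>W. W \<subseteq> Rminus_vecs \<and> fin_dim_subspace W \<longrightarrow> schwartz_on W f"
    proof (intro allI impI)
      fix W :: "'a Fvec set" assume W: "W \<subseteq> Rminus_vecs \<and> fin_dim_subspace W"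
      then obtain N where N: "W \<subseteq> polar_vecs N" using fin_dim_subset_polar by blast
      show "schwartz_on W f"
        unfolding schwartz_on_def
        using cont[OF dd N] diff[OF dd] decay[OF dd, of N] N by (meson subset_eq)
    qed
  qed
qed

lemma schwartz_line_deriv: "f \<in> schwartz_space \<Longrightarrow> line_deriv v f \<in> schwartz_space"
proof -
  let ?S = "{dir_deriv vs f | vs f. f \<in> schwartz_space}"
  have "?S \<subseteq> schwartz_space"
  proof (rule schwartz_coinduct)
    fix h v assume "h \<in> ?S"
    then obtain vs f where "f \<in> schwartz_space" "h = dir_deriv vs f" by blast
    then show "line_deriv v h \<in> ?S"
      by (intro CollectI exI[of _ "v # vs"] exI[of _ f]) simp
  next
    fix h assume "h \<in> ?S"
    then show "R_periodic h" using dir_deriv_periodic schwartz_periodic by blast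
  next
    fix h x v assume "h \<in> ?S"
    then show "(\<lambda>s. h (x + rscale s v)) differentiable (at 0)" using schwartz_dir_deriv_differentiable by blast
  next
    fix h N k assume "h \<in> ?S"
    then show "\<exists>C. \<forall>x\<in>polar_vecs N. coeff_norm x ^ k * norm (h x) \<le> C" using schwartz_dir_deriv_decay by blast
  qed
  moreover assume "f \<in> schwartz_space"
  then have "line_deriv v f \<in> ?S" by (intro CollectI exI[of _ "[v]"] exI[of _ f]) simp
  ultimately show ?thesis by blast
qed

lemma line_deriv_lincomb:
  assumes "f \<in> schwartz_space" "h \<in> schwartz_space"
  shows "line_deriv v (\<lambda>x. a * f x + b * h x) = (\<lambda>x. a * line_deriv v f x + b * line_deriv v h x)"
  using schwartz_line_differentiable[OF assms(1)] schwartz_line_differentiable[OF assms(2)]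
  by (intro ext vector_derivative_at has_vector_derivative_add has_vector_derivative_mult_right)
     (simp_all add: vector_derivative_works)

lemma schwartz_lincomb:
  fixes f h :: "('n::finite) Fvec \<Rightarrow> complex"
  assumes "f \<in> schwartz_space" "h \<in> schwartz_space"
  shows "(\<lambda>x. a * f x + b * h x) \<in> schwartz_space"
proof -
  let ?S = "{\<lambda>x :: 'n Fvec. a * f x + b * h x | f h. f \<in> schwartz_space \<and> h \<in> schwartz_space}"
  have "u \<in> schwartz_space" if "u \<in> ?S" for u
  proof (rule subsetD[OF schwartz_coinduct that])
    fix u assume "u \<in> ?S"
    then obtain f h where fh: "f \<in> schwartz_space" "h \<in> schwartz_space" "u = (\<lambda>x. a * f x + b * h x)"
      by blast
    show "R_periodic u"
      using fh schwartz_periodic[of f] schwartz_periodic[of h] by (simp add: R_periodic_def)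
    show "(\<lambda>s. u (x + rscale s v)) differentiable (at 0)" for x v
      unfolding fh(3) using fh(1,2)[THEN schwartz_line_differentiable]
      by (intro differentiable_add differentiable_mult differentiable_const)
    show "line_deriv v u \<in> ?S" for v
      using fh(1,2)[THEN schwartz_line_deriv]
      by (intro CollectI exI[of _ "line_deriv v f"] exI[of _ "line_deriv v h"])
         (simp add: fh(3) line_deriv_lincomb[OF fh(1,2)])
    fix N k
    obtain C where C: "\<forall>x\<in>polar_vecs N. coeff_norm x ^ k * norm (f x) \<le> C"
      using schwartz_decay[OF fh(1)] by blast
    obtain D where D: "\<forall>x\<in>polar_vecs N. coeff_norm x ^ k * norm (h x) \<le> D"
      using schwartz_decay[OF fh(2)] by blast
    have "coeff_norm x ^ k * norm (u x) \<le> norm a * C + norm b * D" if x: "x \<in> polar_vecs N" for x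
    proof -
      have "coeff_norm x ^ k * norm (u x) \<le> coeff_norm x ^ k * (norm a * norm (f x) + norm b * norm (h x))"
        unfolding fh(3) by (intro mult_left_mono norm_triangle_le) (simp_all add: norm_mult)
      also have "\<dots> = norm a * (coeff_norm x ^ k * norm (f x)) + norm b * (coeff_norm x ^ k * norm (h x))"
        by (simp add: algebra_simps)
      also have "\<dots> \<le> norm a * C + norm b * D"
        using C D x by (intro add_mono mult_left_mono) auto
      finally show ?thesis .
    qed
    then show "\<exists>C. \<forall>x\<in>polar_vecs N. coeff_norm x ^ k * norm (u x) \<le> C" by blast
  qed
  then show ?thesis using assms by blast
qed

lemma schwartz_add:
  "f \<in> schwartz_space \<Longrightarrow> h \<in> schwartz_space \<Longrightarrow> (\<lambda>x. f x + h x) \<in> schwartz_space"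
  using schwartz_lincomb[of f h 1 1] by simp

lemma schwartz_cmult: "f \<in> schwartz_space \<Longrightarrow> (\<lambda>x. c * f x) \<in> schwartz_space"
  using schwartz_lincomb[of f f c 0] by simp

lemma schwartz_zero: "(\<lambda>_. 0) \<in> schwartz_space"
proof -
  have "{\<lambda>_. 0} \<subseteq> schwartz_space"
    by (rule schwartz_coinduct) (auto simp: R_periodic_def)
  then show ?thesis by blast
qed

section \<open>The operators of the semigroup\<close>

lemma poly_bound:
  fixes r C :: real
  assumes "r \<ge> 0" "C \<ge> 0"
  shows "(1 + C * r) ^ k * r ^ j \<le> (1 + C) ^ k * (1 + r ^ (k + j))"
proof (cases "r \<le> 1")
  case True
  have "(1 + C * r) ^ k * r ^ j \<le> (1 + C) ^ k * 1"
    using assms True by (intro mult_mono power_mono power_le_one) (auto intro: mult_left_le)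
  also have "\<dots> \<le> (1 + C) ^ k * (1 + r ^ (k + j))" using assms by (intro mult_left_mono) auto
  finally show ?thesis .
next
  case False
  have "(1 + C * r) ^ k * r ^ j \<le> ((1 + C) * r) ^ k * r ^ j"
    using assms False by (intro mult_right_mono power_mono) (auto simp: algebra_simps)
  also have "\<dots> = (1 + C) ^ k * r ^ (k + j)" by (simp add: power_mult_distrib power_add)
  also have "\<dots> \<le> (1 + C) ^ k * (1 + r ^ (k + j))" using assms by (intro mult_left_mono) auto
  finally show ?thesis .
qed

text \<open>With w the class of \<open>g\<^sup>-\<^sup>1x + y\<close>, both x and y are bounded by a multiple of w, so the decay of f
at w of order \<open>k + j\<close> dominates both factors.\<close>

lemma schwartz_glue_bound:
  assumes f: "f \<in> schwartz_space" and g: "g \<in> matrices_R"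
  shows "\<exists>D. \<forall>x\<in>polar_vecs M. \<forall>y\<in>V_space g.
     coeff_norm x ^ j * norm (f (matrix_inv g *v x + y)) \<le> D * (1 / (1 + coeff_norm y) ^ k)"
proof -
  let ?t = "t_pow (int M) :: 'a Fmat"
  obtain C where C: "C > 0"
    "\<And>x y. x \<in> V_space ?t \<Longrightarrow> y \<in> V_space g \<Longrightarrow>
       coeff_norm x \<le> C * coeff_norm (glue g x y) \<and> coeff_norm y \<le> C * coeff_norm (glue g x y)"
    using glue_bounded_below[OF t_pow_matrices_R g] by blast
  obtain N where N: "V_space (?t ** g) \<subseteq> polar_vecs N"
    using V_space_subset_polar matrices_R_mult[OF t_pow_matrices_R g] by blast
  obtain A where A: "\<forall>x\<in>polar_vecs N. coeff_norm x ^ 0 * norm (f x) \<le> A" using schwartz_decay[OF f] by blast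
  obtain B where B: "\<forall>x\<in>polar_vecs N. coeff_norm x ^ (k + j) * norm (f x) \<le> B" using schwartz_decay[OF f] by blast
  have "coeff_norm x ^ j * norm (f (matrix_inv g *v x + y)) \<le> (C ^ j * ((1 + C) ^ k * (A + B))) * (1 / (1 + coeff_norm y) ^ k)"
    if x: "x \<in> polar_vecs M" and y: "y \<in> V_space g" for x y
  proof -
    define w where "w = glue g x y"
    have x': "x \<in> V_space ?t" using x by (simp add: polar_vecs_eq_V_space)
    have w: "w \<in> polar_vecs N" using glue_in_V_space[OF t_pow_matrices_R g x' y] N by (auto simp: w_def)
    have fw: "f (matrix_inv g *v x + y) = f w"
      unfolding w_def by (rule R_periodic_proj[OF schwartz_periodic[OF f], symmetric])
    let ?r = "coeff_norm w"
    have xy: "coeff_norm x \<le> C * ?r" "coeff_norm y \<le> C * ?r" using C(2)[OF x' y] by (simp_all add: w_def)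
    have "coeff_norm x ^ j * norm (f w) * (1 + coeff_norm y) ^ k \<le> (C * ?r) ^ j * norm (f w) * (1 + C * ?r) ^ k"
      using xy C(1) by (intro mult_mono power_mono) auto
    also have "\<dots> = C ^ j * ((1 + C * ?r) ^ k * ?r ^ j) * norm (f w)" by (simp add: power_mult_distrib)
    also have "\<dots> \<le> C ^ j * ((1 + C) ^ k * (1 + ?r ^ (k + j))) * norm (f w)"
      using C(1) poly_bound[of ?r C k j] by (intro mult_right_mono mult_left_mono) auto
    also have "\<dots> = C ^ j * ((1 + C) ^ k * (norm (f w) + ?r ^ (k + j) * norm (f w)))"
      by (simp add: algebra_simps)
    also have "\<dots> \<le> C ^ j * ((1 + C) ^ k * (A + B))"
      using A B w C(1) by (intro mult_left_mono add_mono) auto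
    finally have "coeff_norm x ^ j * norm (f w) * (1 + coeff_norm y) ^ k \<le> C ^ j * ((1 + C) ^ k * (A + B))" .
    moreover have "(1 + coeff_norm y) ^ k > 0" by (simp add: add_pos_nonneg)
    ultimately show ?thesis unfolding fw by (simp add: pos_le_divide_eq)
  qed
  then show ?thesis by blast
qed

lemma has_vector_derivative_at_0_iff:
  fixes F :: "real \<Rightarrow> 'a::real_normed_vector"
  shows "(F has_vector_derivative D) (at 0) \<longleftrightarrow> ((\<lambda>h. (1 / h) *\<^sub>R (F h - F 0)) \<longlongrightarrow> D) (at 0)"
proof -
  have "(F has_vector_derivative D) (at 0) \<longleftrightarrow> ((\<lambda>h. norm (F h - F 0 - h *\<^sub>R D) / norm h) \<longlongrightarrow> 0) (at 0)"
    by (simp add: has_vector_derivative_def has_derivative_at bounded_linear_scaleR_left)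
  also have "\<dots> \<longleftrightarrow> ((\<lambda>h. norm ((1 / h) *\<^sub>R (F h - F 0) - D)) \<longlongrightarrow> 0) (at 0)"
  proof (rule filterlim_cong)
    show "\<forall>\<^sub>F h in at 0. norm (F h - F 0 - h *\<^sub>R D) / norm h = norm ((1 / h) *\<^sub>R (F h - F 0) - D)"
    proof (rule eventually_at_topological[THEN iffD2], intro exI[of _ UNIV] conjI ballI impI)
      fix h :: real assume "h \<noteq> 0"
      then have "(1 / h) *\<^sub>R (F h - F 0) - D = (1 / h) *\<^sub>R (F h - F 0 - h *\<^sub>R D)"
        by (simp add: scaleR_diff_right)
      then show "norm (F h - F 0 - h *\<^sub>R D) / norm h = norm ((1 / h) *\<^sub>R (F h - F 0) - D)"
        by simp
    qed auto
  qed auto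
  also have "\<dots> \<longleftrightarrow> ((\<lambda>h. (1 / h) *\<^sub>R (F h - F 0)) \<longlongrightarrow> D) (at 0)"
    by (simp add: tendsto_norm_zero_iff LIM_zero_iff)
  finally show ?thesis .
qed

context
  fixes g :: "('n::finite) Fmat" and \<mu>
  assumes M: "(g, \<mu>) \<in> Mhat"
begin

lemma schwartz_translate_measurable:
  assumes f: "f \<in> schwartz_space" shows "(\<lambda>y. f (a + y)) \<in> borel_measurable \<mu>"
proof -
  have g: "g \<in> matrices_R" using M by (simp add: Mhat_iff)
  obtain N1 where N1: "V_space g \<subseteq> polar_vecs N1" using V_space_subset_polar[OF g] .
  obtain N2 where N2: "proj_minus a \<in> polar_vecs N2" using Rminus_in_polar[OF proj_minus_in_Rminus] .
  define N where "N = max N1 N2"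
  have sub: "V_space g \<subseteq> polar_vecs N" "proj_minus a \<in> polar_vecs N"
    using N1 N2 polar_vecs_mono[of N1 N] polar_vecs_mono[of N2 N] by (auto simp: N_def)
  have "(\<lambda>y. proj_minus a + y) \<in> fd_borel (V_space g) \<rightarrow>\<^sub>M fd_borel (polar_vecs N)"
    by (rule measurable_fd_add[where V="polar_vecs N" and W="V_space g"])
       (use sub polar_vecs_closed(2)[of _ N] in auto)
  from measurable_compose[OF this schwartz_measurable[OF f]]
  have "(\<lambda>y. f (proj_minus a + y)) \<in> borel_measurable \<mu>"
    by (simp cong: measurable_cong_sets add: Mhat_sets[OF M])
  moreover have "f (proj_minus a + y) = f (a + y)" for y
    by (rule R_periodic_cong[OF schwartz_periodic[OF f]]) (simp add: R_vecs_iff proj_minus_nth)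
  ultimately show ?thesis by simp
qed

text \<open>The bound is independent of x. It serves dominated convergence in difference quotients as well as
the decay of the integral.\<close>

lemma schwartz_dominated:
  assumes f: "f \<in> schwartz_space"
  obtains G where "integrable \<mu> G"
    "\<And>x y. x \<in> polar_vecs N \<Longrightarrow> y \<in> V_space g \<Longrightarrow> coeff_norm x ^ j * norm (f (matrix_inv g *v x + y)) \<le> G y"
proof -
  obtain K where "haar (V_space g) K \<mu>" using Mhat_haar[OF M] .
  then interpret haar "V_space g" K \<mu> .
  obtain k where k: "integrable \<mu> (\<lambda>y. 1 / (1 + coeff_norm y) ^ k)" using decay_integrable .
  obtain D where "\<forall>x\<in>polar_vecs N. \<forall>y\<in>V_space g.
     coeff_norm x ^ j * norm (f (matrix_inv g *v x + y)) \<le> D * (1 / (1 + coeff_norm y) ^ k)"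
    using schwartz_glue_bound[OF f, of g N j k] M by (auto simp: Mhat_iff)
  moreover have "integrable \<mu> (\<lambda>y. D * (1 / (1 + coeff_norm y) ^ k))"
    using k by (rule integrable_mult_right)
  ultimately show ?thesis by (intro that[of "\<lambda>y. D * (1 / (1 + coeff_norm y) ^ k)"]) blast+
qed

lemma pi_op_eq: "pi_op (g, \<mu>) f x = (\<integral>y. f (matrix_inv g *v x + y) \<partial>\<mu>)"
  by (simp add: pi_op_def)

text \<open>Moving x by an integral r moves \<open>g\<^sup>-\<^sup>1x\<close> by an element of \<open>V_g\<close>, up to integral vectors, and Haar
measure is invariant.\<close>

lemma pi_op_periodic:
  assumes f: "f \<in> schwartz_space" shows "R_periodic (pi_op (g, \<mu>) f)"
  unfolding R_periodic_def
proof (intro allI ballI)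
  fix x r assume r: "r \<in> (R_vecs :: 'n Fvec set)"
  obtain K where "haar (V_space g) K \<mu>" using Mhat_haar[OF M] .
  then interpret haar "V_space g" K \<mu> .
  define v where "v = proj_minus (matrix_inv g *v r)"
  have v: "v \<in> V_space g" using r unfolding v_def V_space_def by blast
  have "pi_op (g, \<mu>) f (x + r) = (\<integral>y. f (matrix_inv g *v x + (y + v)) \<partial>\<mu>)"
    unfolding pi_op_eq
  proof (intro Bochner_Integration.integral_cong HOL.refl R_periodic_cong[OF schwartz_periodic[OF f]])
    fix y
    have "matrix_inv g *v (x + r) + y - (matrix_inv g *v x + (y + v)) = matrix_inv g *v r - proj_minus (matrix_inv g *v r)"
      by (simp add: matrix_vector_right_distrib v_def)
    then show "matrix_inv g *v (x + r) + y - (matrix_inv g *v x + (y + v)) \<in> R_vecs" by simp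
  qed
  also have "\<dots> = pi_op (g, \<mu>) f x"
    unfolding pi_op_eq
    by (rule integral_translate[OF _ v])
       (use schwartz_translate_measurable[OF f] in \<open>simp cong: measurable_cong_sets\<close>)
  finally show "pi_op (g, \<mu>) f (x + r) = pi_op (g, \<mu>) f x" .
qed

lemma schwartz_integrable:
  assumes f: "f \<in> schwartz_space" shows "integrable \<mu> (\<lambda>y. f (matrix_inv g *v x + y))"
proof -
  have *: "integrable \<mu> (\<lambda>y. f (matrix_inv g *v x + y))" if x: "x \<in> Rminus_vecs" for x
  proof -
    obtain N where N: "x \<in> polar_vecs N" using Rminus_in_polar[OF x] .
    obtain G where G: "integrable \<mu> G"
      "\<And>x y. x \<in> polar_vecs N \<Longrightarrow> y \<in> V_space g \<Longrightarrow> coeff_norm x ^ 0 * norm (f (matrix_inv g *v x + y)) \<le> G y"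
      using schwartz_dominated[OF f] by blast
    show ?thesis
    proof (rule Bochner_Integration.integrable_bound[OF G(1) schwartz_translate_measurable[OF f]])
      show "AE y in \<mu>. norm (f (matrix_inv g *v x + y)) \<le> norm (G y)"
      proof (rule AE_I2)
        fix y assume "y \<in> space \<mu>"
        then have "y \<in> V_space g" by (simp add: Mhat_space[OF M])
        from G(2)[OF N this] show "norm (f (matrix_inv g *v x + y)) \<le> norm (G y)" by simp
      qed
    qed
  qed
  obtain K where "haar (V_space g) K \<mu>" using Mhat_haar[OF M] .
  then interpret haar "V_space g" K \<mu> .
  define v where "v = proj_minus (matrix_inv g *v (x - proj_minus x))"
  have v: "v \<in> V_space g" unfolding v_def V_space_def using diff_proj_minus_in_R by blast
  have "integrable (distr \<mu> \<mu> (\<lambda>y. y + v)) (\<lambda>y. f (matrix_inv g *v proj_minus x + y))"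
    unfolding distr_translate[OF v] by (rule *) simp
  then have "integrable \<mu> (\<lambda>y. f (matrix_inv g *v proj_minus x + (y + v)))"
    by (rule integrable_distr[rotated]) (use v in \<open>simp cong: measurable_cong_sets\<close>)
  moreover have "f (matrix_inv g *v proj_minus x + (y + v)) = f (matrix_inv g *v x + y)" for y
  proof (rule R_periodic_cong[OF schwartz_periodic[OF f], symmetric])
    have "matrix_inv g *v x + y - (matrix_inv g *v proj_minus x + (y + v)) =
        matrix_inv g *v (x - proj_minus x) - v"
      by (simp add: matrix_vector_mult_diff_distrib)
    then show "matrix_inv g *v x + y - (matrix_inv g *v proj_minus x + (y + v)) \<in> R_vecs"
      by (simp only: v_def diff_proj_minus_in_R)
  qed
  ultimately show ?thesis by simp
qed

text \<open>Differentiation under the integral sign. The mean value inequality bounds the difference quotients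
by the dominating function for the derivative.\<close>

lemma pi_op_line_derivative_polar:
  assumes f: "f \<in> schwartz_space" and x: "x \<in> polar_vecs N" and v: "v \<in> polar_vecs N"
  shows "((\<lambda>s. pi_op (g, \<mu>) f (x + rscale s v)) has_vector_derivative
      pi_op (g, \<mu>) (line_deriv (matrix_inv g *v v) f) x) (at 0)"
proof -
  let ?b = "matrix_inv g *v v" and ?a = "matrix_inv g *v x"
  define h where "h = line_deriv ?b f"
  have h: "h \<in> schwartz_space" unfolding h_def by (rule schwartz_line_deriv[OF f])
  obtain G where G: "integrable \<mu> G"
      "\<And>x y. x \<in> polar_vecs N \<Longrightarrow> y \<in> V_space g \<Longrightarrow> coeff_norm x ^ 0 * norm (h (matrix_inv g *v x + y)) \<le> G y"
    using schwartz_dominated[OF h] by blast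
  have shift: "matrix_inv g *v (x + rscale s v) + y = ?a + y + rscale s ?b" for s y
    by (simp add: matrix_vector_right_distrib vec.scale algebra_simps)
  have bound: "norm (f (?a + y + rscale s ?b) - f (?a + y)) \<le> G y * \<bar>s\<bar>" if y: "y \<in> V_space g" for s y
  proof (rule line_difference_bound[OF schwartz_line_differentiable[OF f]])
    fix s
    have "x + rscale s v \<in> polar_vecs N" using x v polar_vecs_closed by blast
    from G(2)[OF this y] show "norm (line_deriv ?b f (?a + y + rscale s ?b)) \<le> G y"
      by (simp add: shift h_def)
  qed
  show ?thesis
    unfolding has_vector_derivative_at_0_iff tendsto_at_iff_sequentially
  proof (intro allI impI)
    fix X :: "nat \<Rightarrow> real" assume X: "\<forall>i. X i \<in> UNIV - {0}" "X \<longlonglongrightarrow> 0"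
    let ?q = "\<lambda>i y. (1 / X i) *\<^sub>R (f (?a + y + rscale (X i) ?b) - f (?a + y))"
    have int: "integrable \<mu> (\<lambda>y. f (?a + y + rscale s ?b))" for s
      using schwartz_integrable[OF f, of "x + rscale s v"] by (simp only: shift)
    have "(\<lambda>i. integral\<^sup>L \<mu> (?q i)) \<longlonglongrightarrow> integral\<^sup>L \<mu> (\<lambda>y. h (?a + y))"
    proof (rule integral_dominated_convergence[of _ _ _ G])
      show "(\<lambda>y. h (?a + y)) \<in> borel_measurable \<mu>" by (rule schwartz_translate_measurable[OF h])
      show "?q i \<in> borel_measurable \<mu>" for i
        using int[of "X i"] int[of 0] by (intro borel_measurable_scaleR borel_measurable_diff) auto
      show "integrable \<mu> G" by (rule G(1))
      show "AE y in \<mu>. (\<lambda>i. ?q i y) \<longlonglongrightarrow> h (?a + y)"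
      proof (rule AE_I2)
        fix y
        have "((\<lambda>s. f (?a + y + rscale s ?b)) has_vector_derivative h (?a + y)) (at 0)"
          using line_has_vector_derivative[OF schwartz_line_differentiable[OF f], where v="?b" and x="?a + y" and s=0]
          by (simp add: h_def)
        then have "((\<lambda>s. (1 / s) *\<^sub>R (f (?a + y + rscale s ?b) - f (?a + y + rscale 0 ?b))) \<longlongrightarrow> h (?a + y)) (at 0)"
          by (simp only: has_vector_derivative_at_0_iff)
        then show "(\<lambda>i. ?q i y) \<longlonglongrightarrow> h (?a + y)"
          using X unfolding tendsto_at_iff_sequentially by (simp add: o_def)
      qed
      show "AE y in \<mu>. norm (?q i y) \<le> G y" for i
      proof (rule AE_I2)
        fix y assume "y \<in> space \<mu>"
        then have "y \<in> V_space g" by (simp add: Mhat_space[OF M])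
        from bound[OF this, of "X i"]
        have "norm (f (?a + y + rscale (X i) ?b) - f (?a + y)) / \<bar>X i\<bar> \<le> G y"
          using X(1)[rule_format, of i] by (subst pos_divide_le_eq) auto
        then show "norm (?q i y) \<le> G y" by (simp only: norm_scaleR) simp
      qed
    qed
    moreover have "integral\<^sup>L \<mu> (?q i) =
      (1 / X i) *\<^sub>R (pi_op (g, \<mu>) f (x + rscale (X i) v) - pi_op (g, \<mu>) f (x + rscale 0 v))" for i
    proof -
      have "integral\<^sup>L \<mu> (?q i) = (1 / X i) *\<^sub>R ((\<integral>y. f (?a + y + rscale (X i) ?b) \<partial>\<mu>) - (\<integral>y. f (?a + y + rscale 0 ?b) \<partial>\<mu>))"
        using int[of "X i"] int[of 0] by simp
      then show ?thesis by (simp only: pi_op_eq shift)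
    qed
    ultimately show "((\<lambda>s. (1 / s) *\<^sub>R (pi_op (g, \<mu>) f (x + rscale s v) - pi_op (g, \<mu>) f (x + rscale 0 v))) \<circ> X)
        \<longlonglongrightarrow> pi_op (g, \<mu>) (line_deriv ?b f) x"
      by (simp only: o_def pi_op_eq[of "line_deriv ?b f"] h_def)
  qed
qed

text \<open>Periodicity reduces the claim to polar x and v. The direction contains the polar part of v because
the derivative of f along \<open>g\<^sup>-\<^sup>1v\<close> may change when v changes by an integral vector.\<close>

lemma pi_op_line_derivative:
  assumes f: "f \<in> schwartz_space"
  shows "((\<lambda>s. pi_op (g, \<mu>) f (x + rscale s v)) has_vector_derivative
      pi_op (g, \<mu>) (line_deriv (matrix_inv g *v proj_minus v) f) x) (at 0)"
proof -
  obtain N where N: "proj_minus x \<in> polar_vecs N" "proj_minus v \<in> polar_vecs N"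
    using Rminus_common_polar[OF proj_minus_in_Rminus proj_minus_in_Rminus] .
  have "pi_op (g, \<mu>) f (proj_minus x + rscale s (proj_minus v)) = pi_op (g, \<mu>) f (x + rscale s v)" for s
    by (rule R_periodic_cong[OF pi_op_periodic[OF f]]) (simp add: R_vecs_iff proj_minus_nth)
  then show ?thesis
    using pi_op_line_derivative_polar[OF f N]
    by (simp only: R_periodic_proj[OF pi_op_periodic[OF schwartz_line_deriv[OF f]]])
qed

lemma pi_op_schwartz:
  assumes "f \<in> schwartz_space" shows "pi_op (g, \<mu>) f \<in> schwartz_space"
proof -
  have "pi_op (g, \<mu>) ` schwartz_space \<subseteq> schwartz_space"
  proof (rule schwartz_coinduct)
    fix u assume "u \<in> pi_op (g, \<mu>) ` schwartz_space"
    then obtain f where "f \<in> schwartz_space" "u = pi_op (g, \<mu>) f" by blast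
    then show "R_periodic u" by (simp only: pi_op_periodic)
  next
    fix u x v assume "u \<in> pi_op (g, \<mu>) ` schwartz_space"
    then obtain f where f: "f \<in> schwartz_space" "u = pi_op (g, \<mu>) f" by blast
    show "(\<lambda>s. u (x + rscale s v)) differentiable (at 0)"
      unfolding f(2) by (rule differentiableI_vector[OF pi_op_line_derivative[OF f(1)]])
  next
    fix u v assume "u \<in> pi_op (g, \<mu>) ` schwartz_space"
    then obtain f where f: "f \<in> schwartz_space" "u = pi_op (g, \<mu>) f" by blast
    have "line_deriv v u = pi_op (g, \<mu>) (line_deriv (matrix_inv g *v proj_minus v) f)"
      unfolding f(2) by (intro ext vector_derivative_at pi_op_line_derivative[OF f(1)])
    then show "line_deriv v u \<in> pi_op (g, \<mu>) ` schwartz_space"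
      using schwartz_line_deriv[OF f(1)] by (rule image_eqI)
  next
    fix u N k assume "u \<in> pi_op (g, \<mu>) ` schwartz_space"
    then obtain f where f: "f \<in> schwartz_space" "u = pi_op (g, \<mu>) f" by blast
    obtain G where G: "integrable \<mu> G"
      "\<And>x y. x \<in> polar_vecs N \<Longrightarrow> y \<in> V_space g \<Longrightarrow> coeff_norm x ^ k * norm (f (matrix_inv g *v x + y)) \<le> G y"
      using schwartz_dominated[OF f(1)] by blast
    have "coeff_norm x ^ k * norm (u x) \<le> integral\<^sup>L \<mu> G" if x: "x \<in> polar_vecs N" for x
    proof -
      note int = schwartz_integrable[OF f(1), of x]
      have "coeff_norm x ^ k * norm (u x) \<le> coeff_norm x ^ k * (\<integral>y. norm (f (matrix_inv g *v x + y)) \<partial>\<mu>)"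
        unfolding f(2) pi_op_eq by (intro mult_left_mono integral_norm_bound) simp
      also have "\<dots> = (\<integral>y. coeff_norm x ^ k * norm (f (matrix_inv g *v x + y)) \<partial>\<mu>)" by simp
      also have "\<dots> \<le> integral\<^sup>L \<mu> G"
        using int G x by (intro integral_mono) (auto simp: Mhat_space[OF M])
      finally show ?thesis .
    qed
    then show "\<exists>C. \<forall>x\<in>polar_vecs N. coeff_norm x ^ k * norm (u x) \<le> C" by blast
  qed
  then show ?thesis using assms by blast
qed

lemma pi_op_add:
  assumes "f \<in> schwartz_space" "h \<in> schwartz_space"
  shows "pi_op (g, \<mu>) (\<lambda>x. f x + h x) = (\<lambda>x. pi_op (g, \<mu>) f x + pi_op (g, \<mu>) h x)"
  using schwartz_integrable[OF assms(1)] schwartz_integrable[OF assms(2)] by (simp add: pi_op_eq fun_eq_iff)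

end

text \<open>Fubini for the gluing map; taking polar parts is harmless because f is periodic.\<close>

lemma pi_op_mult:
  assumes \<alpha>: "\<alpha> \<in> Mhat" and \<beta>: "\<beta> \<in> Mhat" and f: "f \<in> schwartz_space"
  shows "pi_op (Mhat_mult \<alpha> \<beta>) f = pi_op \<alpha> (pi_op \<beta> f)"
proof
  fix x
  obtain g1 \<mu>1 g2 \<mu>2 where [simp]: "\<alpha> = (g1, \<mu>1)" "\<beta> = (g2, \<mu>2)" by (cases \<alpha>; cases \<beta>)
  have M1: "(g1, \<mu>1) \<in> Mhat" and M2: "(g2, \<mu>2) \<in> Mhat" using \<alpha> \<beta> by simp_all
  have d: "det g1 \<noteq> 0" "det g2 \<noteq> 0" using M1 M2 by (auto simp: Mhat_iff matrices_R_iff)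
  interpret s1: sigma_finite_measure \<mu>1 by (rule Mhat_sigma_finite[OF M1])
  interpret s2: sigma_finite_measure \<mu>2 by (rule Mhat_sigma_finite[OF M2])
  interpret pair_sigma_finite \<mu>1 \<mu>2 ..
  let ?a = "matrix_inv (g1 ** g2) *v x"
  let ?F = "\<lambda>w. f (?a + w)"
  let ?\<nu> = "conv_measure g1 \<mu>1 g2 \<mu>2"
  have int: "integrable ?\<nu> ?F" by (rule schwartz_integrable[OF Mhat_conv[OF M1 M2] f])
  have meas: "?F \<in> borel_measurable (fd_borel (V_space (g1 ** g2)))"
    using schwartz_translate_measurable[OF Mhat_conv[OF M1 M2] f]
    by (simp add: sets_conv_measure[OF M1 M2] cong: measurable_cong_sets)
  note gl = glue_measurable'[OF M1 M2]
  have int2: "integrable (\<mu>1 \<Otimes>\<^sub>M \<mu>2) (\<lambda>p. ?F (case p of (y, z) \<Rightarrow> glue g2 y z))"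
    using int unfolding conv_measure_eq_distr[OF M1 M2] by (rule integrable_distr[OF gl])
  have "pi_op (Mhat_mult \<alpha> \<beta>) f x = integral\<^sup>L ?\<nu> ?F"
    by (simp add: Mhat_mult_def pi_op_def)
  also have "\<dots> = integral\<^sup>L (\<mu>1 \<Otimes>\<^sub>M \<mu>2) (\<lambda>p. ?F (case p of (y, z) \<Rightarrow> glue g2 y z))"
    unfolding conv_measure_eq_distr[OF M1 M2] by (rule integral_distr[OF gl meas])
  also have "\<dots> = (\<integral>y. (\<integral>z. ?F (glue g2 y z) \<partial>\<mu>2) \<partial>\<mu>1)"
    using integral_fst'[OF int2] by simp
  also have "\<dots> = (\<integral>y. (\<integral>z. f (matrix_inv g2 *v (matrix_inv g1 *v x + y) + z) \<partial>\<mu>2) \<partial>\<mu>1)"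
  proof (intro Bochner_Integration.integral_cong HOL.refl R_periodic_cong[OF schwartz_periodic[OF f]])
    fix y z
    have "?a = matrix_inv g2 *v (matrix_inv g1 *v x)"
      using d by (simp add: matrix_inv_mult matrix_vector_mul_assoc)
    then have "?a + glue g2 y z - (matrix_inv g2 *v (matrix_inv g1 *v x + y) + z) = 0 - (matrix_inv g2 *v y + z - glue g2 y z)"
      by (simp only: matrix_vector_right_distrib) simp
    then show "?a + glue g2 y z - (matrix_inv g2 *v (matrix_inv g1 *v x + y) + z) \<in> R_vecs"
      by (simp only: R_vecs_closed(1,3) diff_proj_minus_in_R)
  qed
  also have "\<dots> = pi_op \<alpha> (pi_op \<beta> f) x" by (simp add: pi_op_def)
  finally show "pi_op (Mhat_mult \<alpha> \<beta>) f x = pi_op \<alpha> (pi_op \<beta> f) x" .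
qed

lemma pi_op_t_lift_0: "pi_op (t_lift 0) f = f"
proof
  fix x
  have V: "polar_vecs 0 = {0 :: 'a Fvec}" using V_space_1 by (simp add: polar_vecs_eq_V_space)
  have sp: "space (mu_st 0 :: 'a Fvec measure) = {0}" by (simp add: mu_st_eq V)
  have "unit_cube 0 = {0 :: 'a Fvec}" by (auto simp: unit_cube_def V)
  then have "measure (mu_st 0) {0 :: 'a Fvec} = 1"
    using emeasure_mu_st_unit_cube[where 'n='a and l=0] by (simp add: measure_def)
  moreover have "pi_op (t_lift 0) f x = (\<integral>y. f x \<partial>(mu_st 0 :: 'a Fvec measure))"
    unfolding t_lift_0 pi_op_def prod.case
    by (intro Bochner_Integration.integral_cong HOL.refl) (simp add: sp matrix_inv_mat_1)
  ultimately show "pi_op (t_lift 0) f x = f x" by (simp add: sp)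
qed

section \<open>The central extensions as groups\<close>

lemma GL0_iff: "g \<in> GL0 \<longleftrightarrow> det g \<noteq> 0 \<and> fls_nth (det g) (fls_subdegree (det g)) \<in> {1, -1}"
  by (simp add: GL0_def invertible_det_nz)

lemma GL0_mult: "g \<in> GL0 \<Longrightarrow> h \<in> GL0 \<Longrightarrow> g ** h \<in> GL0"
  unfolding GL0_iff det_mul by auto

lemma t_pow_GL0: "t_pow k \<in> GL0"
  unfolding GL0_iff det_t_pow by simp

lemma GL0_cancel:
  assumes "h ** g \<in> GL0" "g \<in> GL0" shows "h \<in> GL0"
  using assms unfolding GL0_iff det_mul by auto

lemma Mhat0_iff: "\<alpha> \<in> Mhat0 \<longleftrightarrow> \<alpha> \<in> Mhat \<and> fst \<alpha> \<in> GL0"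
  by (cases \<alpha>) (simp add: Mhat0_def)

lemma Mhat0_mult: "\<alpha> \<in> Mhat0 \<Longrightarrow> \<beta> \<in> Mhat0 \<Longrightarrow> Mhat_mult \<alpha> \<beta> \<in> Mhat0"
  by (simp add: Mhat0_iff Mhat_mult_closed GL0_mult)

lemma t_lift_Mhat0: "t_lift l \<in> Mhat0"
  using t_pow_GL0 by (simp add: Mhat0_iff) (simp add: t_lift_def)

text \<open>Inverses up to a power of t: choose h with \<open>h g = t^m\<close> and rescale a Haar measure on \<open>V_h\<close>.\<close>

lemma Mhat0_inverse:
  assumes "\<alpha> \<in> Mhat0" obtains \<beta> m where "\<beta> \<in> Mhat0" "Mhat_mult \<beta> \<alpha> = t_lift m"
proof -
  obtain g \<mu> where \<alpha>: "\<alpha> = (g, \<mu>)" "(g, \<mu>) \<in> Mhat" "g \<in> GL0"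
    using assms by (cases \<alpha>) (auto simp: Mhat0_iff)
  then have "g \<in> matrices_R" by (simp add: Mhat_iff)
  then obtain m h where h: "h \<in> matrices_R" "h ** g = t_pow (int m)" using matrices_R_complement by blast
  obtain \<nu> where \<nu>: "(h, \<nu>) \<in> Mhat" using haar_measure_exists[OF h(1)] .
  have "(t_pow (int m), conv_measure h \<nu> g \<mu>) \<in> Mhat" using Mhat_conv[OF \<nu> \<alpha>(2)] unfolding h(2) .
  then obtain c where c: "c > 0" "(t_pow (int m), conv_measure h \<nu> g \<mu>) = Mhat_scale c (t_pow (int m), mu_st m)"
    using Mhat_unique[OF _ Mhat_mu_st] by blast
  have eq: "Mhat_mult (h, \<nu>) \<alpha> = Mhat_scale c (t_lift m)"
    using c(2) by (simp only: \<alpha>(1) Mhat_mult_def prod.case h(2) t_lift_def)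
  have "Mhat_mult (Mhat_scale (1 / c) (h, \<nu>)) \<alpha> = Mhat_scale (1 / c) (Mhat_scale c (t_lift m))"
    using c(1) \<nu> \<alpha> by (simp add: Mhat_mult_scale_left flip: eq)
  also have "\<dots> = t_lift m" using c(1) by (simp add: Mhat_scale_scale)
  finally have "Mhat_mult (Mhat_scale (1 / c) (h, \<nu>)) \<alpha> = t_lift m" .
  moreover have "Mhat_scale (1 / c) (h, \<nu>) \<in> Mhat0"
    unfolding Mhat0_iff
  proof
    show "Mhat_scale (1 / c) (h, \<nu>) \<in> Mhat" using c(1) \<nu> by (intro Mhat_scale_closed) auto
    have "h \<in> GL0" using GL0_cancel[of h g] t_pow_GL0 \<alpha>(3) unfolding h(2) by blast
    then show "fst (Mhat_scale (1 / c) (h, \<nu>)) \<in> GL0" by (simp add: Mhat_scale_def)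
  qed
  ultimately show ?thesis using that by blast
qed

lemma Gtilde_iff: "p \<in> Gtilde \<longleftrightarrow> snd p \<in> Mhat0"
  by (cases p) (simp add: Gtilde_def)

lemma Gtilde_mult_eq: "Gtilde_mult p q = (fst p + fst q, Mhat_mult (snd p) (snd q))"
  by (cases p; cases q) (simp add: Gtilde_mult_def)

lemma Gtilde_mult_closed: "p \<in> Gtilde \<Longrightarrow> q \<in> Gtilde \<Longrightarrow> Gtilde_mult p q \<in> Gtilde"
  by (simp add: Gtilde_iff Gtilde_mult_eq Mhat0_mult)

lemma Gtilde_mult_assoc:
  "p \<in> Gtilde \<Longrightarrow> q \<in> Gtilde \<Longrightarrow> r \<in> Gtilde \<Longrightarrow>
     Gtilde_mult (Gtilde_mult p q) r = Gtilde_mult p (Gtilde_mult q r)"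
  by (simp add: Gtilde_iff Gtilde_mult_eq Mhat0_iff Mhat_mult_assoc)

lemma Gtilde_equiv_shift:
  "\<alpha> \<in> Mhat0 \<Longrightarrow> Gtilde_equiv (k + int l, \<alpha>) (k, Mhat_mult (t_lift l) \<alpha>)"
  unfolding t_lift_def by (rule Gtilde_equiv.shift)

text \<open>Rule induction with the distinguished lifts in place of their definition.\<close>

lemma Gtilde_equiv_induct [consumes 1, case_names shift refl sym trans]:
  assumes "Gtilde_equiv p q"
    and "\<And>k l \<alpha>. \<alpha> \<in> Mhat0 \<Longrightarrow> P (k + int l, \<alpha>) (k, Mhat_mult (t_lift l) \<alpha>)"
    and "\<And>p. p \<in> Gtilde \<Longrightarrow> P p p" and "\<And>p q. P p q \<Longrightarrow> P q p"
    and "\<And>p q r. P p q \<Longrightarrow> P q r \<Longrightarrow> P p r"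
  shows "P p q"
  using assms(1)
proof (induction rule: Gtilde_equiv.induct)
  case (shift \<alpha> k l)
  then show ?case using assms(2)[of \<alpha> k l] by (simp only: t_lift_def)
qed (use assms(3-5) in blast)+

lemma Gtilde_equiv_in: "Gtilde_equiv p q \<Longrightarrow> p \<in> Gtilde \<and> q \<in> Gtilde"
  by (induction rule: Gtilde_equiv_induct) (auto simp: Gtilde_iff Mhat0_mult t_lift_Mhat0)

lemma Gtilde_equiv_mult_right:
  assumes "Gtilde_equiv p q" and r: "r \<in> Gtilde"
  shows "Gtilde_equiv (Gtilde_mult p r) (Gtilde_mult q r)"
  using assms(1)
proof (induction rule: Gtilde_equiv_induct)
  case (shift k l \<alpha>)
  have "Mhat_mult \<alpha> (snd r) \<in> Mhat0" using shift r by (simp add: Gtilde_iff Mhat0_mult)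
  from Gtilde_equiv_shift[OF this, of "k + fst r" l] show ?case
    using shift r by (simp add: Gtilde_mult_eq Mhat_mult_assoc Mhat0_iff Gtilde_iff add_ac)
next
  case (refl p)
  then show ?case using r by (intro Gtilde_equiv.refl Gtilde_mult_closed)
qed (rule Gtilde_equiv.sym Gtilde_equiv.trans; assumption)+

text \<open>Moving \<open>T_l\<close> past the left factor is where centrality enters; on the other side associativity is
enough.\<close>

lemma Gtilde_equiv_mult_left:
  assumes "Gtilde_equiv p q" and r: "r \<in> Gtilde"
  shows "Gtilde_equiv (Gtilde_mult r p) (Gtilde_mult r q)"
  using assms(1)
proof (induction rule: Gtilde_equiv_induct)
  case (shift k l \<alpha>)
  have r0: "snd r \<in> Mhat0" using r by (simp add: Gtilde_iff)
  have "Mhat_mult (t_lift l) (Mhat_mult (snd r) \<alpha>) = Mhat_mult (Mhat_mult (snd r) (t_lift l)) \<alpha>"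
    using shift r0 by (simp add: Mhat0_iff Mhat_mult_assoc[symmetric] t_lift_central[OF r0])
  also have "\<dots> = Mhat_mult (snd r) (Mhat_mult (t_lift l) \<alpha>)"
    using shift r0 by (simp add: Mhat0_iff Mhat_mult_assoc)
  finally have eq: "Mhat_mult (t_lift l) (Mhat_mult (snd r) \<alpha>) = Mhat_mult (snd r) (Mhat_mult (t_lift l) \<alpha>)" .
  have "Mhat_mult (snd r) \<alpha> \<in> Mhat0" using shift r0 by (simp add: Mhat0_mult)
  from Gtilde_equiv_shift[OF this, of "fst r + k" l] show ?case
    by (simp add: Gtilde_mult_eq eq add_ac)
next
  case (refl p)
  then show ?case using r by (intro Gtilde_equiv.refl Gtilde_mult_closed)
qed (rule Gtilde_equiv.sym Gtilde_equiv.trans; assumption)+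

lemma in_Gtilde_class: "q \<in> Gtilde_class p \<longleftrightarrow> Gtilde_equiv p q"
  by (simp add: Gtilde_class_def Gtilde_rel_def)

lemma Gtilde_class_self: "p \<in> Gtilde \<Longrightarrow> p \<in> Gtilde_class p"
  by (simp add: in_Gtilde_class Gtilde_equiv.refl)

lemma Gtilde_class_eqI: "Gtilde_equiv p q \<Longrightarrow> Gtilde_class p = Gtilde_class q"
  unfolding set_eq_iff in_Gtilde_class by (meson Gtilde_equiv.sym Gtilde_equiv.trans)

lemma carrier_GLhat: "carrier GLhat = Gtilde_class ` Gtilde"
  by (auto simp: GLhat_def quotient_def Gtilde_class_def)

text \<open>All the classes in the union coincide, since multiplication respects the equivalence.\<close>

lemma GLhat_mult_class:
  assumes p: "p \<in> Gtilde" and q: "q \<in> Gtilde"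
  shows "Gtilde_class p \<otimes>\<^bsub>GLhat\<^esub> Gtilde_class q = Gtilde_class (Gtilde_mult p q)"
proof -
  have "Gtilde_class (Gtilde_mult p' q') = Gtilde_class (Gtilde_mult p q)"
    if "p' \<in> Gtilde_class p" "q' \<in> Gtilde_class q" for p' q'
  proof -
    have pq: "Gtilde_equiv p p'" "Gtilde_equiv q q'" using that by (simp_all add: in_Gtilde_class)
    have "Gtilde_equiv (Gtilde_mult p q) (Gtilde_mult p' q)" by (rule Gtilde_equiv_mult_right[OF pq(1) q])
    moreover have "Gtilde_equiv (Gtilde_mult p' q) (Gtilde_mult p' q')"
      using Gtilde_equiv_in[OF pq(1)] by (intro Gtilde_equiv_mult_left[OF pq(2)]) simp
    ultimately show ?thesis by (intro Gtilde_class_eqI[symmetric]) (rule Gtilde_equiv.trans)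
  qed
  then have "(\<Union>p'\<in>Gtilde_class p. \<Union>q'\<in>Gtilde_class q. Gtilde_class (Gtilde_mult p' q')) =
    (\<Union>p'\<in>Gtilde_class p. \<Union>q'\<in>Gtilde_class q. Gtilde_class (Gtilde_mult p q))" by simp
  also have "\<dots> = Gtilde_class (Gtilde_mult p q)"
    using Gtilde_class_self[OF p] Gtilde_class_self[OF q] by blast
  finally show ?thesis by (simp add: GLhat_def)
qed

lemma one_GLhat: "\<one>\<^bsub>GLhat\<^esub> = Gtilde_class (0, t_lift 0)"
  by (simp add: GLhat_def t_lift_0)

lemma one_in_Gtilde: "(0, t_lift 0) \<in> Gtilde"
  by (simp add: Gtilde_iff t_lift_Mhat0)

text \<open>The class of \<open>(t^k, \<alpha>)\<close> is inverted by the class of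
\<open>(t^(-k-m), \<beta>)\<close> with \<open>\<beta> \<alpha> = T_m\<close>, because \<open>(t^(-m), T_m)\<close> is equivalent to the unit.\<close>

lemma group_GLhat: "group GLhat"
proof (rule groupI)
  fix X Y :: "'a gtilde set" assume "X \<in> carrier GLhat" "Y \<in> carrier GLhat"
  then show "X \<otimes>\<^bsub>GLhat\<^esub> Y \<in> carrier GLhat"
    by (auto simp: carrier_GLhat GLhat_mult_class Gtilde_mult_closed)
next
  show "\<one>\<^bsub>GLhat\<^esub> \<in> carrier (GLhat :: 'a gtilde set monoid)"
    unfolding one_GLhat carrier_GLhat by (rule imageI[OF one_in_Gtilde])
next
  fix X Y Z :: "'a gtilde set" assume "X \<in> carrier GLhat" "Y \<in> carrier GLhat" "Z \<in> carrier GLhat"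
  then show "X \<otimes>\<^bsub>GLhat\<^esub> Y \<otimes>\<^bsub>GLhat\<^esub> Z = X \<otimes>\<^bsub>GLhat\<^esub> (Y \<otimes>\<^bsub>GLhat\<^esub> Z)"
    by (auto simp: carrier_GLhat GLhat_mult_class Gtilde_mult_closed Gtilde_mult_assoc)
next
  fix X :: "'a gtilde set" assume "X \<in> carrier GLhat"
  then obtain p where p: "p \<in> Gtilde" "X = Gtilde_class p" by (auto simp: carrier_GLhat)
  then have "Gtilde_mult (0, t_lift 0) p = p"
    by (cases p) (simp add: Gtilde_mult_eq Gtilde_iff Mhat0_iff Mhat_mult_1_left)
  then show "\<one>\<^bsub>GLhat\<^esub> \<otimes>\<^bsub>GLhat\<^esub> X = X"
    by (simp add: p one_GLhat GLhat_mult_class one_in_Gtilde)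
next
  fix X :: "'a gtilde set" assume "X \<in> carrier GLhat"
  then obtain k \<alpha> where p: "(k, \<alpha>) \<in> Gtilde" "X = Gtilde_class (k, \<alpha>)" by (auto simp: carrier_GLhat)
  then have "\<alpha> \<in> Mhat0" by (simp add: Gtilde_iff)
  then obtain \<beta> m where \<beta>: "\<beta> \<in> Mhat0" "Mhat_mult \<beta> \<alpha> = t_lift m" using Mhat0_inverse by blast
  let ?q = "(- k - int m, \<beta>)"
  have q: "?q \<in> Gtilde" using \<beta> by (simp add: Gtilde_iff)
  have "Gtilde_equiv (- int m + int m, t_lift 0) (- int m, Mhat_mult (t_lift m) (t_lift 0))"
    by (rule Gtilde_equiv_shift[OF t_lift_Mhat0])
  then have "Gtilde_class (Gtilde_mult ?q (k, \<alpha>)) = \<one>\<^bsub>GLhat\<^esub>"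
    unfolding one_GLhat by (intro Gtilde_class_eqI[symmetric]) (simp add: Gtilde_mult_eq \<beta> t_lift_mult)
  then have "Gtilde_class ?q \<otimes>\<^bsub>GLhat\<^esub> X = \<one>\<^bsub>GLhat\<^esub>"
    by (simp only: p(2) GLhat_mult_class[OF q p(1)])
  then show "\<exists>Y\<in>carrier GLhat. Y \<otimes>\<^bsub>GLhat\<^esub> X = \<one>\<^bsub>GLhat\<^esub>"
    using q by (auto simp: carrier_GLhat)
qed

lemma Gtilde_equiv_proj:
  "Gtilde_equiv p q \<Longrightarrow> t_pow (fst p) ** fst (snd p) = t_pow (fst q) ** fst (snd q)"
proof (induction rule: Gtilde_equiv_induct)
  case (shift k l \<alpha>)
  have "t_pow (k + int l) ** fst \<alpha> = t_pow k ** (t_pow (int l) ** fst \<alpha>)"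
    by (simp only: matrix_mul_assoc t_pow_mult)
  then show ?case by (simp only: fst_conv snd_conv fst_Mhat_mult t_lift_def)
qed simp_all

lemma GLhat_proj_class:
  assumes "p \<in> Gtilde" shows "GLhat_proj (Gtilde_class p) = t_pow (fst p) ** fst (snd p)"
proof -
  have "(\<lambda>(k, (g, \<mu>)). t_pow k ** g) ` Gtilde_class p = {t_pow (fst p) ** fst (snd p)}"
  proof -
    have "(\<lambda>(k, (g, \<mu>)). t_pow k ** g) q = t_pow (fst p) ** fst (snd p)" if "q \<in> Gtilde_class p" for q
      using Gtilde_equiv_proj[of p q] that by (simp add: in_Gtilde_class split_beta)
    then have "(\<lambda>(k, (g, \<mu>)). t_pow k ** g) ` Gtilde_class p = (\<lambda>_. t_pow (fst p) ** fst (snd p)) ` Gtilde_class p"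
      by (rule image_cong[OF HOL.refl])
    also have "\<dots> = {t_pow (fst p) ** fst (snd p)}"
      using Gtilde_class_self[OF assms] by (subst image_constant_conv) auto
    finally show ?thesis .
  qed
  then show ?thesis by (simp only: GLhat_proj_def the_elem_eq)
qed

lemma GLhat_proj_mult:
  assumes "X \<in> carrier GLhat" "Y \<in> carrier GLhat"
  shows "GLhat_proj (X \<otimes>\<^bsub>GLhat\<^esub> Y) = GLhat_proj X ** GLhat_proj Y"
proof -
  obtain p q where pq: "p \<in> Gtilde" "q \<in> Gtilde" "X = Gtilde_class p" "Y = Gtilde_class q"
    using assms by (auto simp: carrier_GLhat)
  have "t_pow (fst p + fst q) ** (fst (snd p) ** fst (snd q)) =
      t_pow (fst p) ** ((t_pow (fst q) ** fst (snd p)) ** fst (snd q))"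
    by (simp only: matrix_mul_assoc t_pow_mult)
  also have "\<dots> = t_pow (fst p) ** ((fst (snd p) ** t_pow (fst q)) ** fst (snd q))"
    by (simp only: mat_commute[of _ "fst (snd p)"])
  also have "\<dots> = (t_pow (fst p) ** fst (snd p)) ** (t_pow (fst q) ** fst (snd q))"
    by (simp only: matrix_mul_assoc)
  finally have eq: "t_pow (fst p + fst q) ** (fst (snd p) ** fst (snd q)) =
      (t_pow (fst p) ** fst (snd p)) ** (t_pow (fst q) ** fst (snd q))" .
  have "GLhat_proj (X \<otimes>\<^bsub>GLhat\<^esub> Y) = t_pow (fst (Gtilde_mult p q)) ** fst (snd (Gtilde_mult p q))"
    by (simp only: pq GLhat_mult_class GLhat_proj_class Gtilde_mult_closed)
  then show ?thesis
    by (simp only: pq GLhat_proj_class Gtilde_mult_eq fst_conv snd_conv fst_Mhat_mult eq)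
qed

lemma GLhat_proj_one: "GLhat_proj \<one>\<^bsub>GLhat\<^esub> = mat 1"
  unfolding one_GLhat GLhat_proj_class[OF one_in_Gtilde] by (simp add: t_lift_def)

lemma subgroup_SLhat: "subgroup {X \<in> carrier GLhat. det (GLhat_proj X) = 1} GLhat"
proof -
  interpret group "GLhat :: 'a gtilde set monoid" by (rule group_GLhat)
  show ?thesis
  proof (rule subgroupI)
    show "{X \<in> carrier GLhat. det (GLhat_proj X) = 1} \<noteq> ({} :: 'a gtilde set set)"
      using one_closed GLhat_proj_one[where 'a='a] by (metis (mono_tags, lifting) det_I empty_iff mem_Collect_eq)
    fix X :: "'a gtilde set" assume X: "X \<in> {X \<in> carrier GLhat. det (GLhat_proj X) = 1}"
    then have XG: "X \<in> carrier GLhat" by simp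
    have "det (GLhat_proj (inv\<^bsub>GLhat\<^esub> X)) * det (GLhat_proj X) = det (GLhat_proj (inv\<^bsub>GLhat\<^esub> X \<otimes>\<^bsub>GLhat\<^esub> X))"
      using XG by (simp only: GLhat_proj_mult inv_closed det_mul)
    also have "\<dots> = 1" using XG by (simp only: l_inv GLhat_proj_one det_I)
    finally have "det (GLhat_proj (inv\<^bsub>GLhat\<^esub> X)) * det (GLhat_proj X) = 1" .
    then show "inv\<^bsub>GLhat\<^esub> X \<in> {X \<in> carrier GLhat. det (GLhat_proj X) = 1}" using X by simp
  next
    fix X Y :: "'a gtilde set"
    assume "X \<in> {X \<in> carrier GLhat. det (GLhat_proj X) = 1}" "Y \<in> {X \<in> carrier GLhat. det (GLhat_proj X) = 1}"
    then show "X \<otimes>\<^bsub>GLhat\<^esub> Y \<in> {X \<in> carrier GLhat. det (GLhat_proj X) = 1}"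
      by (simp add: GLhat_proj_mult det_mul)
  qed auto
qed

lemma group_SLhat: "group SLhat"
  unfolding SLhat_def by (rule subgroup.subgroup_is_group[OF subgroup_SLhat group_GLhat])

section \<open>The representation\<close>

lemma group_actionI:
  fixes G (structure)
  assumes "group G"
    and closed: "\<And>a x. a \<in> carrier G \<Longrightarrow> x \<in> E \<Longrightarrow> \<phi> a x \<in> E"
    and ext: "\<And>a. a \<in> carrier G \<Longrightarrow> \<phi> a \<in> extensional E"
    and mult: "\<And>a b x. a \<in> carrier G \<Longrightarrow> b \<in> carrier G \<Longrightarrow> x \<in> E \<Longrightarrow> \<phi> (a \<otimes> b) x = \<phi> a (\<phi> b x)"
    and one: "\<And>x. x \<in> E \<Longrightarrow> \<phi> \<one> x = x"
  shows "group_action G E \<phi>"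
proof -
  interpret group G by fact
  have bij: "\<phi> a \<in> Bij E" if a: "a \<in> carrier G" for a
  proof -
    have "bij_betw (\<phi> a) E E"
    proof (rule bij_betw_byWitness[where f'="\<phi> (inv a)"])
      show "\<forall>x\<in>E. \<phi> (inv a) (\<phi> a x) = x" "\<forall>x\<in>E. \<phi> a (\<phi> (inv a) x) = x"
        using a one by (simp_all flip: mult)
    qed (use a closed in auto)
    then show ?thesis using ext[OF a] by (simp add: Bij_def)
  qed
  have "\<phi> (a \<otimes> b) = compose E (\<phi> a) (\<phi> b)" if "a \<in> carrier G" "b \<in> carrier G" for a b
    by (rule extensionalityI[where A=E]) (use that ext mult in \<open>auto simp: compose_def\<close>)
  then have "\<phi> \<in> hom G (BijGroup E)"
    using bij by (auto simp: hom_def BijGroup_def)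
  then show ?thesis
    by (intro group_action.intro group_hom.intro group_BijGroup group_hom_axioms.intro \<open>group G\<close>)
qed

lemma pi_op_closed: "\<alpha> \<in> Mhat \<Longrightarrow> f \<in> schwartz_space \<Longrightarrow> pi_op \<alpha> f \<in> schwartz_space"
  by (cases \<alpha>) (simp add: pi_op_schwartz)

lemma pi_op_scalar: "pi_op \<alpha> (\<lambda>x. c * f x) = (\<lambda>x. c * pi_op \<alpha> f x)"
  by (cases \<alpha>) (simp add: pi_op_def fun_eq_iff)

lemma pi_op_plus:
  "\<alpha> \<in> Mhat \<Longrightarrow> f \<in> schwartz_space \<Longrightarrow> h \<in> schwartz_space \<Longrightarrow>
     pi_op \<alpha> (\<lambda>x. f x + h x) = (\<lambda>x. pi_op \<alpha> f x + pi_op \<alpha> h x)"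
  by (cases \<alpha>) (simp add: pi_op_add)

lemma schwartz_eigenspace_iff:
  "f \<in> schwartz_eigenspace lam \<longleftrightarrow> f \<in> schwartz_space \<and> pi_op (t_lift 1) f = (\<lambda>x. lam * f x)"
  by (simp add: schwartz_eigenspace_def t_lift_def)

lemma eigenspace_add:
  "f \<in> schwartz_eigenspace lam \<Longrightarrow> h \<in> schwartz_eigenspace lam \<Longrightarrow> (\<lambda>x. f x + h x) \<in> schwartz_eigenspace lam"
  by (simp add: schwartz_eigenspace_iff schwartz_add pi_op_plus distrib_left del: One_nat_def)

lemma eigenspace_cmult:
  "f \<in> schwartz_eigenspace lam \<Longrightarrow> (\<lambda>x. c * f x) \<in> schwartz_eigenspace lam"
  by (simp add: schwartz_eigenspace_iff schwartz_cmult pi_op_scalar mult.left_commute del: One_nat_def)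

lemma eigenspace_zero: "(\<lambda>_. 0) \<in> schwartz_eigenspace lam"
  by (simp add: schwartz_eigenspace_iff schwartz_zero) (simp add: t_lift_def pi_op_def)

lemma complex_function_space_eigenspace: "complex_function_space (schwartz_eigenspace lam)"
  unfolding complex_function_space_def by (intro conjI ballI allI eigenspace_zero eigenspace_add eigenspace_cmult)

lemma eigenspace_schwartz: "f \<in> schwartz_eigenspace lam \<Longrightarrow> f \<in> schwartz_space"
  by (simp add: schwartz_eigenspace_def)

lemma pi_op_t_lift_eigenspace:
  assumes f: "f \<in> schwartz_eigenspace lam" shows "pi_op (t_lift l) f = (\<lambda>x. lam ^ l * f x)"
proof (induction l)
  case 0
  then show ?case by (simp add: pi_op_t_lift_0)
next
  case (Suc l)
  have "(t_lift (Suc l) :: 'a Fmat \<times> _) = Mhat_mult (t_lift 1) (t_lift l)" by (simp add: t_lift_mult)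
  then have "pi_op (t_lift (Suc l)) f = pi_op (t_lift 1) (\<lambda>x. lam ^ l * f x)"
    using Suc by (simp only: pi_op_mult[OF t_lift_Mhat t_lift_Mhat eigenspace_schwartz[OF f]])
  also have "\<dots> = (\<lambda>x. lam ^ l * (lam * f x))"
    using f by (simp only: pi_op_scalar schwartz_eigenspace_iff)
  finally show ?case by (simp add: mult_ac)
qed

text \<open>The operator of \<open>T_1\<close> commutes with that of \<open>\<alpha>\<close> by centrality.\<close>

lemma pi_op_eigenspace:
  assumes \<alpha>: "\<alpha> \<in> Mhat0" and f: "f \<in> schwartz_eigenspace lam"
  shows "pi_op \<alpha> f \<in> schwartz_eigenspace lam"
proof -
  have \<alpha>M: "\<alpha> \<in> Mhat" and fS: "f \<in> schwartz_space" using \<alpha> f by (auto simp: Mhat0_iff eigenspace_schwartz)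
  have "pi_op (t_lift 1) (pi_op \<alpha> f) = pi_op (Mhat_mult (t_lift 1) \<alpha>) f"
    by (rule pi_op_mult[OF t_lift_Mhat \<alpha>M fS, symmetric])
  also have "\<dots> = pi_op (Mhat_mult \<alpha> (t_lift 1)) f" by (simp only: t_lift_central[OF \<alpha>])
  also have "\<dots> = pi_op \<alpha> (pi_op (t_lift 1) f)" by (rule pi_op_mult[OF \<alpha>M t_lift_Mhat fS])
  also have "pi_op (t_lift 1) f = (\<lambda>x. lam * f x)" using f by (simp only: schwartz_eigenspace_iff)
  finally show ?thesis
    using pi_op_closed[OF \<alpha>M fS] by (simp only: schwartz_eigenspace_iff pi_op_scalar simp_thms)
qed

definition Gtilde_op :: "complex \<Rightarrow> ('n::finite) gtilde \<Rightarrow> ('n Fvec \<Rightarrow> complex) \<Rightarrow> 'n Fvec \<Rightarrow> complex" where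
  "Gtilde_op lam p f = (\<lambda>x. lam powi (fst p) * pi_op (snd p) f x)"

context
  fixes lam :: complex
  assumes lam: "lam \<noteq> 0"
begin

lemma Gtilde_op_closed:
  assumes "p \<in> Gtilde" "f \<in> schwartz_eigenspace lam"
  shows "Gtilde_op lam p f \<in> schwartz_eigenspace lam"
  using assms by (simp add: Gtilde_op_def Gtilde_iff pi_op_eigenspace eigenspace_cmult)

text \<open>On the eigenspace \<open>T_l\<close> acts by \<open>\<lambda>^l\<close>, which is exactly the change of the scalar prefactor.\<close>

lemma Gtilde_op_equiv:
  assumes "Gtilde_equiv p q" "f \<in> schwartz_eigenspace lam"
  shows "Gtilde_op lam p f = Gtilde_op lam q f"
  using assms(1)
proof (induction rule: Gtilde_equiv_induct)
  case (shift k l \<alpha>)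
  have "\<alpha> \<in> Mhat" using shift by (simp add: Mhat0_iff)
  then have "pi_op (Mhat_mult (t_lift l) \<alpha>) f = (\<lambda>x. lam ^ l * pi_op \<alpha> f x)"
    using assms(2) shift
    by (simp only: pi_op_mult t_lift_Mhat eigenspace_schwartz pi_op_t_lift_eigenspace[OF pi_op_eigenspace])
  then show ?case
    using lam by (simp add: Gtilde_op_def power_int_add mult.assoc)
qed simp_all

lemma Gtilde_op_mult:
  assumes "p \<in> Gtilde" "q \<in> Gtilde" "f \<in> schwartz_eigenspace lam"
  shows "Gtilde_op lam (Gtilde_mult p q) f = Gtilde_op lam p (Gtilde_op lam q f)"
proof -
  have "snd p \<in> Mhat" "snd q \<in> Mhat" using assms by (auto simp: Gtilde_iff Mhat0_iff)
  then show ?thesis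
    using lam assms(3)
    by (simp add: Gtilde_op_def Gtilde_mult_eq pi_op_mult eigenspace_schwartz pi_op_scalar power_int_add mult_ac)
qed

text \<open>Restricted to the eigenspace, since the bijections of a set form a group only as extensional
functions.\<close>

definition GLhat_action :: "('n::finite) gtilde set \<Rightarrow> ('n Fvec \<Rightarrow> complex) \<Rightarrow> 'n Fvec \<Rightarrow> complex" where
  "GLhat_action X = (\<lambda>f\<in>schwartz_eigenspace lam. Gtilde_op lam (SOME p. p \<in> X) f)"

lemma GLhat_action_class:
  assumes p: "p \<in> Gtilde" and f: "f \<in> schwartz_eigenspace lam"
  shows "GLhat_action (Gtilde_class p) f = Gtilde_op lam p f"
proof -
  have "(SOME q. q \<in> Gtilde_class p) \<in> Gtilde_class p" by (rule someI[of _ p]) (rule Gtilde_class_self[OF p])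
  then have "Gtilde_equiv p (SOME q. q \<in> Gtilde_class p)" by (simp only: in_Gtilde_class)
  from Gtilde_op_equiv[OF this f] show ?thesis using f by (simp add: GLhat_action_def)
qed

lemma GLhat_action_mult:
  assumes "X \<in> carrier GLhat" "Y \<in> carrier GLhat" "f \<in> schwartz_eigenspace lam"
  shows "GLhat_action (X \<otimes>\<^bsub>GLhat\<^esub> Y) f = GLhat_action X (GLhat_action Y f)"
  using assms
  by (auto simp: carrier_GLhat GLhat_mult_class GLhat_action_class Gtilde_mult_closed Gtilde_op_mult Gtilde_op_closed)

text \<open>Stated for any group with the operations of the extension, to cover it and its subgroup over SL_n(F)
at once.\<close>

lemma linear_representation_of_subgroup:
  fixes G :: "('n::finite) gtilde set monoid"
  assumes G: "group G" and carrier: "carrier G \<subseteq> carrier GLhat"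
    and mult: "mult G = mult GLhat" and one: "one G = one GLhat"
  shows "linear_representation G (schwartz_eigenspace lam) GLhat_action"
  unfolding linear_representation_def
proof (intro conjI ballI allI complex_function_space_eigenspace)
  show "group_action G (schwartz_eigenspace lam) GLhat_action"
  proof (rule group_actionI[OF G])
    fix X and f :: "'n Fvec \<Rightarrow> complex" assume "X \<in> carrier G" "f \<in> schwartz_eigenspace lam"
    then show "GLhat_action X f \<in> schwartz_eigenspace lam"
      using carrier by (auto simp: carrier_GLhat GLhat_action_class Gtilde_op_closed)
  next
    fix X :: "'n gtilde set" show "GLhat_action X \<in> extensional (schwartz_eigenspace lam)" by (simp add: GLhat_action_def)
  next
    fix X Y and f :: "'n Fvec \<Rightarrow> complex" assume "X \<in> carrier G" "Y \<in> carrier G" "f \<in> schwartz_eigenspace lam"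
    then show "GLhat_action (X \<otimes>\<^bsub>G\<^esub> Y) f = GLhat_action X (GLhat_action Y f)"
      using carrier unfolding mult by (intro GLhat_action_mult) auto
  next
    fix f :: "'n Fvec \<Rightarrow> complex" assume "f \<in> schwartz_eigenspace lam"
    then show "GLhat_action \<one>\<^bsub>G\<^esub> f = f"
      unfolding one one_GLhat
      by (simp add: GLhat_action_class one_in_Gtilde Gtilde_op_def pi_op_t_lift_0)
  qed
next
  fix X and f h :: "'n Fvec \<Rightarrow> complex" assume "X \<in> carrier G" and fh: "f \<in> schwartz_eigenspace lam" "h \<in> schwartz_eigenspace lam"
  then obtain p where p: "p \<in> Gtilde" "X = Gtilde_class p" using carrier by (auto simp: carrier_GLhat)
  have "(\<lambda>x. f x + h x) \<in> schwartz_eigenspace lam" using fh by (rule eigenspace_add)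
  then show "GLhat_action X (\<lambda>x. f x + h x) = (\<lambda>x. GLhat_action X f x + GLhat_action X h x)"
    using p fh by (simp add: GLhat_action_class Gtilde_op_def pi_op_plus eigenspace_schwartz
      Gtilde_iff Mhat0_iff distrib_left)
next
  fix X c and f :: "'n Fvec \<Rightarrow> complex" assume "X \<in> carrier G" and f: "f \<in> schwartz_eigenspace lam"
  then obtain p where p: "p \<in> Gtilde" "X = Gtilde_class p" using carrier by (auto simp: carrier_GLhat)
  have "(\<lambda>x. c * f x) \<in> schwartz_eigenspace lam"
    using f by (rule eigenspace_cmult)
  then show "GLhat_action X (\<lambda>x. c * f x) = (\<lambda>x. c * GLhat_action X f x)"
    using p f by (simp add: GLhat_action_class Gtilde_op_def pi_op_scalar mult_ac)
qed

end

theorem theorem2p4: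
  fixes lam :: complex
  assumes "lam \<noteq> 0"
  shows "\<exists>\<rho> :: ('n::finite) gtilde set \<Rightarrow> ('n Fvec \<Rightarrow> complex) \<Rightarrow> 'n Fvec \<Rightarrow> complex.
     linear_representation (GLhat :: 'n gtilde set monoid) (schwartz_eigenspace lam) \<rho> \<and>
     (\<forall>l g \<mu>. (l, (g, \<mu>)) \<in> Gtilde \<longrightarrow>
        (\<forall>f\<in>schwartz_eigenspace lam.
           \<rho> (Gtilde_class (l, (g, \<mu>))) f = (\<lambda>x. lam powi l * pi_op (g, \<mu>) f x) \<and>
           \<rho> (Gtilde_class (l, (g, \<mu>))) f
             = (\<lambda>x. lam powi l * (\<integral>y. f (matrix_inv g *v x + y) \<partial>\<mu>)))) \<and>
     linear_representation (SLhat :: 'n gtilde set monoid) (schwartz_eigenspace lam) \<rho>"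
proof (intro exI[of _ "GLhat_action lam"] conjI allI impI ballI)
  show "linear_representation (GLhat :: 'n gtilde set monoid) (schwartz_eigenspace lam) (GLhat_action lam)"
    by (rule linear_representation_of_subgroup[OF assms group_GLhat]) simp_all
  show "linear_representation (SLhat :: 'n gtilde set monoid) (schwartz_eigenspace lam) (GLhat_action lam)"
    by (rule linear_representation_of_subgroup[OF assms group_SLhat]) (auto simp: SLhat_def)
  fix l \<mu> and g :: "'n Fmat" and f :: "'n Fvec \<Rightarrow> complex"
  assume "(l, g, \<mu>) \<in> Gtilde" "f \<in> schwartz_eigenspace lam"
  then show *: "GLhat_action lam (Gtilde_class (l, g, \<mu>)) f = (\<lambda>x. lam powi l * pi_op (g, \<mu>) f x)"
    using GLhat_action_class[OF assms, of "(l, g, \<mu>)" f] by (simp add: Gtilde_op_def)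
  then show "GLhat_action lam (Gtilde_class (l, g, \<mu>)) f
      = (\<lambda>x. lam powi l * (\<integral>y. f (matrix_inv g *v x + y) \<partial>\<mu>))"
    by (simp add: pi_op_def)
qed

end
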